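(* Let $n\ge 3$, let $\mathbb F=\mathbb C$, and let $(A_n,\mu)$ be the $(n+1)$-dimensional simple $n$-Lie algebra over $\mathbb F$, i.e. the vector space with basis $e_1,\dots,e_{n+1}$ and alternating $n$-linear multiplication determined by $\mu(e_1,\dots,\widehat{e_i},\dots,e_{n+1})=e_i$ for $1\le i\le n+1$. Let $\Delta:A_n\to A_n^{\wedge n}$ be a linear map, with dual map $\Delta^*:(A_n^* )^{\otimes n}\to A_n^*$. Then the triple $(A_n,\mu,\Delta)$ is an $n$-Lie bialgebra if and only if one of the following holds: (i) $R(\Delta)=0$ (that is, $(A_n^*,\Delta^* )$ is the abelian $n$-Lie algebra); or (ii) $R(\Delta)=2$ and $(A_n^*,\Delta^* )$ is an $n$-Lie algebra of type $(c_3)$.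
   Context: A hat means omission. An $n$-Lie algebra $(L,\mu)$ is a vector space $L$ over $\mathbb F$ with an alternating $n$-linear map $\mu:L^{\otimes n}\to L$ (so $\mu(x_1,\dots,x_n)=\mathrm{sign}(\sigma)\mu(x_{\sigma(1)},\dots,x_{\sigma(n)})$ for $\sigma\in S_n$) satisfying $$\mu(x_1,\dots,x_{n-1},\mu(y_1,\dots,y_n))=\sum_{s=1}^n(-1)^{n-s}\mu(y_1,\dots,\widehat{y_s},\dots,y_n,\mu(x_1,\dots,x_{n-1},y_s)).$$ $L^{\wedge n}$ is regarded as the space of skew-symmetric tensors in $L^{\otimes n}$, with $v_1\wedge\cdots\wedge v_n=\sum_{\sigma\in S_n}\mathrm{sign}(\sigma)v_{\sigma(1)}\otimes\cdots\otimes v_{\sigma(n)}$. For finite-dimensional $L$ and linear $\Delta:L\to L^{\otimes n}$, the dual map $\Delta^*:(L^* )^{\otimes n}\to L^*$ is given by $\langle\Delta^*(y^1,\dots,y^n),x\rangle=\langle y^1\otimes\cdots\otimes y^n,\Delta(x)\rangle$, where tensors are paired factorwise. An $n$-Lie coalgebra $(L,\Delta)$ is a vector space $L$ with a linear map $\Delta:L\to L^{\wedge n}$ such that $\big(1-\sum_{s=1}^n(-1)^{n-s}\omega_s\big)(1^{\otimes(n-1)}\otimes\Delta)\Delta=0$, where $\omega_s:L^{\otimes(n-1)}\otimes L^{\otimes n}\to L^{\otimes(n-1)}\otimes L^{\otimes n}$ is the linear map determined by $$\langle x_1\otimes\cdots\otimes x_{n-1}\otimes y_1\otimes\cdots\otimes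 y_n,\ \omega_s(w)\rangle=\langle y_1\otimes\cdots\otimes\widehat{y_s}\otimes\cdots\otimes y_n\otimes x_1\otimes\cdots\otimes x_{n-1}\otimes y_s,\ w\rangle$$ for all $x_i,y_j\in L^*$ and $w\in L^{\otimes(2n-1)}$. An $n$-Lie bialgebra is a triple $(L,\mu,\Delta)$ such that $(L,\mu)$ is an $n$-Lie algebra, $(L,\Delta)$ is an $n$-Lie coalgebra, and for all $x_1,\dots,x_n\in L$ $$\Delta\mu(x_1,\dots,x_n)=\sum_{s=1}^n\sum_{k=1}^n(-1)^{n-k}\rho^\mu_s(x_1,\dots,\widehat{x_k},\dots,x_n)\Delta(x_k),$$ where $\rho^\mu_s(z_1,\dots,z_{n-1})(y_1\otimes\cdots\otimes y_n)=y_1\otimes\cdots\otimes y_{s-1}\otimes\mu(z_1,\dots,z_{n-1},y_s)\otimes y_{s+1}\otimes\cdots\otimes y_n$. The rank $R(\Delta)$ of an $n$-Lie coalgebra $(L,\Delta)$ is the dimension of the derived algebra of the $n$-Lie algebra $(L^*,\Delta^* )$, i.e. of the span of all $\Delta^*(f_1,\dots,f_n)$, $f_i\in L^*$. An $(n+1)$-dimensional $n$-Lie algebra is of type $(c_3)$ if it is isomorphic to the $n$-Lie algebra with basis $f_1,\dots,f_{n+1}$ whose only nonzero brackets of basis vectors (up to permutation of arguments) are $[f_1,f_3,\dots,f_{n+1}]=f_1$ and $[f_2,f_3,\dots,f_{n+1}]=f_2$. *)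

theory Defs
  imports Complex_Main "HOL-Library.Function_Algebras" "HOL-Combinatorics.Permutations"
begin

text \<open>
  A vector space is given by a scalar multiplication \<open>scale\<close> in the sense of the locale
  \<^locale>\<open>vector_space\<close>.  An \<open>n\<close>-ary operation is a function on lists, of which only the values
  at lists of length \<open>n\<close> matter.  List positions start at \<open>0\<close>, so the mathematical index
  \<open>s\<close> is the position \<open>s - 1\<close> and the sign \<open>(-1)^(n-s)\<close> reads \<open>(-1)^(n - Suc s)\<close>.
\<close>

definition fscale :: "'f::field \<Rightarrow> ('x \<Rightarrow> 'f) \<Rightarrow> 'x \<Rightarrow> 'f" where
  "fscale c g = (\<lambda>x. c * g x)"

definition omit :: "nat \<Rightarrow> 'a list \<Rightarrow> 'a list" where
  "omit i xs = take i xs @ drop (Suc i) xs"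

definition is_basis :: "('f::field \<Rightarrow> 'v::ab_group_add \<Rightarrow> 'v) \<Rightarrow> 'v set \<Rightarrow> 'v list \<Rightarrow> bool" where
  "is_basis scale V bs \<longleftrightarrow>
     distinct bs \<and> \<not> module.dependent scale (set bs) \<and> module.span scale (set bs) = V"


section \<open>\<open>n\<close>-Lie algebras\<close>

text \<open>The underlying space is a subspace \<open>V\<close> of a vector space, so that the dual space
  of linear functionals is covered as well.\<close>

definition multilinear_on ::
  "('f::field \<Rightarrow> 'v::ab_group_add \<Rightarrow> 'v) \<Rightarrow> nat \<Rightarrow> 'v set \<Rightarrow> ('v list \<Rightarrow> 'v) \<Rightarrow> bool" where
  "multilinear_on scale n V \<mu> \<longleftrightarrow>
     (\<forall>xs. length xs = n \<and> set xs \<subseteq> V \<longrightarrow> \<mu> xs \<in> V \<and>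
        (\<forall>i<n. \<forall>x\<in>V. \<forall>y\<in>V. \<forall>c.
           \<mu> (xs[i := x + y]) = \<mu> (xs[i := x]) + \<mu> (xs[i := y]) \<and>
           \<mu> (xs[i := scale c x]) = scale c (\<mu> (xs[i := x]))))"

definition alternating_on ::
  "('f::field \<Rightarrow> 'v::ab_group_add \<Rightarrow> 'v) \<Rightarrow> nat \<Rightarrow> 'v set \<Rightarrow> ('v list \<Rightarrow> 'v) \<Rightarrow> bool" where
  "alternating_on scale n V \<mu> \<longleftrightarrow>
     (\<forall>xs \<sigma>. length xs = n \<and> set xs \<subseteq> V \<and> \<sigma> permutes {..<n} \<longrightarrow>
        \<mu> xs = scale (of_int (sign \<sigma>)) (\<mu> (permute_list \<sigma> xs)))"

definition n_lie_algebra ::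
  "('f::field \<Rightarrow> 'v::ab_group_add \<Rightarrow> 'v) \<Rightarrow> nat \<Rightarrow> 'v set \<Rightarrow> ('v list \<Rightarrow> 'v) \<Rightarrow> bool" where
  "n_lie_algebra scale n V \<mu> \<longleftrightarrow>
     vector_space scale \<and> module.subspace scale V \<and>
     multilinear_on scale n V \<mu> \<and> alternating_on scale n V \<mu> \<and>
     (\<forall>xs ys. length xs = n - 1 \<and> set xs \<subseteq> V \<and> length ys = n \<and> set ys \<subseteq> V \<longrightarrow>
        \<mu> (xs @ [\<mu> ys]) =
        (\<Sum>s<n. scale ((-1) ^ (n - Suc s)) (\<mu> (omit s ys @ [\<mu> (xs @ [ys ! s])]))))"

definition derived_algebra ::
  "('f::field \<Rightarrow> 'v::ab_group_add \<Rightarrow> 'v) \<Rightarrow> nat \<Rightarrow> 'v set \<Rightarrow> ('v list \<Rightarrow> 'v) \<Rightarrow> 'v set" where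
  "derived_algebra scale n V \<mu> = module.span scale {\<mu> xs |xs. length xs = n \<and> set xs \<subseteq> V}"

definition n_lie_iso ::
  "('f::field \<Rightarrow> 'v::ab_group_add \<Rightarrow> 'v) \<Rightarrow> ('f \<Rightarrow> 'w::ab_group_add \<Rightarrow> 'w) \<Rightarrow> nat \<Rightarrow>
     'v set \<Rightarrow> ('v list \<Rightarrow> 'v) \<Rightarrow> 'w set \<Rightarrow> ('w list \<Rightarrow> 'w) \<Rightarrow> ('v \<Rightarrow> 'w) \<Rightarrow> bool" where
  "n_lie_iso scale scale' n V \<mu> W \<nu> \<phi> \<longleftrightarrow>
     bij_betw \<phi> V W \<and>
     (\<forall>x\<in>V. \<forall>y\<in>V. \<phi> (x + y) = \<phi> x + \<phi> y) \<and>
     (\<forall>c. \<forall>x\<in>V. \<phi> (scale c x) = scale' c (\<phi> x)) \<and>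
     (\<forall>xs. length xs = n \<and> set xs \<subseteq> V \<longrightarrow> \<phi> (\<mu> xs) = \<nu> (map \<phi> xs))"

definition coord_space :: "nat \<Rightarrow> (nat \<Rightarrow> 'f::field) set" where
  "coord_space m = {g. \<forall>i\<ge>m. g i = 0}"

definition unit_vectors :: "nat \<Rightarrow> (nat \<Rightarrow> 'f::field) list" where
  "unit_vectors m = map (\<lambda>i j. if j = i then 1 else 0) [0..<m]"

text \<open>
  Since the bracket is alternating, it is given by the brackets of \<open>n\<close> distinct basis vectors in
  increasing order, that is, with one of the \<open>n + 1\<close> basis vectors omitted: omitting
  \<open>f\<^sub>2\<close> gives \<open>[f\<^sub>1, f\<^sub>3, \<dots>] = f\<^sub>1\<close>, and omitting \<open>f\<^sub>1\<close> gives \<open>[f\<^sub>2, f\<^sub>3, \<dots>] = f\<^sub>2\<close>.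
\<close>

definition c3_bracket :: "nat \<Rightarrow> ((nat \<Rightarrow> 'f::field) list \<Rightarrow> (nat \<Rightarrow> 'f)) \<Rightarrow> bool" where
  "c3_bracket n \<nu> \<longleftrightarrow>
     n_lie_algebra fscale n (coord_space (n + 1)) \<nu> \<and>
     (let fs = unit_vectors (n + 1) in
        \<nu> (omit 1 fs) = fs ! 0 \<and> \<nu> (omit 0 fs) = fs ! 1 \<and>
        (\<forall>i. 2 \<le> i \<and> i \<le> n \<longrightarrow> \<nu> (omit i fs) = 0))"

definition type_c3 ::
  "('f::field \<Rightarrow> 'v::ab_group_add \<Rightarrow> 'v) \<Rightarrow> nat \<Rightarrow> 'v set \<Rightarrow> ('v list \<Rightarrow> 'v) \<Rightarrow> bool" where
  "type_c3 scale n V \<mu> \<longleftrightarrow>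
     n_lie_algebra scale n V \<mu> \<and>
     (\<exists>\<nu> \<phi>. c3_bracket n \<nu> \<and> n_lie_iso scale fscale n V \<mu> (coord_space (n + 1)) \<nu> \<phi>)"


section \<open>Tensor powers\<close>

definition dual_space :: "('f::field \<Rightarrow> 'v::ab_group_add \<Rightarrow> 'v) \<Rightarrow> ('v \<Rightarrow> 'f) set" where
  "dual_space scale = {f. Vector_Spaces.linear scale (*) f}"

text \<open>
  Over a field, the canonical map from the \<open>k\<close>-th tensor power of \<open>L\<close> to the \<open>k\<close>-linear forms on \<open>L\<^sup>*\<close>, which sends
  \<open>x\<^sub>1 \<otimes> \<dots> \<otimes> x\<^sub>k\<close> to \<open>(f\<^sub>1, \<dots>, f\<^sub>k) \<mapsto> f\<^sub>1(x\<^sub>1) \<dots> f\<^sub>k(x\<^sub>k)\<close>, is injective.  The tensor power is taken to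
  be its image, the span of the pure tensors.  Thus \<open>t [f\<^sub>1, \<dots>, f\<^sub>k]\<close> is the factorwise pairing
  \<open>\<langle>f\<^sub>1 \<otimes> \<dots> \<otimes> f\<^sub>k, t\<rangle>\<close>.  A tensor is \<open>0\<close> at all lists other than the \<open>k\<close>-tuples of linear
  functionals, so that equality of tensors is equality of functions.
\<close>

definition functional_tuples ::
  "('f::field \<Rightarrow> 'v::ab_group_add \<Rightarrow> 'v) \<Rightarrow> nat \<Rightarrow> ('v \<Rightarrow> 'f) list set" where
  "functional_tuples scale k = {fs. length fs = k \<and> set fs \<subseteq> dual_space scale}"

definition pure_tensor ::
  "('f::field \<Rightarrow> 'v::ab_group_add \<Rightarrow> 'v) \<Rightarrow> 'v list \<Rightarrow> ('v \<Rightarrow> 'f) list \<Rightarrow> 'f" where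
  "pure_tensor scale xs = (\<lambda>fs.
     if fs \<in> functional_tuples scale (length xs) then \<Prod>i<length xs. (fs ! i) (xs ! i) else 0)"

definition tensor_power ::
  "('f::field \<Rightarrow> 'v::ab_group_add \<Rightarrow> 'v) \<Rightarrow> nat \<Rightarrow> (('v \<Rightarrow> 'f) list \<Rightarrow> 'f) set" where
  "tensor_power scale k = module.span fscale {pure_tensor scale xs |xs. length xs = k}"

definition wedge_power ::
  "('f::field \<Rightarrow> 'v::ab_group_add \<Rightarrow> 'v) \<Rightarrow> nat \<Rightarrow> (('v \<Rightarrow> 'f) list \<Rightarrow> 'f) set" where
  "wedge_power scale k = {t \<in> tensor_power scale k.
     \<forall>fs\<in>functional_tuples scale k. \<forall>\<sigma>. \<sigma> permutes {..<k} \<longrightarrow>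
       t (permute_list \<sigma> fs) = of_int (sign \<sigma>) * t fs}"

definition tensor_product ::
  "('f::field \<Rightarrow> 'v::ab_group_add \<Rightarrow> 'v) \<Rightarrow> nat \<Rightarrow> nat \<Rightarrow>
     (('v \<Rightarrow> 'f) list \<Rightarrow> 'f) \<Rightarrow> (('v \<Rightarrow> 'f) list \<Rightarrow> 'f) \<Rightarrow> ('v \<Rightarrow> 'f) list \<Rightarrow> 'f" where
  "tensor_product scale p q t u = (\<lambda>fs.
     if fs \<in> functional_tuples scale (p + q) then t (take p fs) * u (drop p fs) else 0)"


section \<open>\<open>n\<close>-Lie coalgebras and bialgebras\<close>

text \<open>The map \<open>1 \<otimes> \<dots> \<otimes> 1 \<otimes> \<Delta>\<close>, with \<open>n - 1\<close> identity factors, from tensors of degree \<open>n\<close> to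
  tensors of degree \<open>2 * n - 1\<close>; its values at pure tensors are computed in the lemma
  \<open>id_tensor_map_pure\<close> below.\<close>

definition id_tensor_map ::
  "('f::field \<Rightarrow> 'v::ab_group_add \<Rightarrow> 'v) \<Rightarrow> nat \<Rightarrow> ('v \<Rightarrow> ('v \<Rightarrow> 'f) list \<Rightarrow> 'f) \<Rightarrow>
     (('v \<Rightarrow> 'f) list \<Rightarrow> 'f) \<Rightarrow> ('v \<Rightarrow> 'f) list \<Rightarrow> 'f" where
  "id_tensor_map scale n \<Delta> t = (\<lambda>fs.
     if fs \<in> functional_tuples scale (2 * n - 1)
     then t (take (n - 1) fs @ [\<lambda>x. \<Delta> x (drop (n - 1) fs)]) else 0)"

definition omega ::
  "('f::field \<Rightarrow> 'v::ab_group_add \<Rightarrow> 'v) \<Rightarrow> nat \<Rightarrow> nat \<Rightarrow>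
     (('v \<Rightarrow> 'f) list \<Rightarrow> 'f) \<Rightarrow> ('v \<Rightarrow> 'f) list \<Rightarrow> 'f" where
  "omega scale n s w = (\<lambda>fs.
     if fs \<in> functional_tuples scale (2 * n - 1)
     then let xs = take (n - 1) fs; ys = drop (n - 1) fs in w (omit s ys @ xs @ [ys ! s])
     else 0)"

definition n_lie_coalgebra ::
  "('f::field \<Rightarrow> 'v::ab_group_add \<Rightarrow> 'v) \<Rightarrow> nat \<Rightarrow> ('v \<Rightarrow> ('v \<Rightarrow> 'f) list \<Rightarrow> 'f) \<Rightarrow> bool" where
  "n_lie_coalgebra scale n \<Delta> \<longleftrightarrow>
     vector_space scale \<and> Vector_Spaces.linear scale fscale \<Delta> \<and>
     range \<Delta> \<subseteq> wedge_power scale n \<and>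
     (\<forall>x. let w = id_tensor_map scale n \<Delta> (\<Delta> x) in
        w - (\<Sum>s<n. fscale ((-1) ^ (n - Suc s)) (omega scale n s w)) = 0)"

text \<open>The map \<open>\<rho>\<^sup>\<mu>\<^sub>s(zs)\<close>: applying \<open>\<mu>(zs, -)\<close> to the tensor factor at position
  \<open>s\<close> amounts to composing the functional at position \<open>s\<close> with it, see the lemma \<open>rho_pure\<close>.\<close>

definition rho ::
  "('f::field \<Rightarrow> 'v::ab_group_add \<Rightarrow> 'v) \<Rightarrow> nat \<Rightarrow> ('v list \<Rightarrow> 'v) \<Rightarrow> nat \<Rightarrow> 'v list \<Rightarrow>
     (('v \<Rightarrow> 'f) list \<Rightarrow> 'f) \<Rightarrow> ('v \<Rightarrow> 'f) list \<Rightarrow> 'f" where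
  "rho scale n \<mu> s zs t = (\<lambda>fs.
     if fs \<in> functional_tuples scale n
     then t (fs[s := \<lambda>y. (fs ! s) (\<mu> (zs @ [y]))]) else 0)"

definition n_lie_bialgebra ::
  "('f::field \<Rightarrow> 'v::ab_group_add \<Rightarrow> 'v) \<Rightarrow> nat \<Rightarrow> ('v list \<Rightarrow> 'v) \<Rightarrow>
     ('v \<Rightarrow> ('v \<Rightarrow> 'f) list \<Rightarrow> 'f) \<Rightarrow> bool" where
  "n_lie_bialgebra scale n \<mu> \<Delta> \<longleftrightarrow>
     n_lie_algebra scale n UNIV \<mu> \<and> n_lie_coalgebra scale n \<Delta> \<and>
     (\<forall>xs. length xs = n \<longrightarrow>
        \<Delta> (\<mu> xs) =
        (\<Sum>s<n. \<Sum>k<n. fscale ((-1) ^ (n - Suc k)) (rho scale n \<mu> s (omit k xs) (\<Delta> (xs ! k)))))"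

definition dual_map :: "('v \<Rightarrow> ('v \<Rightarrow> 'f) list \<Rightarrow> 'f::field) \<Rightarrow> ('v \<Rightarrow> 'f) list \<Rightarrow> 'v \<Rightarrow> 'f" where
  "dual_map \<Delta> fs = (\<lambda>x. \<Delta> x fs)"

definition coalgebra_rank ::
  "('f::field \<Rightarrow> 'v::ab_group_add \<Rightarrow> 'v) \<Rightarrow> nat \<Rightarrow> ('v \<Rightarrow> ('v \<Rightarrow> 'f) list \<Rightarrow> 'f) \<Rightarrow> nat" where
  "coalgebra_rank scale n \<Delta> =
     vector_space.dim fscale (derived_algebra fscale n (dual_space scale) (dual_map \<Delta>))"


section \<open>The operations on pure tensors\<close>

lemma vector_space_fscale: "vector_space (fscale :: 'f::field \<Rightarrow> ('x \<Rightarrow> 'f) \<Rightarrow> 'x \<Rightarrow> 'f)"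
  by unfold_locales (auto simp: fscale_def fun_eq_iff algebra_simps)

lemma pure_tensor_append:
  "pure_tensor scale (xs @ ys) =
   tensor_product scale (length xs) (length ys) (pure_tensor scale xs) (pure_tensor scale ys)"
proof
  fix fs
  have split: "(\<Prod>i<m + k. h i) = (\<Prod>i<m. h i) * (\<Prod>i<k. h (m + i))"
    for m k :: nat and h :: "nat \<Rightarrow> 'b"
    by (induction k) (simp_all add: mult.assoc)
  show "pure_tensor scale (xs @ ys) fs =
    tensor_product scale (length xs) (length ys) (pure_tensor scale xs) (pure_tensor scale ys) fs"
  proof (cases "fs \<in> functional_tuples scale (length xs + length ys)")
    case True
    then have "take (length xs) fs \<in> functional_tuples scale (length xs)"
      "drop (length xs) fs \<in> functional_tuples scale (length ys)"
      by (auto simp: functional_tuples_def dest: in_set_takeD in_set_dropD)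
    with True show ?thesis
      by (auto simp: pure_tensor_def tensor_product_def split nth_append functional_tuples_def
          intro!: prod.cong)
  next
    case False
    then show ?thesis by (simp add: pure_tensor_def tensor_product_def)
  qed
qed

lemma id_tensor_map_pure:
  assumes lin: "Vector_Spaces.linear scale fscale \<Delta>" and len: "length xs = n - 1" and n: "n \<ge> 1"
  shows "id_tensor_map scale n \<Delta> (pure_tensor scale (xs @ [x])) =
         tensor_product scale (n - 1) n (pure_tensor scale xs) (\<Delta> x)"
proof
  fix fs
  interpret \<Delta>: Vector_Spaces.linear scale fscale \<Delta> by (rule lin)
  have dual: "(\<lambda>x. \<Delta> x gs) \<in> dual_space scale" for gs
    unfolding dual_space_def
    by (auto intro!: Vector_Spaces.linear.intro module_hom.intro module_hom_axioms.intro
        \<Delta>.vs1.vector_space_axioms \<Delta>.vs1.module_axioms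
        simp: \<Delta>.add \<Delta>.scale fscale_def vector_space_def module_def algebra_simps)
  have idx: "2 * n - 1 = n - 1 + n" using n by simp
  show "id_tensor_map scale n \<Delta> (pure_tensor scale (xs @ [x])) fs =
        tensor_product scale (n - 1) n (pure_tensor scale xs) (\<Delta> x) fs"
  proof (cases "fs \<in> functional_tuples scale (n - 1 + n)")
    case True
    then have "take (n - 1) fs \<in> functional_tuples scale (n - 1)"
      "take (n - 1) fs @ [\<lambda>x. \<Delta> x (drop (n - 1) fs)] \<in> functional_tuples scale n"
      using n dual by (auto simp: functional_tuples_def dest: in_set_takeD)
    moreover obtain m where "n = Suc m" using n by (cases n) auto
    ultimately show ?thesis
      using True len unfolding id_tensor_map_def idx
      by (auto simp: pure_tensor_def tensor_product_def nth_append functional_tuples_def)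
  next
    case False
    then show ?thesis by (simp only: id_tensor_map_def idx tensor_product_def if_False)
  qed
qed

lemma rho_pure:
  assumes lin: "Vector_Spaces.linear scale scale (\<lambda>y. \<mu> (zs @ [y]))"
    and len: "length ys = n" and s: "s < n"
  shows "rho scale n \<mu> s zs (pure_tensor scale ys) = pure_tensor scale (ys[s := \<mu> (zs @ [ys ! s])])"
proof
  fix fs
  show "rho scale n \<mu> s zs (pure_tensor scale ys) fs =
        pure_tensor scale (ys[s := \<mu> (zs @ [ys ! s])]) fs"
  proof (cases "fs \<in> functional_tuples scale n")
    case True
    then have "fs ! s \<in> dual_space scale"
      using s by (auto simp: functional_tuples_def)
    then have "(\<lambda>y. (fs ! s) (\<mu> (zs @ [y]))) \<in> dual_space scale"
      using Vector_Spaces.linear_compose[OF lin] by (auto simp: dual_space_def comp_def)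
    with True have "fs[s := \<lambda>y. (fs ! s) (\<mu> (zs @ [y]))] \<in> functional_tuples scale n"
      by (auto simp: functional_tuples_def dest: set_update_subset_insert[THEN subsetD])
    with True show ?thesis
      using len s by (auto simp: rho_def pure_tensor_def functional_tuples_def nth_list_update
          intro!: prod.cong split: if_splits)
  next
    case False
    then show ?thesis using len by (simp add: rho_def pure_tensor_def)
  qed
qed

end

theory Submission
  imports Defs
begin

text \<open>
  An alternating \<open>n\<close>-ary bracket on a space of dimension \<open>n + 1\<close> has the form \<open>T \<circ> c\<close>, where \<open>c\<close> is the
  cross product with values in the dual space and \<open>T : V\<^sup>* \<rightarrow> V\<close> is linear.  Its matrix \<open>K\<close> consists of
  the brackets of the basis with one vector omitted, with alternating signs.  The proof translates
  each condition into one on \<open>K\<close>.  The tool is a trace formula (\<open>alternating_form_trace\<close>): an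
  endomorphism \<open>A\<close>, acting as a derivation on the forms \<open>\<Lambda>\<^sup>n V\<^sup>* \<cong> V\<close>, becomes \<open>tr(A) - A\<close>.

  Applied to adjoint maps, the formula turns the Filippov identity into quadratic equations in \<open>K\<close>
  (\<open>n_lie_algebra_iff_filippov_quadric\<close>).  They hold when \<open>K\<close> is symmetric, which settles the simple
  algebra \<open>(A\<^sub>n, \<mu>)\<close>.  Since the coalgebra condition on \<open>\<Delta>\<close> is the Filippov identity for the dual map
  \<open>\<Delta>\<^sup>*\<close> (\<open>n_lie_coalgebra_iff\<close>), they also describe the admissible matrices of \<open>\<Delta>\<^sup>*\<close>.

  Applied on the dual space, the formula turns the compatibility of \<open>\<mu>\<close> and \<open>\<Delta>\<close> into linear equations
  which say that the matrix of \<open>\<Delta>\<^sup>*\<close> is skew-symmetric (\<open>cocycle_iff_skew\<close>).  Hence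
  \<open>(A\<^sub>n, \<mu>, \<Delta>)\<close> is a bialgebra if and only if \<open>\<Delta>\<^sup>*\<close> is an \<open>n\<close>-Lie bracket with skew-symmetric matrix.

  Such a matrix is zero, which is the case of rank \<open>0\<close>, or it has an entry \<open>K p q \<noteq> 0\<close>.  Then two of
  its rows can be made part of a basis of type \<open>(c\<^sub>3)\<close>, and they span the derived algebra
  (\<open>c3_if_skew\<close>).  Conversely, the bracket of type \<open>(c\<^sub>3)\<close> has a skew-symmetric matrix in its own
  basis; skew-symmetry is independent of the basis (\<open>skew_bracket_iff\<close>), so it also holds in the
  basis dual to that of \<open>A\<^sub>n\<close>, where compatibility is tested.
\<close>

section \<open>Alternating forms\<close>

(* Intervals of indices stay whole: omit is compared with lists [0..<d] for symbolic d. *)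
declare upt_Suc [simp del]

definition linear_form_on ::
  "('f::field \<Rightarrow> 'v::ab_group_add \<Rightarrow> 'v) \<Rightarrow> 'v set \<Rightarrow> ('v \<Rightarrow> 'f) \<Rightarrow> bool" where
  "linear_form_on scale V g \<longleftrightarrow>
     (\<forall>x\<in>V. \<forall>y\<in>V. g (x + y) = g x + g y) \<and> (\<forall>c. \<forall>x\<in>V. g (scale c x) = c * g x)"

definition linear_endo_on ::
  "('f::field \<Rightarrow> 'v::ab_group_add \<Rightarrow> 'v) \<Rightarrow> 'v set \<Rightarrow> ('v \<Rightarrow> 'v) \<Rightarrow> bool" where
  "linear_endo_on scale V A \<longleftrightarrow> (\<forall>x\<in>V. A x \<in> V) \<and>
     (\<forall>x\<in>V. \<forall>y\<in>V. A (x + y) = A x + A y) \<and> (\<forall>c. \<forall>x\<in>V. A (scale c x) = scale c (A x))"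

definition multilinear_form_on ::
  "('f::field \<Rightarrow> 'v::ab_group_add \<Rightarrow> 'v) \<Rightarrow> nat \<Rightarrow> 'v set \<Rightarrow> ('v list \<Rightarrow> 'f) \<Rightarrow> bool" where
  "multilinear_form_on scale m V F \<longleftrightarrow>
     (\<forall>xs i x y c. length xs = m \<and> set xs \<subseteq> V \<and> i < m \<and> x \<in> V \<and> y \<in> V \<longrightarrow>
        F (xs[i := x + y]) = F (xs[i := x]) + F (xs[i := y]) \<and>
        F (xs[i := scale c x]) = c * F (xs[i := x]))"

definition alternating_form_on ::
  "('f::field \<Rightarrow> 'v::ab_group_add \<Rightarrow> 'v) \<Rightarrow> nat \<Rightarrow> 'v set \<Rightarrow> ('v list \<Rightarrow> 'f) \<Rightarrow> bool" where
  "alternating_form_on scale m V F \<longleftrightarrow> multilinear_form_on scale m V F \<and>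
     (\<forall>xs \<sigma>. length xs = m \<and> set xs \<subseteq> V \<and> \<sigma> permutes {..<m} \<longrightarrow>
        F (permute_list \<sigma> xs) = of_int (sign \<sigma>) * F xs)"

lemma multilinear_form_add:
  assumes "multilinear_form_on scale m V F" "length xs = m" "set xs \<subseteq> V" "i < m" "x \<in> V" "y \<in> V"
  shows "F (xs[i := x + y]) = F (xs[i := x]) + F (xs[i := y])"
  using assms unfolding multilinear_form_on_def by blast

lemma multilinear_form_scale:
  assumes "multilinear_form_on scale m V F" "length xs = m" "set xs \<subseteq> V" "i < m" "x \<in> V"
  shows "F (xs[i := scale c x]) = c * F (xs[i := x])"
  using assms unfolding multilinear_form_on_def by blast

lemma alternating_form_multilinear:
  "alternating_form_on scale m V F \<Longrightarrow> multilinear_form_on scale m V F"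
  by (simp add: alternating_form_on_def)

lemma alternating_form_permute:
  assumes "alternating_form_on scale m V F" "length xs = m" "set xs \<subseteq> V" "\<sigma> permutes {..<m}"
  shows "F (permute_list \<sigma> xs) = of_int (sign \<sigma>) * F xs"
  using assms unfolding alternating_form_on_def by blast

lemma set_list_update_subset:
  "set xs \<subseteq> V \<Longrightarrow> x \<in> V \<Longrightarrow> set (xs[i := x]) \<subseteq> V"
  using set_update_subset_insert[of xs i x] by blast

lemma alternating_form_swap:
  assumes F: "alternating_form_on scale m V F" and xs: "length xs = m" "set xs \<subseteq> V"
    and ij: "i < m" "j < m" "i \<noteq> j"
  shows "F (xs[i := xs ! j, j := xs ! i]) = - F xs"
proof -
  have p: "transpose i j permutes {..<m}" using ij by (simp add: permutes_swap_id)
  have "permute_list (transpose i j) xs = xs[i := xs ! j, j := xs ! i]"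
    using ij xs
    by (intro nth_equalityI) (auto simp: permute_list_def nth_list_update transpose_def)
  then show ?thesis
    using alternating_form_permute[OF F xs p] ij by (simp add: sign_swap_id)
qed

lemma alternating_form_repeated:
  fixes F :: "'v::ab_group_add list \<Rightarrow> 'f::field_char_0"
  assumes F: "alternating_form_on scale m V F" and xs: "length xs = m" "set xs \<subseteq> V"
    and rep: "\<not> distinct xs"
  shows "F xs = 0"
proof -
  obtain i j where ij: "i < m" "j < m" "i \<noteq> j" "xs ! i = xs ! j"
    using rep xs by (auto simp: distinct_conv_nth)
  then have "F xs = - F xs"
    using alternating_form_swap[OF F xs ij(1-3)] by (metis list_update_id)
  then have "2 * F xs = 0" by simp
  then show ?thesis by simp
qed

lemma alternating_form_move:
  assumes F: "alternating_form_on scale m V F"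
    and len: "length (as @ x # bs @ cs) = m" and V: "set (as @ x # bs @ cs) \<subseteq> V"
  shows "F (as @ x # bs @ cs) = (-1) ^ length bs * F (as @ bs @ x # cs)"
  using len V
proof (induction bs arbitrary: as)
  case (Cons b bs)
  let ?xs = "as @ b # x # bs @ cs"
  have "F (?xs[length as := ?xs ! Suc (length as), Suc (length as) := ?xs ! length as]) = - F ?xs"
    using Cons.prems by (intro alternating_form_swap[OF F]) auto
  moreover have "?xs[length as := ?xs ! Suc (length as), Suc (length as) := ?xs ! length as]
      = as @ x # b # bs @ cs"
    by (simp add: nth_append list_update_append)
  ultimately have "F (as @ x # b # bs @ cs) = - F ((as @ [b]) @ x # bs @ cs)" by simp
  then show ?case using Cons.IH[of "as @ [b]"] Cons.prems by simp
qed simp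

text \<open>
  The coface map: \<open>skip i\<close> enumerates the indices different from \<open>i\<close> in increasing order, so it
  names the entries of \<open>omit i xs\<close> by their positions in \<open>xs\<close>.
\<close>

definition skip :: "nat \<Rightarrow> nat \<Rightarrow> nat" where
  "skip i s = (if s < i then s else Suc s)"

lemma bij_betw_skip: "i \<le> n \<Longrightarrow> bij_betw (skip i) {..<n} ({..<Suc n} - {i})"
proof (rule bij_betw_byWitness[where f' = "\<lambda>k. if k < i then k else k - 1"])
qed (auto simp: skip_def)

lemma skip_neq: "skip i s \<noteq> i" and skip_less: "i \<le> n \<Longrightarrow> s < n \<Longrightarrow> skip i s < Suc n"
  by (auto simp: skip_def)

lemma length_omit: "i < length xs \<Longrightarrow> length (omit i xs) = length xs - 1"
  by (simp add: omit_def)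

lemma nth_omit: "i < length xs \<Longrightarrow> s < length xs - 1 \<Longrightarrow> omit i xs ! s = xs ! skip i s"
  by (auto simp: omit_def skip_def nth_append min_def)

lemma set_omit_subset: "set (omit i xs) \<subseteq> set xs"
  by (auto simp: omit_def dest: in_set_takeD in_set_dropD)

lemma map_omit: "map f (omit i xs) = omit i (map f xs)"
  by (simp add: omit_def take_map drop_map)

text \<open>
  In the coalgebra condition, the Filippov identity and the compatibility condition, one entry is
  removed and the new one is appended with a sign; the sign is what it takes to put the new entry
  into the vacated position.  In this form the expressions are visibly multilinear and alternating.
\<close>

lemma alternating_form_omit_last:
  assumes F: "alternating_form_on scale m V F" and ys: "length ys = m" "set ys \<subseteq> V"
    and z: "z \<in> V" and s: "s < m"
  shows "F (ys[s := z]) = (-1) ^ (m - Suc s) * F (omit s ys @ [z])"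
proof -
  have "F (take s ys @ z # drop (Suc s) ys @ []) =
      (-1) ^ length (drop (Suc s) ys) * F (take s ys @ drop (Suc s) ys @ z # [])"
    using ys z s by (intro alternating_form_move[OF F])
      (auto dest: in_set_takeD in_set_dropD)
  then show ?thesis using ys s by (simp add: upd_conv_take_nth_drop omit_def)
qed

lemma split_list_two_positions:
  assumes "p < q" "q < length xs"
  obtains as u ms v cs where "xs = as @ u # ms @ v # cs" "length as = p" "length ms = q - Suc p"
proof -
  have "xs = take p xs @ xs ! p # drop (Suc p) xs"
    using assms by (intro id_take_nth_drop) simp
  moreover have "drop (Suc p) xs = take (q - Suc p) (drop (Suc p) xs) @
      drop (Suc p) xs ! (q - Suc p) # drop (Suc (q - Suc p)) (drop (Suc p) xs)"
    using assms by (intro id_take_nth_drop) simp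
  ultimately have "xs = take p xs @ xs ! p # take (q - Suc p) (drop (Suc p) xs) @
      drop (Suc p) xs ! (q - Suc p) # drop (Suc (q - Suc p)) (drop (Suc p) xs)"
    by metis
  then show thesis using assms by (intro that) auto
qed

text \<open>
  Putting the omitted entry \<open>i\<close> in place of entry \<open>k\<close> gives the list with \<open>k\<close> omitted, except that
  entry \<open>i\<close> has to move past the \<open>\<bar>i - k\<bar> - 1\<close> entries between the two positions.  All signs of the
  theory come from here.
\<close>

lemma alternating_form_omit_replace:
  assumes F: "alternating_form_on scale n V F" and xs: "length xs = Suc n" "set xs \<subseteq> V"
    and i: "i \<le> n" and s: "s < n"
  shows "F ((omit i xs)[s := xs ! i]) = - ((-1) ^ (i + skip i s) * F (omit (skip i s) xs))"
proof (cases "s < i")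
  case True
  with i xs obtain as u ms v cs where xs_eq: "xs = as @ u # ms @ v # cs"
    and l: "length as = s" "length ms = i - Suc s"
    by (metis split_list_two_positions le_imp_less_Suc)
  have v: "xs ! i = v" and om: "omit i xs = as @ u # ms @ cs" "omit s xs = as @ ms @ v # cs"
    using True l by (auto simp: omit_def xs_eq nth_append nth_Cons' take_Cons' drop_Cons')
  have "F (as @ v # ms @ cs) = (-1) ^ length ms * F (as @ ms @ v # cs)"
    using xs by (intro alternating_form_move[OF F]) (auto simp: xs_eq)
  moreover have "(-1::'a) ^ (i - Suc s) = - ((-1) ^ (i + s))"
  proof -
    have "i + s = Suc (i - Suc s) + 2 * s" using True by simp
    then show ?thesis by (simp only: power_add power_mult) simp
  qed
  ultimately show ?thesis using True om l v by (simp add: skip_def list_update_append)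
next
  case False
  define k where "k = Suc s"
  have k: "i < k" "k \<le> n" using False s by (auto simp: k_def)
  with xs obtain as v ms u cs where xs_eq: "xs = as @ v # ms @ u # cs"
    and l: "length as = i" "length ms = k - Suc i"
    by (metis split_list_two_positions le_imp_less_Suc)
  have v: "xs ! i = v" and om: "omit i xs = as @ ms @ u # cs" "omit k xs = as @ v # ms @ cs"
    using k l by (auto simp: omit_def xs_eq nth_append nth_Cons' take_Cons' drop_Cons')
  have "F (as @ v # ms @ cs) = (-1) ^ length ms * F (as @ ms @ v # cs)"
    using xs by (intro alternating_form_move[OF F]) (auto simp: xs_eq)
  moreover have "(-1::'a) ^ (i + k) = - ((-1) ^ (k - Suc i))"
  proof -
    have "i + k = Suc (k - Suc i) + 2 * i" using k by simp
    then show ?thesis by (simp only: power_add power_mult) simp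
  qed
  moreover have "(omit i xs)[s := v] = as @ ms @ v # cs"
    using om l k by (simp add: k_def list_update_append)
  moreover have "skip i s = k" using False by (simp add: skip_def k_def)
  ultimately show ?thesis using om v by (simp add: l flip: mult.assoc power_mult_distrib)
qed

lemma linear_form_add: "linear_form_on scale V g \<Longrightarrow> x \<in> V \<Longrightarrow> y \<in> V \<Longrightarrow> g (x + y) = g x + g y"
  and linear_form_scale: "linear_form_on scale V g \<Longrightarrow> x \<in> V \<Longrightarrow> g (scale c x) = c * g x"
  by (auto simp: linear_form_on_def)

lemma linear_endo_in: "linear_endo_on scale V A \<Longrightarrow> x \<in> V \<Longrightarrow> A x \<in> V"
  and linear_endo_add: "linear_endo_on scale V A \<Longrightarrow> x \<in> V \<Longrightarrow> y \<in> V \<Longrightarrow> A (x + y) = A x + A y"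
  and linear_endo_scale: "linear_endo_on scale V A \<Longrightarrow> x \<in> V \<Longrightarrow> A (scale c x) = scale c (A x)"
  by (auto simp: linear_endo_on_def)

lemma alternating_form_lincomb:
  assumes "alternating_form_on scale m V F" "alternating_form_on scale m V G"
  shows "alternating_form_on scale m V (\<lambda>xs. a * F xs + b * G xs)"
proof -
  have M: "multilinear_form_on scale m V F" "multilinear_form_on scale m V G"
    using assms by (simp_all add: alternating_form_on_def)
  show ?thesis
    using assms unfolding alternating_form_on_def multilinear_form_on_def[of _ _ _ "\<lambda>xs. a * F xs + b * G xs"]
    by (auto simp: algebra_simps multilinear_form_add[OF M(1)] multilinear_form_add[OF M(2)]
        multilinear_form_scale[OF M(1)] multilinear_form_scale[OF M(2)])
qed

lemma alternating_form_diff: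
  assumes "alternating_form_on scale m V F" "alternating_form_on scale m V G"
  shows "alternating_form_on scale m V (\<lambda>xs. F xs - G xs)"
  using alternating_form_lincomb[OF assms, of 1 "-1"] by simp

lemma alternating_form_scaled:
  assumes "alternating_form_on scale m V F"
  shows "alternating_form_on scale m V (\<lambda>xs. c * F xs)"
  using alternating_form_lincomb[OF assms assms, of c 0] by simp

lemma alternating_form_sum:
  assumes "\<And>k. k \<in> S \<Longrightarrow> alternating_form_on scale m V (F k)"
  shows "alternating_form_on scale m V (\<lambda>xs. \<Sum>k\<in>S. F k xs)"
  using assms
proof (induction S rule: infinite_finite_induct)
  case (insert k S)
  then have "alternating_form_on scale m V (\<lambda>xs. 1 * F k xs + 1 * (\<Sum>k\<in>S. F k xs))"
    by (intro alternating_form_lincomb) auto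
  then show ?case using insert by simp
qed (auto simp: alternating_form_on_def multilinear_form_on_def)

section \<open>Endomorphisms acting on alternating forms\<close>

lemma permute_list_update:
  assumes "\<sigma> permutes {..<length xs}" "s < length xs"
  shows "permute_list \<sigma> (xs[\<sigma> s := z]) = (permute_list \<sigma> xs)[s := z]"
proof (rule nth_equalityI)
  fix i assume "i < length (permute_list \<sigma> (xs[\<sigma> s := z]))"
  then have "i < length xs" by simp
  moreover have "\<sigma> i < length xs" "\<sigma> s < length xs"
    using permutes_in_image[OF assms(1)] assms calculation by auto
  moreover have "\<sigma> s = \<sigma> i \<longleftrightarrow> s = i" using permutes_inj[OF assms(1)] by (auto dest: injD)
  ultimately show "permute_list \<sigma> (xs[\<sigma> s := z]) ! i = (permute_list \<sigma> xs)[s := z] ! i"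
    using assms by (auto simp: permute_list_nth nth_list_update)
qed simp

text \<open>
  A permutation of the arguments permutes the summands, so the derivation induced by an
  endomorphism preserves alternating forms.
\<close>

lemma alternating_form_derivation:
  assumes F: "alternating_form_on scale m V F" and A: "linear_endo_on scale V A"
  shows "alternating_form_on scale m V (\<lambda>xs. \<Sum>s<m. F (xs[s := A (xs ! s)]))"
  unfolding alternating_form_on_def multilinear_form_on_def
proof safe
  note M = alternating_form_multilinear[OF F]
  fix xs i x y c
  assume xs: "set xs \<subseteq> V" "i < length xs" "x \<in> V" "y \<in> V" "m = length xs"
  have "F (xs[i := x + y, s := A (xs[i := x + y] ! s)]) =
      F (xs[i := x, s := A (xs[i := x] ! s)]) + F (xs[i := y, s := A (xs[i := y] ! s)]) \<and>
      F (xs[i := scale c x, s := A (xs[i := scale c x] ! s)]) =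
      c * F (xs[i := x, s := A (xs[i := x] ! s)])" if "s < length xs" for s
  proof (cases "s = i")
    case True
    then show ?thesis
      using xs by (simp add: linear_endo_add[OF A] linear_endo_scale[OF A] linear_endo_in[OF A]
          multilinear_form_add[OF M] multilinear_form_scale[OF M])
  next
    case False
    have "set (xs[s := A (xs ! s)]) \<subseteq> V"
      using xs that by (intro set_list_update_subset linear_endo_in[OF A]) auto
    then show ?thesis
      using False xs that by (simp add: list_update_swap[of i s] multilinear_form_add[OF M]
          multilinear_form_scale[OF M])
  qed
  then show "(\<Sum>s<length xs. F (xs[i := x + y, s := A (xs[i := x + y] ! s)])) =
      (\<Sum>s<length xs. F (xs[i := x, s := A (xs[i := x] ! s)])) +
      (\<Sum>s<length xs. F (xs[i := y, s := A (xs[i := y] ! s)]))"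
    and "(\<Sum>s<length xs. F (xs[i := scale c x, s := A (xs[i := scale c x] ! s)])) =
      c * (\<Sum>s<length xs. F (xs[i := x, s := A (xs[i := x] ! s)]))"
    by (simp_all add: sum.distrib sum_distrib_left)
next
  fix xs \<sigma>
  assume xs: "set xs \<subseteq> V" "\<sigma> permutes {..<length xs}" "m = length xs"
  let ?G = "\<lambda>s. F (xs[s := A (xs ! s)])"
  have "F ((permute_list \<sigma> xs)[s := A (permute_list \<sigma> xs ! s)]) =
      of_int (sign \<sigma>) * ?G (\<sigma> s)" if s: "s < length xs" for s
  proof -
    have \<sigma>s: "\<sigma> s < length xs" using permutes_in_image[OF xs(2)] s by auto
    then have "set (xs[\<sigma> s := A (xs ! \<sigma> s)]) \<subseteq> V"
      using xs by (intro set_list_update_subset linear_endo_in[OF A]) auto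
    then have "F (permute_list \<sigma> (xs[\<sigma> s := A (xs ! \<sigma> s)])) = of_int (sign \<sigma>) * ?G (\<sigma> s)"
      using xs by (intro alternating_form_permute[OF F]) auto
    then show ?thesis using xs s by (simp add: permute_list_update permute_list_nth)
  qed
  then have "(\<Sum>s<length xs. F ((permute_list \<sigma> xs)[s := A (permute_list \<sigma> xs ! s)])) =
      (\<Sum>s<length xs. of_int (sign \<sigma>) * ?G (\<sigma> s))"
    by simp
  also have "\<dots> = of_int (sign \<sigma>) * (\<Sum>s<length xs. ?G (\<sigma> s))"
    by (simp add: sum_distrib_left)
  also have "(\<Sum>s<length xs. ?G (\<sigma> s)) = (\<Sum>s<length xs. ?G s)"
    using permutes_imp_bij[OF xs(2)] by (intro sum.reindex_bij_betw) 
  finally show "(\<Sum>s<length xs. F ((permute_list \<sigma> xs)[s := A (permute_list \<sigma> xs ! s)])) =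
      of_int (sign \<sigma>) * (\<Sum>s<length xs. F (xs[s := A (xs ! s)]))" .
qed

lemma omit_upt: "i < d \<Longrightarrow> omit i [0..<d] = [0..<i] @ [Suc i..<d]"
  by (simp add: omit_def)

section \<open>Forms in coordinates\<close>

text \<open>
  The space is a subspace \<open>V\<close> with a basis \<open>e\<close> and its coordinate functionals \<open>co\<close>; both are indexed by
  numbers below \<open>d\<close>.  Carrying the coordinates along makes the passage to the dual space a mere
  exchange of roles, and one and the same space can be given several bases.
\<close>

locale coordinates = vector_space scale
  for scale :: "'f::field_char_0 \<Rightarrow> 'v::ab_group_add \<Rightarrow> 'v" +
  fixes V :: "'v set" and d :: nat and e :: "nat \<Rightarrow> 'v" and co :: "nat \<Rightarrow> 'v \<Rightarrow> 'f"
  assumes subspace_V: "subspace V"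
    and e_in: "i < d \<Longrightarrow> e i \<in> V"
    and co_linear: "j < d \<Longrightarrow> linear_form_on scale V (co j)"
    and co_e: "i < d \<Longrightarrow> j < d \<Longrightarrow> co j (e i) = (if j = i then 1 else 0)"
    and expand: "x \<in> V \<Longrightarrow> x = (\<Sum>j<d. scale (co j x) (e j))"
begin

abbreviation bs :: "'v list" where "bs \<equiv> map e [0..<d]"

lemma set_bs: "set bs \<subseteq> V"
  using e_in by auto

lemma linear_form_zero: "linear_form_on scale V g \<Longrightarrow> g 0 = 0"
  using linear_form_scale[of scale V g 0 0] subspace_0[OF subspace_V] by simp

lemma linear_form_sum:
  assumes "linear_form_on scale V g" "\<And>j. j \<in> J \<Longrightarrow> f j \<in> V"
  shows "g (\<Sum>j\<in>J. scale (c j) (f j)) = (\<Sum>j\<in>J. c j * g (f j))"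
  using assms(2)
proof (induction J rule: infinite_finite_induct)
  case (insert j J)
  then show ?case
    by (simp add: linear_form_add[OF assms(1)] linear_form_scale[OF assms(1)]
        subspace_scale[OF subspace_V] subspace_sum[OF subspace_V])
qed (simp_all add: linear_form_zero[OF assms(1)])

lemma linear_form_expand:
  assumes "linear_form_on scale V g" "x \<in> V"
  shows "g x = (\<Sum>j<d. co j x * g (e j))"
  using linear_form_sum[OF assms(1), of "{..<d}" e "\<lambda>j. co j x"] expand[OF assms(2)] e_in by simp

lemma coordinates_eqI:
  assumes "x \<in> V" "y \<in> V" "\<And>j. j < d \<Longrightarrow> co j x = co j y"
  shows "x = y"
  using expand[OF assms(1)] expand[OF assms(2)] assms(3) by simp

lemma linear_combination_in: "(\<Sum>j<d. scale (c j) (e j)) \<in> V"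
  by (intro subspace_sum[OF subspace_V] subspace_scale[OF subspace_V] e_in) auto

lemma co_sum: "i < d \<Longrightarrow> co i (\<Sum>j<d. scale (c j) (e j)) = c i"
  by (subst linear_form_sum[OF co_linear]) (auto simp: e_in co_e if_distrib[of "\<lambda>x. _ * x"] cong: if_cong)

lemma multilinear_form_slot:
  assumes M: "multilinear_form_on scale m V F" and xs: "length xs = m" "set xs \<subseteq> V" and i: "i < m"
  shows "linear_form_on scale V (\<lambda>x. F (xs[i := x]))"
  using assms by (auto simp: linear_form_on_def multilinear_form_add multilinear_form_scale)

text \<open>
  A multilinear form that vanishes on basis vectors vanishes: the entries are expanded one after
  the other.
\<close>

lemma multilinear_form_zeroI:
  assumes M: "multilinear_form_on scale m V F"
    and zero: "\<And>is. length is = m \<Longrightarrow> set is \<subseteq> {..<d} \<Longrightarrow> F (map e is) = 0"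
    and xs: "length xs = m" "set xs \<subseteq> V"
  shows "F xs = 0"
proof -
  \<comment> \<open>The induction is over the number of leading entries that are not yet basis vectors.\<close>
  have "F xs = 0" if "k \<le> m" "length xs = m" "set xs \<subseteq> V" "\<And>i. k \<le> i \<Longrightarrow> i < m \<Longrightarrow> xs ! i \<in> e ` {..<d}"
    for k xs using that
  proof (induction k arbitrary: xs)
    case 0
    then have "set xs \<subseteq> e ` {..<d}" by (auto simp: in_set_conv_nth)
    then have "xs \<in> map e ` lists {..<d}" by (metis lists_image in_listsI subsetD)
    then obtain js where "set js \<subseteq> {..<d}" "xs = map e js" by auto
    then show ?case using zero[of js] 0 by simp
  next
    case (Suc k)
    then have k: "k < m" "xs ! k \<in> V" by auto
    have "F xs = F (xs[k := xs ! k])" by simp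
    also have "\<dots> = (\<Sum>j<d. co j (xs ! k) * F (xs[k := e j]))"
      using linear_form_expand[OF multilinear_form_slot[OF M] k(2)] Suc.prems k by blast
    also have "\<dots> = (\<Sum>j<d. co j (xs ! k) * 0)"
    proof (intro sum.cong refl arg_cong2[of _ _ _ _ "(*)"])
      fix j assume j: "j \<in> {..<d}"
      have "set (xs[k := e j]) \<subseteq> V"
        using Suc.prems j by (intro set_list_update_subset e_in) auto
      then show "F (xs[k := e j]) = 0"
        using Suc.prems j k by (intro Suc.IH) (auto simp: nth_list_update)
    qed
    also have "\<dots> = 0" by simp
    finally show ?case .
  qed
  from this[of m xs] show ?thesis using xs by simp
qed

text \<open>
  In dimension \<open>m + 1\<close> an alternating \<open>m\<close>-linear form has only \<open>m + 1\<close> independent values: a list of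
  \<open>m\<close> distinct basis vectors misses exactly one of them, hence is a permutation of the basis with one
  vector omitted.
\<close>

lemma alternating_form_omit_zeroI:
  assumes F: "alternating_form_on scale m V F" and d: "d = Suc m"
    and zero: "\<And>i. i \<le> m \<Longrightarrow> F (omit i bs) = 0"
    and xs: "length xs = m" "set xs \<subseteq> V"
  shows "F xs = 0"
proof (rule multilinear_form_zeroI[OF alternating_form_multilinear[OF F] _ xs])
  fix js assume js: "length js = m" "set js \<subseteq> {..<d}"
  have V: "set (map e js) \<subseteq> V" using js e_in by auto
  show "F (map e js) = 0"
  proof (cases "distinct js")
    case False
    then show ?thesis using js V by (intro alternating_form_repeated[OF F]) (auto simp: distinct_map)
  next
    case True
    then have "card ({..<d} - set js) = 1"
      using js d by (simp add: card_Diff_subset distinct_card)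
    then obtain i where i: "{..<d} - set js = {i}" by (rule card_1_singletonE)
    have "i \<in> {..<d}" using i by blast
    then have id: "i < d" by simp
    then have im: "i \<le> m" using d by linarith
    have "distinct (omit i [0..<d])" unfolding omit_upt[OF id] by simp
    moreover have "set (omit i [0..<d]) = set js"
    proof -
      have "set (omit i [0..<d]) = {..<d} - {i}" unfolding omit_upt[OF id] using id by auto
      also have "\<dots> = {..<d} - ({..<d} - set js)" unfolding i ..
      also have "\<dots> = set js" using js(2) by blast
      finally show ?thesis .
    qed
    ultimately have "mset (omit i [0..<d]) = mset js"
      using True set_eq_iff_mset_eq_distinct by blast
    then obtain p where p: "p permutes {..<length js}" "permute_list p js = omit i [0..<d]"
      by (rule mset_eq_permutation)
    have "F (permute_list p (map e js)) = of_int (sign p) * F (map e js)"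
      using p js V by (intro alternating_form_permute[OF F]) auto
    then have "of_int (sign p) * F (map e js) = 0"
      using p zero[OF im] by (simp add: permute_list_map map_omit)
    then show ?thesis by (auto simp: sign_def split: if_splits)
  qed
qed

lemma nth_omit_bs: "d = Suc n \<Longrightarrow> i \<le> n \<Longrightarrow> s < n \<Longrightarrow> omit i bs ! s = e (skip i s)"
  by (subst nth_omit) (auto simp: skip_def)

lemma set_omit_bs: "set (omit i bs) \<subseteq> V"
  by (rule order_trans[OF set_omit_subset set_bs])

lemma length_omit_bs: "d = Suc n \<Longrightarrow> i \<le> n \<Longrightarrow> length (omit i bs) = n"
  by (subst length_omit) auto

lemma nth_omit_bs_exists:
  assumes "d = Suc n" "i \<le> n" "k \<le> n" "k \<noteq> i"
  obtains s where "s < n" "skip i s = k" "omit i bs ! s = e k"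
proof -
  have "k \<in> skip i ` {..<n}"
    using bij_betw_skip[OF assms(2)] assms by (auto simp: bij_betw_def)
  then show thesis using that nth_omit_bs[OF assms(1,2)] by auto
qed

lemma alternating_form_omit_update:
  assumes t: "alternating_form_on scale n V t" and d: "d = Suc n" and i: "i \<le> n" and s: "s < n"
    and l: "l \<le> n" and k: "k = skip i s"
  shows "t ((omit i bs)[s := e l]) =
    (if l = k then t (omit i bs) else if l = i then - ((-1) ^ (i + k) * t (omit k bs)) else 0)"
proof (cases "l = k \<or> l = i")
  case True
  then show ?thesis
  proof
    assume "l = k"
    then show ?thesis using nth_omit_bs[OF d i s] k by (metis list_update_id)
  next
    assume "l = i"
    then show ?thesis
      using alternating_form_omit_replace[OF t _ set_bs i s] d i k skip_neq[of i s] by simp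
  qed
next
  case False
  obtain s' where s': "s' < n" "skip i s' = l" "omit i bs ! s' = e l"
    using nth_omit_bs_exists[OF d i l] False by blast
  with False k have "s' \<noteq> s" by auto
  have len: "length (omit i bs) = n" by (rule length_omit_bs[OF d i])
  have "(omit i bs)[s := e l] ! s = (omit i bs)[s := e l] ! s'"
    using s s' \<open>s' \<noteq> s\<close> len by simp
  then have "\<not> distinct ((omit i bs)[s := e l])"
    using s s' \<open>s' \<noteq> s\<close> len by (metis length_list_update nth_eq_iff_index_eq)
  then have "t ((omit i bs)[s := e l]) = 0"
    using len l d e_in by (intro alternating_form_repeated[OF t] set_list_update_subset set_omit_bs) auto
  then show ?thesis using False by simp
qed

text \<open>
  The basic computation.  For \<open>n\<close>-linear alternating \<open>t\<close> on a space of dimension \<open>n + 1\<close> the numbers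
  \<open>T\<^sub>i = (-1)^i t(omit i bs)\<close> are the coordinates of a vector, since contraction with a volume form
  identifies \<open>\<Lambda>\<^sup>n V\<^sup>*\<close> with \<open>V\<close> up to the determinant.  The derivation induced by \<open>A\<close> therefore
  becomes \<open>T \<mapsto> tr(A) T - A T\<close>.  In coordinates: replacing an entry \<open>e\<^sub>k\<close> by \<open>A e\<^sub>k\<close> only leaves the
  component along \<open>e\<^sub>k\<close>, which contributes to the trace, and the component along the missing vector
  \<open>e\<^sub>i\<close>, which exchanges the omitted index; all other components repeat a vector.
\<close>

lemma alternating_form_trace:
  assumes t: "alternating_form_on scale n V t" and d: "d = Suc n" and i: "i \<le> n"
    and A: "linear_endo_on scale V A"
  shows "(\<Sum>s<n. t ((omit i bs)[s := A (omit i bs ! s)])) =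
    (-1) ^ i * (\<Sum>k\<le>n. co k (A (e k)) * ((-1) ^ i * t (omit i bs)) -
                         co i (A (e k)) * ((-1) ^ k * t (omit k bs)))"
proof -
  let ?y = "omit i bs"
  let ?f = "\<lambda>k. co k (A (e k)) * ((-1) ^ i * t ?y) - co i (A (e k)) * ((-1) ^ k * t (omit k bs))"
  have "t (?y[s := A (?y ! s)]) = (-1) ^ i * ?f (skip i s)" if s: "s < n" for s
  proof -
    let ?k = "skip i s"
    have k: "?k < d" "?k \<noteq> i" using skip_less[OF i s] skip_neq d by auto
    have in_V: "A (e ?k) \<in> V" using k by (intro linear_endo_in[OF A] e_in)
    have "t (?y[s := A (?y ! s)]) = t (?y[s := A (e ?k)])"
      using nth_omit_bs[OF d i s] by simp
    also have "\<dots> = (\<Sum>l<d. co l (A (e ?k)) * t (?y[s := e l]))"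
      using linear_form_expand[OF multilinear_form_slot[OF alternating_form_multilinear[OF t]] in_V]
        length_omit_bs[OF d i] set_omit_bs s by blast
    also have "\<dots> = (\<Sum>l<d. (if l = ?k then co l (A (e ?k)) * t ?y else 0) +
        (if l = i then - co l (A (e ?k)) * ((-1) ^ (i + ?k) * t (omit ?k bs)) else 0))"
    proof (intro sum.cong refl)
      fix l assume "l \<in> {..<d}"
      then have l: "l \<le> n" using d by simp
      show "co l (A (e ?k)) * t (?y[s := e l]) = (if l = ?k then co l (A (e ?k)) * t ?y else 0) +
        (if l = i then - co l (A (e ?k)) * ((-1) ^ (i + ?k) * t (omit ?k bs)) else 0)"
        using k unfolding alternating_form_omit_update[OF t d i s l refl] by auto
    qed
    also have "\<dots> = co ?k (A (e ?k)) * t ?y - co i (A (e ?k)) * ((-1) ^ (i + ?k) * t (omit ?k bs))"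
    proof -
      have "i < d" using i d by simp
      with k show ?thesis by (simp add: sum.distrib)
    qed
    also have "\<dots> = (-1) ^ i * ?f ?k"
    proof -
      have "(-1) ^ i * (x * ((-1) ^ i * u) - y * ((-1) ^ m * v)) = x * u - y * ((-1) ^ (i + m) * v)"
        for x y u v :: 'f and m by (cases "even i") (simp_all add: power_add)
      then show ?thesis by simp
    qed
    finally show ?thesis .
  qed
  then have "(\<Sum>s<n. t (?y[s := A (?y ! s)])) = (\<Sum>s<n. (-1) ^ i * ?f (skip i s))" by simp
  also have "\<dots> = (\<Sum>k\<in>{..<Suc n} - {i}. (-1) ^ i * ?f k)"
    by (rule sum.reindex_bij_betw[OF bij_betw_skip[OF i]])
  also have "\<dots> = (\<Sum>k\<in>{..<Suc n}. (-1) ^ i * ?f k)"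
    by (rule sum.mono_neutral_left) auto
  also have "{..<Suc n} = {..n}" by (rule lessThan_Suc_atMost)
  also have "(\<Sum>k\<le>n. (-1) ^ i * ?f k) = (-1) ^ i * (\<Sum>k\<le>n. ?f k)"
    by (rule sum_distrib_left[symmetric])
  finally show ?thesis .
qed

end

context coordinates
begin

text \<open>
  With \<open>n - 1\<close> basis vectors fixed, an alternating form becomes a functional of its last argument that
  only sees the two missing basis vectors \<open>e\<^sub>a\<close> and \<open>e\<^sub>b\<close>, and its two values have opposite signs
  relative to the values \<open>T\<^sub>a\<close> and \<open>T\<^sub>b\<close>.  The common sign \<open>s\<close> depends on the list, but not on the
  form; this lets the same \<open>s\<close> serve for all coordinates of a bracket.
\<close>

lemma alternating_form_omit_two:
  assumes d: "d = Suc n" and ab: "a \<le> n" "b \<le> n" "a \<noteq> b"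
    and js: "distinct js" "set js = {..n} - {a, b}"
  obtains s :: 'f where "s * s = 1"
    and "\<And>t. alternating_form_on scale n V t \<Longrightarrow>
      t (map e js @ [e b]) = s * ((-1) ^ a * t (omit a bs)) \<and>
      t (map e js @ [e a]) = - (s * ((-1) ^ b * t (omit b bs)))"
proof -
  let ?om = "omit a [0..<d]"
  have ad: "a < d" using ab d by simp
  have set_om: "set ?om = {..n} - {a}" unfolding omit_upt[OF ad] using ab d by auto
  have len_om: "length ?om = n" using ab d by (simp add: length_omit)
  have nth_om: "?om ! s = skip a s" if "s < n" for s
    using that ab d by (subst nth_omit) (auto simp: skip_def)
  have "mset (js @ [b]) = mset ?om"
  proof -
    have "distinct ?om" unfolding omit_upt[OF ad] by simp
    moreover have "distinct (js @ [b])" using js by simp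
    moreover have "set (js @ [b]) = set ?om" unfolding set_om using js ab by auto
    ultimately show ?thesis using set_eq_iff_mset_eq_distinct by blast
  qed
  then obtain p where p: "p permutes {..<length ?om}" "permute_list p ?om = js @ [b]"
    by (rule mset_eq_permutation)
  have "b \<in> set ?om" using set_om ab by simp
  then obtain pos where pos: "pos < n" "skip a pos = b"
    using len_om nth_om by (auto simp: in_set_conv_nth)
  \<comment> \<open>Renaming \<open>b\<close> to \<open>a\<close> commutes with permutations; it turns the list that ends in \<open>b\<close> into the one
    that ends in \<open>a\<close>, so both have the same sign.\<close>
  define r where "r k = (if k = b then a else k)" for k
  have om_upd: "map e (map r ?om) = (omit a bs)[pos := e a]"
  proof (rule nth_equalityI)
    show "length (map e (map r ?om)) = length ((omit a bs)[pos := e a])"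
      using len_om length_omit_bs[OF d ab(1)] by simp
    fix i assume "i < length (map e (map r ?om))"
    then have i: "i < n" using len_om by simp
    have "skip a i = b \<longleftrightarrow> i = pos" using pos by (auto simp: skip_def split: if_splits)
    then show "map e (map r ?om) ! i = (omit a bs)[pos := e a] ! i"
      using i len_om length_omit_bs[OF d ab(1)] nth_om[OF i] nth_omit_bs[OF d ab(1) i]
      by (simp add: r_def nth_list_update)
  qed
  have r_js: "map r js = js" using js by (intro map_idI) (auto simp: r_def)
  show thesis
  proof (rule that[of "of_int (sign p) * (-1) ^ a"])
    show "of_int (sign p) * (-1) ^ a * (of_int (sign p) * (-1) ^ a) = (1::'f)"
      by (cases "even a") (auto simp: sign_def)
    fix t assume t: "alternating_form_on scale n V t"
    have V: "set (map e xs) \<subseteq> V" if "set xs \<subseteq> {..n}" for xs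
      using that d e_in by auto
    have perm: "t (map e (map f (js @ [b]))) = of_int (sign p) * t (map e (map f ?om))"
      if "f ` {..n} \<subseteq> {..n}" for f
    proof -
      have "set (map e (map f ?om)) \<subseteq> V" using that set_om by (intro V) auto
      then have "t (permute_list p (map e (map f ?om))) = of_int (sign p) * t (map e (map f ?om))"
        using p len_om by (intro alternating_form_permute[OF t]) auto
      then show ?thesis using p len_om by (simp add: permute_list_map flip: p(2))
    qed
    have 1: "t (map e js @ [e b]) = of_int (sign p) * t (omit a bs)"
      using perm[of id] by (simp add: map_omit)
    have "t (map e js @ [e a]) = of_int (sign p) * t (map e (map r ?om))"
      using perm[of r] r_js ab by (auto simp: r_def)
    also have "\<dots> = of_int (sign p) * t ((omit a bs)[pos := e a])"
      by (simp only: om_upd)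
    also have "t ((omit a bs)[pos := e a]) = - ((-1) ^ (a + b) * t (omit b bs))"
      using alternating_form_omit_update[OF t d ab(1) pos(1) ab(1) refl] pos ab by simp
    finally have 2: "t (map e js @ [e a]) = of_int (sign p) * - ((-1) ^ (a + b) * t (omit b bs))" .
    show "t (map e js @ [e b]) = of_int (sign p) * (-1) ^ a * ((-1) ^ a * t (omit a bs)) \<and>
      t (map e js @ [e a]) = - (of_int (sign p) * (-1) ^ a * ((-1) ^ b * t (omit b bs)))"
      unfolding 1 2 by (cases "even a") (simp_all add: power_add)
  qed
qed

end

section \<open>The matrix of a bracket\<close>

locale bracket_coordinates = coordinates scale V "Suc n" e co
  for scale :: "'f::field_char_0 \<Rightarrow> 'v::ab_group_add \<Rightarrow> 'v" and V n e co +
  fixes \<beta> :: "'v list \<Rightarrow> 'v"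
  assumes multilinear: "multilinear_on scale n V \<beta>"
    and alternating: "alternating_on scale n V \<beta>"
    and n_pos: "0 < n"
begin

text \<open>
  The bracket factors as \<open>\<beta> = T \<circ> c\<close>, where \<open>c : V\<^sup>n \<rightarrow> V\<^sup>*\<close> is the cross product given by the volume
  form of the basis and \<open>T : V\<^sup>* \<rightarrow> V\<close> is linear; \<open>K\<close> is the matrix of \<open>T\<close>.  The sign \<open>(-1)^i\<close> is the one
  that makes symmetric and skew-symmetric matrices meaningful.
\<close>

definition K :: "nat \<Rightarrow> nat \<Rightarrow> 'f" where
  "K i j = (-1) ^ i * co j (\<beta> (omit i bs))"

lemma bracket_in: "length xs = n \<Longrightarrow> set xs \<subseteq> V \<Longrightarrow> \<beta> xs \<in> V"
  using multilinear by (simp add: multilinear_on_def)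

lemma bracket_add:
  "length xs = n \<Longrightarrow> set xs \<subseteq> V \<Longrightarrow> i < n \<Longrightarrow> x \<in> V \<Longrightarrow> y \<in> V \<Longrightarrow>
    \<beta> (xs[i := x + y]) = \<beta> (xs[i := x]) + \<beta> (xs[i := y])"
  using multilinear by (simp add: multilinear_on_def)

lemma bracket_scale:
  "length xs = n \<Longrightarrow> set xs \<subseteq> V \<Longrightarrow> i < n \<Longrightarrow> x \<in> V \<Longrightarrow>
    \<beta> (xs[i := scale c x]) = scale c (\<beta> (xs[i := x]))"
  using multilinear by (simp add: multilinear_on_def)

lemma form_bracket:
  assumes g: "linear_form_on scale V g"
  shows "alternating_form_on scale n V (\<lambda>xs. g (\<beta> xs))"
  unfolding alternating_form_on_def
proof (intro conjI allI impI)
  show "multilinear_form_on scale n V (\<lambda>xs. g (\<beta> xs))"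
    unfolding multilinear_form_on_def
  proof (intro allI impI)
    fix xs i x y c
    assume "length xs = n \<and> set xs \<subseteq> V \<and> i < n \<and> x \<in> V \<and> y \<in> V"
    moreover from this have "\<beta> (xs[i := x]) \<in> V" "\<beta> (xs[i := y]) \<in> V"
      by (auto intro!: bracket_in dest!: subsetD[OF set_update_subset_insert])
    ultimately show "g (\<beta> (xs[i := x + y])) = g (\<beta> (xs[i := x])) + g (\<beta> (xs[i := y])) \<and>
       g (\<beta> (xs[i := scale c x])) = c * g (\<beta> (xs[i := x]))"
      by (simp add: bracket_add bracket_scale linear_form_add[OF g] linear_form_scale[OF g])
  qed
next
  fix xs \<sigma> assume xs: "length xs = n \<and> set xs \<subseteq> V \<and> \<sigma> permutes {..<n}"
  then have in_V: "\<beta> (permute_list \<sigma> xs) \<in> V"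
    by (intro bracket_in) auto
  have "\<beta> xs = scale (of_int (sign \<sigma>)) (\<beta> (permute_list \<sigma> xs))"
    using xs alternating by (simp add: alternating_on_def)
  then have "g (\<beta> xs) = of_int (sign \<sigma>) * g (\<beta> (permute_list \<sigma> xs))"
    using linear_form_scale[OF g in_V] by simp
  then show "g (\<beta> (permute_list \<sigma> xs)) = of_int (sign \<sigma>) * g (\<beta> xs)"
    by (auto simp: sign_def)
qed

lemma co_bracket: "j \<le> n \<Longrightarrow> alternating_form_on scale n V (\<lambda>xs. co j (\<beta> xs))"
  by (intro form_bracket co_linear) simp

lemma in_V_sum: "(\<And>s. s \<in> S \<Longrightarrow> f s \<in> V) \<Longrightarrow> (\<Sum>s\<in>S. f s) \<in> V"
  by (rule subspace_sum[OF subspace_V])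

lemma co_sum_in:
  assumes "j \<le> n" "\<And>s. s \<in> S \<Longrightarrow> f s \<in> V"
  shows "co j (\<Sum>s\<in>S. f s) = (\<Sum>s\<in>S. co j (f s))"
  using linear_form_sum[of "co j" S f "\<lambda>_. 1"] assms co_linear[of j] by simp

lemma coordinates_eqI': "x \<in> V \<Longrightarrow> y \<in> V \<Longrightarrow> (\<And>j. j \<le> n \<Longrightarrow> co j x = co j y) \<Longrightarrow> x = y"
  by (rule coordinates_eqI) auto

lemma e_in_V: "i \<le> n \<Longrightarrow> e i \<in> V"
  by (rule e_in) simp

lemma map_e_in: assumes "set js \<subseteq> {..n}" shows "set (map e js) \<subseteq> V"
proof
  fix x assume "x \<in> set (map e js)"
  then obtain k where k: "x = e k" "k \<in> set js" by auto
  then have "k \<le> n" using assms by blast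
  then show "x \<in> V" using k e_in_V by simp
qed

lemma ad_linear:
  assumes xs: "length xs = n - 1" "set xs \<subseteq> V"
  shows "linear_endo_on scale V (\<lambda>y. \<beta> (xs @ [y]))"
proof -
  have *: "length (xs @ [x]) = n" "set (xs @ [x]) \<subseteq> V" if "x \<in> V" for x
    using xs n_pos that by auto
  have l: "length xs < n" using xs n_pos by simp
  show ?thesis unfolding linear_endo_on_def
  proof (intro conjI ballI allI)
    fix x assume x: "x \<in> V"
    show "\<beta> (xs @ [x]) \<in> V" using * x by (intro bracket_in)
    fix c show "\<beta> (xs @ [scale c x]) = scale c (\<beta> (xs @ [x]))"
      using bracket_scale[OF *[OF x] l x, of c] by simp
  next
    fix x y assume x: "x \<in> V" "y \<in> V"
    then show "\<beta> (xs @ [x + y]) = \<beta> (xs @ [x]) + \<beta> (xs @ [y])"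
      using bracket_add[OF *[OF x(1)] l x] by simp
  qed
qed

definition derivation :: "('v \<Rightarrow> 'v) \<Rightarrow> bool" where
  "derivation A \<longleftrightarrow> (\<forall>ys. length ys = n \<and> set ys \<subseteq> V \<longrightarrow>
     A (\<beta> ys) = (\<Sum>s<n. \<beta> (ys[s := A (ys ! s)])))"

lemma bracket_omit_last:
  assumes "length ys = n" "set ys \<subseteq> V" "z \<in> V" "s < n"
  shows "scale ((-1) ^ (n - Suc s)) (\<beta> (omit s ys @ [z])) = \<beta> (ys[s := z])"
proof (rule coordinates_eqI')
  have 1: "\<beta> (omit s ys @ [z]) \<in> V"
    using assms n_pos set_omit_subset[of s ys] by (intro bracket_in) (auto simp: length_omit)
  then show "scale ((-1) ^ (n - Suc s)) (\<beta> (omit s ys @ [z])) \<in> V"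
    by (rule subspace_scale[OF subspace_V])
  show "\<beta> (ys[s := z]) \<in> V" using assms by (intro bracket_in set_list_update_subset) auto
  fix j assume "j \<le> n"
  then show "co j (scale ((-1) ^ (n - Suc s)) (\<beta> (omit s ys @ [z]))) = co j (\<beta> (ys[s := z]))"
    using alternating_form_omit_last[OF co_bracket assms] linear_form_scale[OF co_linear 1] by simp
qed

lemma n_lie_algebra_iff_derivation:
  "n_lie_algebra scale n V \<beta> \<longleftrightarrow>
    (\<forall>xs. length xs = n - 1 \<and> set xs \<subseteq> V \<longrightarrow> derivation (\<lambda>y. \<beta> (xs @ [y])))"
proof -
  have "(\<Sum>s<n. scale ((-1) ^ (n - Suc s)) (\<beta> (omit s ys @ [\<beta> (xs @ [ys ! s])]))) =
        (\<Sum>s<n. \<beta> (ys[s := \<beta> (xs @ [ys ! s])]))"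
    if "length xs = n - 1 \<and> set xs \<subseteq> V" "length ys = n \<and> set ys \<subseteq> V" for xs ys
    using that n_pos by (intro sum.cong refl bracket_omit_last bracket_in) auto
  then show ?thesis
    using vector_space_axioms subspace_V multilinear alternating
    unfolding n_lie_algebra_def derivation_def by auto
qed

text \<open>
  By the trace formula an endomorphism \<open>A\<close> is a derivation of \<open>T \<circ> c\<close> if and only if
  \<open>A T + T A\<^sup>t = tr(A) T\<close>.
\<close>

lemma derivation_iff:
  assumes A: "linear_endo_on scale V A"
  shows "derivation A \<longleftrightarrow> (\<forall>i\<le>n. \<forall>j\<le>n. (\<Sum>l\<le>n. K i l * co j (A (e l))) =
    (\<Sum>k\<le>n. co k (A (e k)) * K i j - co i (A (e k)) * K k j))" (is "_ \<longleftrightarrow> ?R")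
proof -
  let ?L = "\<lambda>ys. A (\<beta> ys)" and ?D = "\<lambda>ys. \<Sum>s<n. \<beta> (ys[s := A (ys ! s)])"
  have L_in: "?L ys \<in> V" and D_in: "\<beta> (ys[s := A (ys ! s)]) \<in> V"
    if "length ys = n" "set ys \<subseteq> V" "s < n" for ys s
    using that by (auto intro!: linear_endo_in[OF A] bracket_in
        dest!: subsetD[OF set_update_subset_insert])
  have coA: "linear_form_on scale V (\<lambda>x. co j (A x))" if "j \<le> n" for j
    using A co_linear[of j] that by (auto simp: linear_form_on_def linear_endo_on_def)
  have key: "co j (?L (omit i bs)) - co j (?D (omit i bs)) =
      (-1) ^ i * ((\<Sum>l\<le>n. K i l * co j (A (e l))) -
        (\<Sum>k\<le>n. co k (A (e k)) * K i j - co i (A (e k)) * K k j))" if "i \<le> n" "j \<le> n" for i j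
  proof -
    let ?y = "omit i bs"
    have y: "length ?y = n" "set ?y \<subseteq> V"
      using length_omit_bs[OF refl that(1)] set_omit_bs by auto
    have "co j (?L ?y) = (\<Sum>l<Suc n. co l (\<beta> ?y) * co j (A (e l)))"
      by (rule linear_form_expand[OF coA[OF that(2)] bracket_in[OF y]])
    also have "\<dots> = (-1) ^ i * (\<Sum>l\<le>n. K i l * co j (A (e l)))"
      unfolding lessThan_Suc_atMost sum_distrib_left K_def
      by (intro sum.cong refl) (simp flip: power_mult_distrib mult.assoc)
    finally have 1: "co j (?L ?y) = (-1) ^ i * (\<Sum>l\<le>n. K i l * co j (A (e l)))" .
    have "co j (?D ?y) = (\<Sum>s<n. co j (\<beta> (?y[s := A (?y ! s)])))"
      using D_in[OF y] that by (intro co_sum_in) auto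
    also have "\<dots> = (-1) ^ i * (\<Sum>k\<le>n. co k (A (e k)) * K i j - co i (A (e k)) * K k j)"
      unfolding K_def by (rule alternating_form_trace[OF co_bracket[OF that(2)] refl that(1) A])
    finally show ?thesis unfolding 1 by (simp add: algebra_simps)
  qed
  show ?thesis
  proof
    assume D: "derivation A"
    show ?R
    proof (intro allI impI)
      fix i j assume ij: "i \<le> n" "j \<le> n"
      have "?L (omit i bs) = ?D (omit i bs)"
        using D length_omit_bs[OF refl ij(1)] set_omit_bs unfolding derivation_def by blast
      then show "(\<Sum>l\<le>n. K i l * co j (A (e l))) =
          (\<Sum>k\<le>n. co k (A (e k)) * K i j - co i (A (e k)) * K k j)"
        using key[OF ij] by simp
    qed
  next
    assume R: ?R
    show "derivation A" unfolding derivation_def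
    proof (intro allI impI)
      fix ys assume ys: "length ys = n \<and> set ys \<subseteq> V"
      show "?L ys = ?D ys"
      proof (rule coordinates_eqI')
        show "?L ys \<in> V" "?D ys \<in> V" using ys n_pos L_in[of ys 0] D_in by (auto intro!: in_V_sum)
        fix j assume j: "j \<le> n"
        have F: "alternating_form_on scale n V
            (\<lambda>ys. co j (?L ys) - (\<Sum>s<n. co j (\<beta> (ys[s := A (ys ! s)]))))"
          by (intro alternating_form_diff form_bracket coA j alternating_form_derivation co_bracket A)
        have D: "co j (?D ys) = (\<Sum>s<n. co j (\<beta> (ys[s := A (ys ! s)])))"
          if "length ys = n" "set ys \<subseteq> V" for ys
          using D_in[OF that] j by (intro co_sum_in) auto
        have "co j (?L ys) - (\<Sum>s<n. co j (\<beta> (ys[s := A (ys ! s)]))) = 0"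
        proof (rule alternating_form_omit_zeroI[OF F refl])
          fix i assume i: "i \<le> n"
          show "co j (?L (omit i bs)) - (\<Sum>s<n. co j (\<beta> ((omit i bs)[s := A (omit i bs ! s)]))) = 0"
            using key[OF i j] R i j D[OF length_omit_bs[OF refl i] set_omit_bs] by simp
        qed (use ys in auto)
        then show "co j (?L ys) = co j (?D ys)" using D ys by simp
      qed
    qed
  qed
qed

lemma ad_basis_distinct:
  assumes ab: "a \<le> n" "b \<le> n" "a \<noteq> b" and js: "distinct js" "set js = {..n} - {a, b}"
  obtains s where "s * s = 1" and "\<And>j l. j \<le> n \<Longrightarrow> l \<le> n \<Longrightarrow> co j (\<beta> (map e js @ [e l])) =
      (if l = b then s * K a j else if l = a then - (s * K b j) else 0)"
proof -
  obtain s where s: "s * s = (1::'f)"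
    and t: "\<And>t. alternating_form_on scale n V t \<Longrightarrow>
      t (map e js @ [e b]) = s * ((-1) ^ a * t (omit a bs)) \<and>
      t (map e js @ [e a]) = - (s * ((-1) ^ b * t (omit b bs)))"
    using alternating_form_omit_two[OF refl ab js] by metis
  have len: "length js = n - 1"
    using js ab by (simp flip: distinct_card)
  show thesis
  proof (rule that[OF s])
    fix j l assume jl: "j \<le> n" "l \<le> n"
    show "co j (\<beta> (map e js @ [e l])) =
      (if l = b then s * K a j else if l = a then - (s * K b j) else 0)"
    proof (cases "l = a \<or> l = b")
      case True
      then show ?thesis using t[OF co_bracket[OF jl(1)]] ab by (auto simp: K_def)
    next
      case False
      then have "l \<in> set js" using js jl by auto
      then have "\<not> distinct (map e js @ [e l])" by auto
      moreover have "length (map e js @ [e l]) = n" using len n_pos by simp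
      moreover have "set (map e js @ [e l]) \<subseteq> V"
        using map_e_in[of js] js(2) e_in_V[OF jl(2)] by simp
      ultimately have "co j (\<beta> (map e js @ [e l])) = 0"
        by (intro alternating_form_repeated[OF co_bracket[OF jl(1)]])
      then show ?thesis using False by simp
    qed
  qed
qed

lemma ad_basis:
  assumes js: "length js = n - 1" "set js \<subseteq> {..n}"
  obtains a b s where "a \<le> n" "b \<le> n" "a \<noteq> b"
    "\<And>j l. j \<le> n \<Longrightarrow> l \<le> n \<Longrightarrow> co j (\<beta> (map e js @ [e l])) =
      (if l = b then s * K a j else if l = a then - (s * K b j) else 0)"
proof (cases "distinct js")
  case True
  have "card ({..n} - set js) = 2"
    using js True n_pos by (simp add: card_Diff_subset distinct_card)
  then obtain a b where ab: "{..n} - set js = {a, b}" "a \<noteq> b" unfolding card_2_iff by blast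
  have "a \<in> {..n}" "b \<in> {..n}" using ab(1) by blast+
  then have le: "a \<le> n" "b \<le> n" by simp_all
  have "set js = {..n} - {a, b}" using js ab(1) by blast
  from ad_basis_distinct[OF le ab(2) True this] that[OF le ab(2)] show thesis by metis
next
  case False
  have "co j (\<beta> (map e js @ [e l])) = 0" if "j \<le> n" "l \<le> n" for j l
  proof (rule alternating_form_repeated[OF co_bracket[OF that(1)]])
    show "\<not> distinct (map e js @ [e l])" using False by (auto simp: distinct_map)
    show "set (map e js @ [e l]) \<subseteq> V" using map_e_in[OF js(2)] e_in_V[OF that(2)] by simp
  qed (use js n_pos in auto)
  then show thesis using n_pos by (intro that[of 0 1 0]) auto
qed

text \<open>
  The condition \<open>A T + T A\<^sup>t = tr(A) T\<close> for the adjoint map \<open>A = T C\<close>, with \<open>C\<close> skew-symmetric of rank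
  two supported on the indices \<open>a\<close> and \<open>b\<close>.  It reads \<open>T C (T - T\<^sup>t) = tr(T C) T\<close>: every term has a
  factor from \<open>T - T\<^sup>t\<close>, so symmetric matrices satisfy it, and for skew-symmetric ones it is the
  Pluecker relation that expresses rank at most two.
\<close>

definition filippov_quadric :: "nat \<Rightarrow> nat \<Rightarrow> nat \<Rightarrow> nat \<Rightarrow> 'f" where
  "filippov_quadric a b i j = (K i b - K b i) * K a j + (K a i - K i a) * K b j + (K b a - K a b) * K i j"

lemma derivation_ad_basis_iff:
  assumes ab: "a \<le> n" "b \<le> n" "a \<noteq> b" and js: "length js = n - 1" "set js \<subseteq> {..n}"
    and val: "\<And>j l. j \<le> n \<Longrightarrow> l \<le> n \<Longrightarrow> co j (\<beta> (map e js @ [e l])) =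
      (if l = b then s * K a j else if l = a then - (s * K b j) else 0)"
  shows "derivation (\<lambda>y. \<beta> (map e js @ [y])) \<longleftrightarrow> (\<forall>i\<le>n. \<forall>j\<le>n. s * filippov_quadric a b i j = 0)"
proof -
  have A: "linear_endo_on scale V (\<lambda>y. \<beta> (map e js @ [y]))"
    using js map_e_in[OF js(2)] by (intro ad_linear) simp_all
  have "((\<Sum>l\<le>n. K i l * co j (\<beta> (map e js @ [e l]))) =
     (\<Sum>k\<le>n. co k (\<beta> (map e js @ [e k])) * K i j - co i (\<beta> (map e js @ [e k])) * K k j)) \<longleftrightarrow>
     s * filippov_quadric a b i j = 0" if "i \<le> n" "j \<le> n" for i j
  proof -
    have "(\<Sum>l\<le>n. K i l * co j (\<beta> (map e js @ [e l]))) =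
       (\<Sum>l\<le>n. (if l = b then s * (K i b * K a j) else 0) + (if l = a then - (s * (K i a * K b j)) else 0))"
      using ab that by (intro sum.cong refl) (auto simp: val)
    also have "\<dots> = s * (K i b * K a j - K i a * K b j)"
      using ab by (simp add: sum.distrib algebra_simps)
    finally have 1: "(\<Sum>l\<le>n. K i l * co j (\<beta> (map e js @ [e l]))) = s * (K i b * K a j - K i a * K b j)" .
    have "(\<Sum>k\<le>n. co k (\<beta> (map e js @ [e k])) * K i j - co i (\<beta> (map e js @ [e k])) * K k j) =
       (\<Sum>k\<le>n. (if k = b then s * (K a b * K i j - K a i * K b j) else 0) +
          (if k = a then - (s * (K b a * K i j - K b i * K a j)) else 0))"
      using ab that by (intro sum.cong refl) (auto simp: val algebra_simps)
    also have "\<dots> = s * (K a b * K i j - K a i * K b j - K b a * K i j + K b i * K a j)"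
      using ab by (simp add: sum.distrib algebra_simps)
    finally show ?thesis unfolding 1 filippov_quadric_def by (simp only: flip: eq_iff_diff_eq_0)
       (simp add: algebra_simps)
  qed
  then show ?thesis unfolding derivation_iff[OF A] by blast
qed

text \<open>
  The Filippov identity says that the adjoint maps are derivations.  It is multilinear in their
  parameters, so adjoint maps of basis vectors suffice, and these are known explicitly.
\<close>

proposition n_lie_algebra_iff_filippov_quadric:
  "n_lie_algebra scale n V \<beta> \<longleftrightarrow> (\<forall>a\<le>n. \<forall>b\<le>n. \<forall>i\<le>n. \<forall>j\<le>n. filippov_quadric a b i j = 0)"
proof
  assume L: "n_lie_algebra scale n V \<beta>"
  show "\<forall>a\<le>n. \<forall>b\<le>n. \<forall>i\<le>n. \<forall>j\<le>n. filippov_quadric a b i j = 0"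
  proof (intro allI impI)
    fix a b i j assume *: "a \<le> n" "b \<le> n" "i \<le> n" "j \<le> n"
    show "filippov_quadric a b i j = 0"
    proof (cases "a = b")
      case True
      then show ?thesis by (simp add: filippov_quadric_def algebra_simps)
    next
      case False
      define js where "js = filter (\<lambda>k. k \<noteq> a \<and> k \<noteq> b) [0..<Suc n]"
      have js: "distinct js" "set js = {..n} - {a, b}" by (auto simp: js_def)
      then have len: "length js = n - 1" using * False by (simp flip: distinct_card)
      obtain s where s: "s * s = 1" and val: "\<And>j l. j \<le> n \<Longrightarrow> l \<le> n \<Longrightarrow>
        co j (\<beta> (map e js @ [e l])) =
        (if l = b then s * K a j else if l = a then - (s * K b j) else 0)"
        using ad_basis_distinct[OF *(1,2) False js] by metis
      have "set (map e js) \<subseteq> V" using map_e_in[of js] js(2) by simp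
      then have "derivation (\<lambda>y. \<beta> (map e js @ [y]))"
        using L len unfolding n_lie_algebra_iff_derivation by simp
      then have "s * filippov_quadric a b i j = 0"
        using derivation_ad_basis_iff[OF *(1,2) False len _ val] js * by blast
      then show ?thesis using s by auto
    qed
  qed
next
  assume Q: "\<forall>a\<le>n. \<forall>b\<le>n. \<forall>i\<le>n. \<forall>j\<le>n. filippov_quadric a b i j = 0"
  show "n_lie_algebra scale n V \<beta>"
    unfolding n_lie_algebra_iff_derivation derivation_def
  proof (intro allI impI)
    fix xs ys assume xs: "length xs = n - 1 \<and> set xs \<subseteq> V" and ys: "length ys = n \<and> set ys \<subseteq> V"
    have ysV: "ys ! s \<in> V" if "s < n" for s using ys that by auto
    have \<beta>V: "\<beta> (xs @ [y]) \<in> V" if "length xs = n - 1" "set xs \<subseteq> V" "y \<in> V" for xs y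
      using linear_endo_in[OF ad_linear] that by blast
    have D_in: "\<beta> (ys[s := \<beta> (xs @ [ys ! s])]) \<in> V"
      if "length xs = n - 1" "set xs \<subseteq> V" "s < n" for xs s
      using that ys ysV by (intro bracket_in set_list_update_subset \<beta>V) auto
    show "\<beta> (xs @ [\<beta> ys]) = (\<Sum>s<n. \<beta> (ys[s := \<beta> (xs @ [ys ! s])]))"
    proof (rule coordinates_eqI')
      show "\<beta> (xs @ [\<beta> ys]) \<in> V" using xs ys by (intro \<beta>V bracket_in) auto
      show "(\<Sum>s<n. \<beta> (ys[s := \<beta> (xs @ [ys ! s])])) \<in> V"
        using xs D_in by (intro in_V_sum) auto
      fix j assume j: "j \<le> n"
      let ?F = "\<lambda>xs. co j (\<beta> (xs @ [\<beta> ys])) - (\<Sum>s<n. co j (\<beta> (ys[s := \<beta> (xs @ [ys ! s])])))"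
      have co_D: "co j (\<Sum>s<n. \<beta> (ys[s := \<beta> (xs @ [ys ! s])])) =
          (\<Sum>s<n. co j (\<beta> (ys[s := \<beta> (xs @ [ys ! s])])))"
        if "length xs = n - 1" "set xs \<subseteq> V" for xs
        using that j D_in by (intro co_sum_in) auto
      have "multilinear_form_on scale (n - 1) V ?F"
        unfolding multilinear_form_on_def
      proof (intro allI impI)
        fix xs i x y c
        assume *: "length xs = n - 1 \<and> set xs \<subseteq> V \<and> i < n - 1 \<and> x \<in> V \<and> y \<in> V"
        then have i: "i < n" by linarith
        have upd: "\<beta> (xs[i := x + y] @ [z]) = \<beta> (xs[i := x] @ [z]) + \<beta> (xs[i := y] @ [z])"
          "\<beta> (xs[i := scale c x] @ [z]) = scale c (\<beta> (xs[i := x] @ [z]))" if z: "z \<in> V" for z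
          using bracket_add[of "xs @ [z]" i x y] bracket_scale[of "xs @ [z]" i x c] * z n_pos i
          by (simp_all add: list_update_append)
        have V: "\<beta> (xs[i := x] @ [z]) \<in> V" "\<beta> (xs[i := y] @ [z]) \<in> V" if z: "z \<in> V" for z
          using * z by (auto intro!: \<beta>V dest!: subsetD[OF set_update_subset_insert])
        note M = alternating_form_multilinear[OF co_bracket[OF j]]
        have co_j: "linear_form_on scale V (co j)" using j by (intro co_linear) simp
        have \<beta>y: "\<beta> ys \<in> V" using ys by (intro bracket_in) auto
        show "?F (xs[i := x + y]) = ?F (xs[i := x]) + ?F (xs[i := y]) \<and>
            ?F (xs[i := scale c x]) = c * ?F (xs[i := x])"
          using ys V[OF \<beta>y] by (simp add: upd[OF \<beta>y] upd[OF ysV] V ysV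
             multilinear_form_add[OF M] multilinear_form_scale[OF M]
             linear_form_add[OF co_j] linear_form_scale[OF co_j]
             sum.distrib right_diff_distrib sum_distrib_left)
      qed
      then have "?F xs = 0"
      proof (rule multilinear_form_zeroI)
        fix js assume js: "length js = n - 1" "set js \<subseteq> {..<Suc n}"
        then have js': "set js \<subseteq> {..n}" by (simp add: lessThan_Suc_atMost)
        obtain a b s where ab: "a \<le> n" "b \<le> n" "a \<noteq> b" and
          val: "\<And>j l. j \<le> n \<Longrightarrow> l \<le> n \<Longrightarrow> co j (\<beta> (map e js @ [e l])) =
            (if l = b then s * K a j else if l = a then - (s * K b j) else 0)"
          using ad_basis[OF js(1) js'] by metis
        have "derivation (\<lambda>y. \<beta> (map e js @ [y])) \<longleftrightarrow> (\<forall>i\<le>n. \<forall>j\<le>n. s * filippov_quadric a b i j = 0)"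
        proof (rule derivation_ad_basis_iff[OF ab js(1) js'])
          fix j l assume "j \<le> n" "l \<le> n"
          then show "co j (\<beta> (map e js @ [e l])) =
            (if l = b then s * K a j else if l = a then - (s * K b j) else 0)"
            by (rule val)
        qed
        then have "derivation (\<lambda>y. \<beta> (map e js @ [y]))" using Q ab by simp
        then have "\<beta> (map e js @ [\<beta> ys]) = (\<Sum>s<n. \<beta> (ys[s := \<beta> (map e js @ [ys ! s])]))"
          unfolding derivation_def using ys by blast
        then show "?F (map e js) = 0"
          using co_D[of "map e js"] js(1) map_e_in[OF js'] by simp
      qed (use xs in auto)
      then show "co j (\<beta> (xs @ [\<beta> ys])) = co j (\<Sum>s<n. \<beta> (ys[s := \<beta> (xs @ [ys ! s])]))"
        using co_D xs by simp
    qed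
  qed
qed

end

section \<open>Skew-symmetry does not depend on the basis\<close>

text \<open>
  The expression \<open>g(v) \<beta>(ys) - \<Sum>\<^sub>s g(ys\<^sub>s) \<beta>(ys[s := v])\<close> is alternating in the \<open>n + 1\<close> vectors \<open>v, ys\<close>,
  hence their volume times the vector \<open>T g\<close>.  Pairing with \<open>h\<close> makes the bilinear form \<open>h(T g)\<close>
  accessible without a basis.
\<close>

definition skew_defect ::
  "('f::field \<Rightarrow> 'v::ab_group_add \<Rightarrow> 'v) \<Rightarrow> nat \<Rightarrow> ('v list \<Rightarrow> 'v) \<Rightarrow>
     ('v \<Rightarrow> 'f) \<Rightarrow> ('v \<Rightarrow> 'f) \<Rightarrow> 'v \<Rightarrow> 'v list \<Rightarrow> 'f" where
  "skew_defect scale n \<beta> g h v ys =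
     g v * h (\<beta> ys) - (\<Sum>s<n. h (\<beta> (ys[s := scale (g (ys ! s)) v])))"

text \<open>
  In view of \<open>skew_defect\<close> this says \<open>h(T g) + g(T h) = 0\<close>.  The matrix of \<open>T\<close> depends on the chosen
  basis, but whether it is skew-symmetric does not; type \<open>(c\<^sub>3)\<close> is read off in one basis, and the
  compatibility condition in another.
\<close>

definition skew_bracket ::
  "('f::field \<Rightarrow> 'v::ab_group_add \<Rightarrow> 'v) \<Rightarrow> nat \<Rightarrow> 'v set \<Rightarrow> ('v list \<Rightarrow> 'v) \<Rightarrow> bool" where
  "skew_bracket scale n V \<beta> \<longleftrightarrow>
     (\<forall>g h v ys. linear_form_on scale V g \<and> linear_form_on scale V h \<and> v \<in> V \<and>
        length ys = n \<and> set ys \<subseteq> V \<longrightarrow>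
        skew_defect scale n \<beta> g h v ys + skew_defect scale n \<beta> h g v ys = 0)"

context bracket_coordinates
begin

lemma rank_one_endo:
  assumes "linear_form_on scale V g" "v \<in> V"
  shows "linear_endo_on scale V (\<lambda>y. scale (g y) v)"
  using assms unfolding linear_endo_on_def
  by (auto simp: linear_form_add linear_form_scale subspace_scale[OF subspace_V] scale_left_distrib)

lemma skew_defect_alternating:
  assumes g: "linear_form_on scale V g" and h: "linear_form_on scale V h" and v: "v \<in> V"
  shows "alternating_form_on scale n V (skew_defect scale n \<beta> g h v)"
  unfolding skew_defect_def
  by (intro alternating_form_diff alternating_form_scaled form_bracket h
      alternating_form_derivation[OF form_bracket[OF h] rank_one_endo[OF g v]])

lemma skew_defect_linear:
  assumes g: "linear_form_on scale V g" and h: "linear_form_on scale V h"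
    and ys: "length ys = n" "set ys \<subseteq> V"
  shows "linear_form_on scale V (\<lambda>v. skew_defect scale n \<beta> g h v ys)"
proof -
  note M = alternating_form_multilinear[OF form_bracket[OF h]]
  have eq: "skew_defect scale n \<beta> g h v ys =
      g v * h (\<beta> ys) - (\<Sum>s<n. g (ys ! s) * h (\<beta> (ys[s := v])))" if "v \<in> V" for v
    unfolding skew_defect_def using that ys multilinear_form_scale[OF M ys] by simp
  show ?thesis
    using multilinear_form_add[OF M ys] multilinear_form_scale[OF M ys]
    unfolding linear_form_on_def
    by (auto simp: eq subspace_add[OF subspace_V] subspace_scale[OF subspace_V]
        linear_form_add[OF g] linear_form_scale[OF g] algebra_simps sum.distrib sum_distrib_left)
qed

text \<open>
  The trace formula for the endomorphism \<open>y \<mapsto> g(y) e\<^sub>m\<close> of rank one: its trace cancels the first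
  term of the defect.
\<close>

lemma skew_defect_basis:
  assumes g: "linear_form_on scale V g" and h: "linear_form_on scale V h"
    and mi: "m \<le> n" "i \<le> n"
  shows "skew_defect scale n \<beta> g h (e m) (omit i bs) =
    (if m = i then (-1) ^ i * (\<Sum>k\<le>n. \<Sum>j\<le>n. K k j * g (e k) * h (e j)) else 0)"
proof -
  let ?T = "\<lambda>k. (-1) ^ k * h (\<beta> (omit k bs))"
  have co: "co k (scale (g (e k')) (e m)) = (if k = m then g (e k') else 0)" if "k \<le> n" "k' \<le> n" for k k'
    using that mi by (simp add: linear_form_scale[OF co_linear] e_in_V co_e)
  have "(\<Sum>s<n. h (\<beta> ((omit i bs)[s := scale (g (omit i bs ! s)) (e m)]))) =
     (-1) ^ i * (\<Sum>k\<le>n. co k (scale (g (e k)) (e m)) * ?T i - co i (scale (g (e k)) (e m)) * ?T k)"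
    by (rule alternating_form_trace[OF form_bracket[OF h] refl mi(2) rank_one_endo[OF g e_in_V[OF mi(1)]]])
  also have "(\<Sum>k\<le>n. co k (scale (g (e k)) (e m)) * ?T i - co i (scale (g (e k)) (e m)) * ?T k) =
     (\<Sum>k\<le>n. (if k = m then g (e k) * ?T i else 0) - (if m = i then g (e k) * ?T k else 0))"
    using mi by (intro sum.cong refl) (auto simp: co)
  also have "\<dots> = g (e m) * ?T i - (if m = i then \<Sum>k\<le>n. g (e k) * ?T k else 0)"
    using mi by (simp add: sum_subtractf)
  finally have 1: "skew_defect scale n \<beta> g h (e m) (omit i bs) =
      (if m = i then (-1) ^ i * (\<Sum>k\<le>n. g (e k) * ?T k) else 0)"
    unfolding skew_defect_def by (simp add: right_diff_distrib mult.left_commute[of "(-1) ^ i"] flip: mult.assoc power_mult_distrib)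
  have "?T k = (\<Sum>j\<le>n. K k j * h (e j))" if "k \<le> n" for k
  proof -
    have "\<beta> (omit k bs) \<in> V"
      by (intro bracket_in length_omit_bs set_omit_bs refl that)
    from linear_form_expand[OF h this] show ?thesis
      unfolding K_def lessThan_Suc_atMost by (simp add: sum_distrib_left mult.assoc)
  qed
  then show ?thesis unfolding 1 by (auto simp: sum_distrib_left mult_ac)
qed

proposition skew_bracket_iff:
  "skew_bracket scale n V \<beta> \<longleftrightarrow> (\<forall>i\<le>n. \<forall>j\<le>n. K i j = - K j i)"
proof
  assume S: "skew_bracket scale n V \<beta>"
  show "\<forall>i\<le>n. \<forall>j\<le>n. K i j = - K j i"
  proof (intro allI impI)
    fix a b assume ab: "a \<le> n" "b \<le> n"
    have lin: "linear_form_on scale V (co a)" "linear_form_on scale V (co b)"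
      using ab by (auto intro: co_linear)
    have val: "(\<Sum>k\<le>n. \<Sum>j\<le>n. K k j * co p (e k) * co q (e j)) = K p q" if "p \<le> n" "q \<le> n" for p q
    proof -
      have "(\<Sum>k\<le>n. \<Sum>j\<le>n. K k j * co p (e k) * co q (e j)) =
        (\<Sum>k\<le>n. if k = p then K p q else 0)"
        using that by (intro sum.cong refl) (auto simp: co_e if_distrib[of "(*) _"] cong: if_cong)
      then show ?thesis using that by simp
    qed
    have "skew_defect scale n \<beta> (co a) (co b) (e 0) (omit 0 bs) +
        skew_defect scale n \<beta> (co b) (co a) (e 0) (omit 0 bs) = 0"
      using S lin e_in_V[of 0] length_omit_bs[OF refl, of 0] set_omit_bs
      unfolding skew_bracket_def by blast
    then have "K a b + K b a = 0"
      using ab by (simp add: skew_defect_basis lin val)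
    then show "K a b = - K b a" by (simp add: eq_neg_iff_add_eq_0)
  qed
next
  assume K: "\<forall>i\<le>n. \<forall>j\<le>n. K i j = - K j i"
  show "skew_bracket scale n V \<beta>"
    unfolding skew_bracket_def
  proof (intro allI impI, elim conjE)
    fix g h v ys
    assume g: "linear_form_on scale V g" and h: "linear_form_on scale V h" and v: "v \<in> V"
      and ys: "length ys = n" "set ys \<subseteq> V"
    let ?F = "\<lambda>v ys. skew_defect scale n \<beta> g h v ys + skew_defect scale n \<beta> h g v ys"
    have alt: "alternating_form_on scale n V (?F v)" if "v \<in> V" for v
      using alternating_form_lincomb[OF skew_defect_alternating[OF g h that]
          skew_defect_alternating[OF h g that], of 1 1] by simp
    have lin: "linear_form_on scale V (\<lambda>v. ?F v ys)"
      using skew_defect_linear[OF g h ys] skew_defect_linear[OF h g ys]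
      by (simp add: linear_form_on_def algebra_simps)
    have "(\<Sum>k\<le>n. \<Sum>j\<le>n. K k j * h (e k) * g (e j)) = (\<Sum>j\<le>n. \<Sum>k\<le>n. K k j * h (e k) * g (e j))"
      by (rule sum.swap)
    also have "\<dots> = (\<Sum>j\<le>n. \<Sum>k\<le>n. - (K j k * g (e j) * h (e k)))"
    proof (intro sum.cong refl)
      fix j k assume "j \<in> {..n}" "k \<in> {..n}"
      then have "K k j = - K j k" using K by blast
      then show "K k j * h (e k) * g (e j) = - (K j k * g (e j) * h (e k))"
        by (simp only: mult_minus_left mult.assoc mult.commute[of "h (e k)"])
    qed
    finally have "(\<Sum>k\<le>n. \<Sum>j\<le>n. K k j * g (e k) * h (e j)) +
        (\<Sum>k\<le>n. \<Sum>j\<le>n. K k j * h (e k) * g (e j)) = 0"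
      by (simp add: sum_negf)
    then have "?F (e m) (omit i bs) = 0" if "m \<le> n" "i \<le> n" for m i
      using that by (auto simp: skew_defect_basis g h simp flip: distrib_left)
    then have "?F (e m) ys = 0" if "m \<le> n" for m
      using that by (intro alternating_form_omit_zeroI[OF alt[OF e_in_V] refl _ ys]) auto
    then show "?F v ys = 0"
      using linear_form_expand[OF lin v] by simp
  qed
qed

end

section \<open>Tensors as forms on the dual space\<close>

lemma fscale_apply: "fscale c g x = c * g x"
  by (simp add: fscale_def)

lemma sum_fun_apply: "(\<Sum>i\<in>S. f i) x = (\<Sum>i\<in>S. f i x)"
  by (induction S rule: infinite_finite_induct) auto

lemma dual_space_iff:
  "vector_space scale \<Longrightarrow> f \<in> dual_space scale \<longleftrightarrow> linear_form_on scale UNIV f"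
proof -
  have "vector_space ((*) :: 'a \<Rightarrow> 'a \<Rightarrow> 'a)"
    by unfold_locales (auto simp: algebra_simps)
  then show "vector_space scale \<Longrightarrow> f \<in> dual_space scale \<longleftrightarrow> linear_form_on scale UNIV f"
    by (simp add: dual_space_def Vector_Spaces.linear_iff linear_form_on_def)
qed

lemma module_fscale: "module fscale"
  using vector_space_fscale vector_space_def module_def by (metis module_iff_vector_space)

lemma subspace_dual_space:
  assumes "vector_space scale"
  shows "module.subspace fscale (dual_space scale)"
  unfolding module.subspace_def[OF module_fscale]
  by (auto simp: dual_space_iff[OF assms] linear_form_on_def fscale_def algebra_simps)

text \<open>
  Both properties pass to linear combinations, so it is enough to see them for pure tensors.
\<close>

lemma tensor_power_cases:
  assumes "t \<in> tensor_power scale k" and vs: "vector_space scale"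
  shows "(\<forall>fs. fs \<notin> functional_tuples scale k \<longrightarrow> t fs = 0) \<and>
    multilinear_form_on fscale k (dual_space scale) t"
  using assms(1) unfolding tensor_power_def
proof (induction rule: module.span_induct[OF module_fscale, consumes 1])
  case 1
  show ?case
    unfolding module.subspace_def[OF module_fscale] multilinear_form_on_def
    by (auto simp: fscale_def algebra_simps)
next
  case (2 t)
  then obtain xs where t: "t = pure_tensor scale xs" and len: "length xs = k" by auto
  have "multilinear_form_on fscale k (dual_space scale) t"
    unfolding multilinear_form_on_def
  proof (intro allI impI)
    fix fs i f g c
    assume *: "length fs = k \<and> set fs \<subseteq> dual_space scale \<and> i < k \<and>
      f \<in> dual_space scale \<and> g \<in> dual_space scale"
    have dual: "f + g \<in> dual_space scale" "fscale c f \<in> dual_space scale"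
      using * subspace_dual_space[OF vs] unfolding module.subspace_def[OF module_fscale] by auto
    have val: "t (fs[i := h]) = h (xs ! i) * (\<Prod>l\<in>{..<k} - {i}. (fs ! l) (xs ! l))"
      if "h \<in> dual_space scale" for h
    proof -
      have "fs[i := h] \<in> functional_tuples scale k"
        using * that by (simp add: functional_tuples_def set_list_update_subset)
      then have "t (fs[i := h]) = (\<Prod>l<k. (fs[i := h] ! l) (xs ! l))"
        by (simp add: t pure_tensor_def len)
      also have "\<dots> = (fs[i := h] ! i) (xs ! i) * (\<Prod>l\<in>{..<k} - {i}. (fs[i := h] ! l) (xs ! l))"
        using * by (intro prod.remove) auto
      also have "(\<Prod>l\<in>{..<k} - {i}. (fs[i := h] ! l) (xs ! l)) = (\<Prod>l\<in>{..<k} - {i}. (fs ! l) (xs ! l))"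
        by (intro prod.cong refl) auto
      finally show ?thesis using * by simp
    qed
    show "t (fs[i := f + g]) = t (fs[i := f]) + t (fs[i := g]) \<and>
        t (fs[i := fscale c f]) = c * t (fs[i := f])"
      using * dual by (simp add: val fscale_def algebra_simps)
  qed
  then show ?case by (simp add: t pure_tensor_def len)
qed

lemma wedge_power_alternating:
  assumes "t \<in> wedge_power scale k" and vs: "vector_space scale"
  shows "alternating_form_on fscale k (dual_space scale) t"
  using assms tensor_power_cases[OF _ vs, of t k]
  by (auto simp: wedge_power_def alternating_form_on_def functional_tuples_def)

lemma wedge_power_outside:
  assumes "t \<in> wedge_power scale k" "vector_space scale" "fs \<notin> functional_tuples scale k"
  shows "t fs = 0"
  using assms tensor_power_cases[of t scale k] by (auto simp: wedge_power_def)

lemma (in coordinates) dual_coordinates: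
  assumes V: "V = UNIV"
  shows "coordinates fscale (dual_space scale) d co (\<lambda>i f. f (e i))"
proof (intro coordinates.intro coordinates_axioms.intro vector_space_fscale)
  show "module.subspace fscale (dual_space scale)"
    by (rule subspace_dual_space[OF vector_space_axioms])
  show "co i \<in> dual_space scale" if "i < d" for i
    using co_linear[OF that] by (simp add: dual_space_iff[OF vector_space_axioms] V)
  show "linear_form_on fscale (dual_space scale) (\<lambda>f. f (e j))" for j
    by (simp add: linear_form_on_def fscale_def)
  show "co i (e j) = (if j = i then 1 else 0)" if "i < d" "j < d" for i j
    using co_e[OF that(2,1)] by simp
  show "f = (\<Sum>j<d. fscale (f (e j)) (co j))" if "f \<in> dual_space scale" for f
  proof
    fix x
    have "f x = (\<Sum>j<d. co j x * f (e j))"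
      using that V by (intro linear_form_expand) (auto simp: dual_space_iff[OF vector_space_axioms])
    then show "f x = (\<Sum>j<d. fscale (f (e j)) (co j)) x"
      by (simp add: sum_fun_apply fscale_def mult.commute)
  qed
qed

section \<open>The coalgebra condition\<close>

locale bracket_cobracket = bracket_coordinates scale UNIV n e co \<mu>
  for scale :: "'f::field_char_0 \<Rightarrow> 'v::ab_group_add \<Rightarrow> 'v" and n e co \<mu> +
  fixes \<Delta> :: "'v \<Rightarrow> ('v \<Rightarrow> 'f) list \<Rightarrow> 'f"
  assumes cobracket_linear: "Vector_Spaces.linear scale fscale \<Delta>"
    and cobracket_wedge: "range \<Delta> \<subseteq> wedge_power scale n"
begin

lemma cobracket_alternating: "alternating_form_on fscale n (dual_space scale) (\<Delta> x)"
  using cobracket_wedge by (intro wedge_power_alternating vector_space_axioms) auto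

lemma cobracket_outside: "fs \<notin> functional_tuples scale n \<Longrightarrow> \<Delta> x fs = 0"
  using cobracket_wedge by (intro wedge_power_outside[OF _ vector_space_axioms]) auto

lemma cobracket_add: "\<Delta> (x + y) fs = \<Delta> x fs + \<Delta> y fs"
  and cobracket_scale: "\<Delta> (scale c x) fs = c * \<Delta> x fs"
  using cobracket_linear by (simp_all add: Vector_Spaces.linear_iff fscale_apply)

lemma dual_map_in: "dual_map \<Delta> fs \<in> dual_space scale"
  by (simp add: dual_space_iff[OF vector_space_axioms] linear_form_on_def dual_map_def
      cobracket_add cobracket_scale)

sublocale dual: bracket_coordinates fscale "dual_space scale" n co "\<lambda>i f. f (e i)" "dual_map \<Delta>"
proof (intro bracket_coordinates.intro bracket_coordinates_axioms.intro dual_coordinates refl n_pos)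
  note M = alternating_form_multilinear[OF cobracket_alternating]
  show "multilinear_on fscale n (dual_space scale) (dual_map \<Delta>)"
    unfolding multilinear_on_def
  proof (intro allI impI conjI ballI)
    fix fs i f g c assume *: "length fs = n \<and> set fs \<subseteq> dual_space scale" "i < n"
      "f \<in> dual_space scale" "g \<in> dual_space scale"
    show "dual_map \<Delta> (fs[i := f + g]) = dual_map \<Delta> (fs[i := f]) + dual_map \<Delta> (fs[i := g])"
      using * by (intro ext) (simp add: dual_map_def multilinear_form_add[OF M])
    show "dual_map \<Delta> (fs[i := fscale c f]) = fscale c (dual_map \<Delta> (fs[i := f]))"
      using * by (intro ext) (simp add: dual_map_def multilinear_form_scale[OF M] fscale_apply)
  qed (rule dual_map_in)
  show "alternating_on fscale n (dual_space scale) (dual_map \<Delta>)"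
    unfolding alternating_on_def
  proof (intro allI impI)
    fix fs \<sigma> assume *: "length fs = n \<and> set fs \<subseteq> dual_space scale \<and> \<sigma> permutes {..<n}"
    show "dual_map \<Delta> fs = fscale (of_int (sign \<sigma>)) (dual_map \<Delta> (permute_list \<sigma> fs))"
    proof
      fix x show "dual_map \<Delta> fs x = fscale (of_int (sign \<sigma>)) (dual_map \<Delta> (permute_list \<sigma> fs)) x"
        using alternating_form_permute[OF cobracket_alternating, of fs \<sigma> x] *
        by (auto simp: dual_map_def fscale_def sign_def)
    qed
  qed
qed

text \<open>
  The coalgebra condition is an equation between tensors of degree \<open>2 * n - 1\<close>.  Evaluated at a list
  of functionals \<open>xs @ ys\<close> and regarded as a functional of the remaining vector, it is the Filippov
  identity for the dual map at \<open>xs\<close> and \<open>ys\<close>.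
\<close>

lemma n_lie_coalgebra_iff:
  "n_lie_coalgebra scale n \<Delta> \<longleftrightarrow> n_lie_algebra fscale n (dual_space scale) (dual_map \<Delta>)"
proof -
  let ?V = "dual_space scale" and ?b = "dual_map \<Delta>"
  define w where "w x = id_tensor_map scale n \<Delta> (\<Delta> x)" for x
  define P where "P xs ys x \<longleftrightarrow> \<Delta> x (xs @ [?b ys]) =
      (\<Sum>s<n. (-1) ^ (n - Suc s) * \<Delta> x (omit s ys @ [?b (xs @ [ys ! s])]))" for xs ys x
  have w: "w x (zs @ zs') = \<Delta> x (zs @ [?b zs'])"
    if "length zs = n - 1" "length zs' = n" "set zs \<subseteq> ?V" "set zs' \<subseteq> ?V" for x zs zs'
    using that n_pos by (simp add: w_def id_tensor_map_def functional_tuples_def dual_map_def mult_2)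
  have om: "omega scale n s (w x) (xs @ ys) = \<Delta> x (omit s ys @ [?b (xs @ [ys ! s])])"
    if *: "length xs = n - 1" "length ys = n" "set xs \<subseteq> ?V" "set ys \<subseteq> ?V" "s < n" for x xs ys s
  proof -
    have "xs @ ys \<in> functional_tuples scale (2 * n - 1)"
      using * n_pos by (simp add: functional_tuples_def)
    then have "omega scale n s (w x) (xs @ ys) = w x (omit s ys @ (xs @ [ys ! s]))"
      using * by (simp add: omega_def)
    also have "\<dots> = \<Delta> x (omit s ys @ [?b (xs @ [ys ! s])])"
      using * n_pos set_omit_subset[of s ys] by (intro w) (auto simp: length_omit)
    finally show ?thesis .
  qed
  have P_iff: "(w x - (\<Sum>s<n. fscale ((-1) ^ (n - Suc s)) (omega scale n s (w x)))) (xs @ ys) = 0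
      \<longleftrightarrow> P xs ys x"
    if *: "length xs = n - 1" "length ys = n" "set xs \<subseteq> ?V" "set ys \<subseteq> ?V" for x xs ys
    using * by (simp add: sum_fun_apply fscale_def w om P_def)
  have out: "(w x - (\<Sum>s<n. fscale ((-1) ^ (n - Suc s)) (omega scale n s (w x)))) fs = 0"
    if "fs \<notin> functional_tuples scale (2 * n - 1)" for x fs
    using that by (simp add: sum_fun_apply fscale_def w_def id_tensor_map_def omega_def)
  have "n_lie_coalgebra scale n \<Delta> \<longleftrightarrow> (\<forall>x fs.
      (w x - (\<Sum>s<n. fscale ((-1) ^ (n - Suc s)) (omega scale n s (w x)))) fs = 0)"
    using vector_space_axioms cobracket_linear cobracket_wedge
    unfolding n_lie_coalgebra_def Let_def w_def fun_eq_iff zero_fun_def by simp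
  also have "\<dots> \<longleftrightarrow> (\<forall>xs ys. length xs = n - 1 \<and> set xs \<subseteq> ?V \<and> length ys = n \<and> set ys \<subseteq> ?V \<longrightarrow>
      (\<forall>x. P xs ys x))"
  proof (intro iffI allI impI)
    fix x fs
    assume *: "\<forall>xs ys. length xs = n - 1 \<and> set xs \<subseteq> ?V \<and> length ys = n \<and> set ys \<subseteq> ?V \<longrightarrow>
      (\<forall>x. P xs ys x)"
    show "(w x - (\<Sum>s<n. fscale ((-1) ^ (n - Suc s)) (omega scale n s (w x)))) fs = 0"
    proof (cases "fs \<in> functional_tuples scale (2 * n - 1)")
      case True
      define xs ys where "xs = take (n - 1) fs" and "ys = drop (n - 1) fs"
      have fs: "fs = xs @ ys" by (simp add: xs_def ys_def)
      have xy: "length xs = n - 1" "length ys = n" "set xs \<subseteq> ?V" "set ys \<subseteq> ?V"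
        using True n_pos unfolding xs_def ys_def functional_tuples_def
        by (auto dest: in_set_takeD in_set_dropD)
      then have "P xs ys x" using * by simp
      then show ?thesis unfolding fs using P_iff[OF xy] by simp
    qed (rule out)
  qed (simp add: P_iff[symmetric])
  also have "\<dots> \<longleftrightarrow> n_lie_algebra fscale n ?V ?b"
    using dual.vector_space_axioms dual.subspace_V dual.multilinear dual.alternating
    unfolding n_lie_algebra_def P_def by (simp add: fun_eq_iff sum_fun_apply fscale_def dual_map_def)
  finally show ?thesis .
qed

section \<open>The compatibility condition\<close>

definition cocycle :: bool where
  "cocycle \<longleftrightarrow> (\<forall>xs. length xs = n \<longrightarrow>
        \<Delta> (\<mu> xs) =
        (\<Sum>s<n. \<Sum>k<n. fscale ((-1) ^ (n - Suc k)) (rho scale n \<mu> s (omit k xs) (\<Delta> (xs ! k)))))"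

text \<open>
  The part of the compatibility condition that involves \<open>\<Delta>(xs\<^sub>k)\<close>, paired with \<open>fs\<close>: the form
  \<open>\<Delta>(xs\<^sub>k)\<close> with the endomorphism \<open>f \<mapsto> f \<circ> \<mu>(\<dots>, -, \<dots>)\<close> of the dual space acting as a derivation.
  The free argument of \<open>\<mu>\<close> stands in position \<open>k\<close>, which absorbs the sign.
\<close>

definition cocycle_term :: "'v list \<Rightarrow> ('v \<Rightarrow> 'f) list \<Rightarrow> nat \<Rightarrow> 'f" where
  "cocycle_term xs fs k = (\<Sum>s<n. \<Delta> (xs ! k) (fs[s := \<lambda>y. (fs ! s) (\<mu> (xs[k := y]))]))"

lemma pullback_endo:
  assumes "length xs = n" "k < n"
  shows "linear_endo_on fscale (dual_space scale) (\<lambda>f y. f (\<mu> (xs[k := y])))"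
  using assms by (auto simp: linear_endo_on_def dual_space_iff[OF vector_space_axioms]
      linear_form_on_def fscale_def bracket_add bracket_scale)

lemma cocycle_iff_terms:
  "cocycle \<longleftrightarrow> (\<forall>xs fs. length xs = n \<and> length fs = n \<and> set fs \<subseteq> dual_space scale \<longrightarrow>
     \<Delta> (\<mu> xs) fs = (\<Sum>k<n. cocycle_term xs fs k))"
proof -
  let ?r = "\<lambda>xs. (\<Sum>s<n. \<Sum>k<n. fscale ((-1) ^ (n - Suc k))
    (rho scale n \<mu> s (omit k xs) (\<Delta> (xs ! k))))"
  have out: "?r xs fs = 0" if "fs \<notin> functional_tuples scale n" for xs fs
    using that by (simp add: sum_fun_apply fscale_def rho_def)
  have inside: "?r xs fs = (\<Sum>k<n. cocycle_term xs fs k)"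
    if xs: "length xs = n" and fs: "fs \<in> functional_tuples scale n" for xs fs
  proof -
    have "(-1) ^ (n - Suc k) * rho scale n \<mu> s (omit k xs) (\<Delta> (xs ! k)) fs =
      \<Delta> (xs ! k) (fs[s := \<lambda>y. (fs ! s) (\<mu> (xs[k := y]))])" if sk: "s < n" "k < n" for s k
    proof -
      let ?c = "(-1) ^ (n - Suc k) :: 'f" and ?g = "\<lambda>y. (fs ! s) (\<mu> (omit k xs @ [y]))"
      have fs': "length fs = n" "set fs \<subseteq> dual_space scale" using fs by (auto simp: functional_tuples_def)
      then have lin: "linear_form_on scale UNIV (fs ! s)"
        using sk by (auto simp flip: dual_space_iff[OF vector_space_axioms])
      have "linear_endo_on scale UNIV (\<lambda>y. \<mu> (omit k xs @ [y]))"
        using xs sk by (intro ad_linear) (auto simp: length_omit)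
      then have g: "?g \<in> dual_space scale"
        using lin by (simp add: dual_space_iff[OF vector_space_axioms] linear_form_on_def linear_endo_on_def)
      have "fscale ?c ?g = (\<lambda>y. (fs ! s) (\<mu> (xs[k := y])))"
      proof
        fix y
        have "\<mu> (xs[k := y]) = scale ?c (\<mu> (omit k xs @ [y]))"
          using xs sk by (intro bracket_omit_last[symmetric]) auto
        then show "fscale ?c ?g y = (fs ! s) (\<mu> (xs[k := y]))"
          using linear_form_scale[OF lin, of "\<mu> (omit k xs @ [y])" ?c] by (simp add: fscale_def)
      qed
      then show ?thesis
        using multilinear_form_scale[OF alternating_form_multilinear[OF cobracket_alternating]
            fs' sk(1) g, of "xs ! k" ?c] fs by (simp add: rho_def)
    qed
    then have "(\<Sum>s<n. \<Sum>k<n. (-1) ^ (n - Suc k) * rho scale n \<mu> s (omit k xs) (\<Delta> (xs ! k)) fs) =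
      (\<Sum>s<n. \<Sum>k<n. \<Delta> (xs ! k) (fs[s := \<lambda>y. (fs ! s) (\<mu> (xs[k := y]))]))"
      by (intro sum.cong refl) auto
    also have "\<dots> = (\<Sum>k<n. cocycle_term xs fs k)" unfolding cocycle_term_def by (rule sum.swap)
    finally show ?thesis by (simp add: sum_fun_apply fscale_apply)
  qed
  show ?thesis
  proof
    assume cocycle
    then show "\<forall>xs fs. length xs = n \<and> length fs = n \<and> set fs \<subseteq> dual_space scale \<longrightarrow>
     \<Delta> (\<mu> xs) fs = (\<Sum>k<n. cocycle_term xs fs k)"
      using inside unfolding cocycle_def functional_tuples_def by simp
  next
    assume *: "\<forall>xs fs. length xs = n \<and> length fs = n \<and> set fs \<subseteq> dual_space scale \<longrightarrow>
     \<Delta> (\<mu> xs) fs = (\<Sum>k<n. cocycle_term xs fs k)"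
    show cocycle unfolding cocycle_def
    proof (intro allI impI ext)
      fix xs :: "'v list" and fs :: "('v \<Rightarrow> 'f) list" assume xs: "length xs = n"
      show "\<Delta> (\<mu> xs) fs = ?r xs fs"
      proof (cases "fs \<in> functional_tuples scale n")
        case True
        then show ?thesis using * xs inside[OF xs True] by (simp add: functional_tuples_def)
      next
        case False
        then show ?thesis using out cobracket_outside by simp
      qed
    qed
  qed
qed

text \<open>
  Both sides of the compatibility condition are alternating in the functionals, and also in the
  vectors; so it has to be checked only for bases with one element omitted.
\<close>

lemma cocycle_term_alternating_functionals:
  assumes "length xs = n"
  shows "alternating_form_on fscale n (dual_space scale) (\<lambda>fs. \<Sum>k<n. cocycle_term xs fs k)"
  unfolding cocycle_term_def using assms
  by (intro alternating_form_sum alternating_form_derivation cobracket_alternating pullback_endo) auto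

lemma cocycle_term_alternating_vectors:
  assumes fs: "length fs = n" "set fs \<subseteq> dual_space scale"
  shows "alternating_form_on scale n UNIV (\<lambda>xs. \<Sum>k<n. cocycle_term xs fs k)"
  unfolding alternating_form_on_def multilinear_form_on_def
proof (intro conjI allI impI)
  note M = alternating_form_multilinear[OF cobracket_alternating]
  have lin: "linear_form_on scale UNIV (fs ! s)" if "s < n" for s
    using fs that by (auto simp flip: dual_space_iff[OF vector_space_axioms])
  have pull: "(\<lambda>y. (fs ! s) (\<mu> (xs[k := y]))) \<in> dual_space scale"
    if "s < n" "length xs = n" "k < n" for s k xs
    using linear_endo_in[OF pullback_endo[OF that(2,3)], of "fs ! s"] fs that
      nth_mem[of s fs] by blast
  {
    fix xs :: "'v list" and i and x y :: 'v and c
    assume *: "length xs = n \<and> set xs \<subseteq> UNIV \<and> i < n \<and> x \<in> UNIV \<and> y \<in> UNIV"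
    have "\<Delta> (xs[i := x + y] ! k) (fs[s := \<lambda>z. (fs ! s) (\<mu> (xs[i := x + y, k := z]))]) =
       \<Delta> (xs[i := x] ! k) (fs[s := \<lambda>z. (fs ! s) (\<mu> (xs[i := x, k := z]))]) +
       \<Delta> (xs[i := y] ! k) (fs[s := \<lambda>z. (fs ! s) (\<mu> (xs[i := y, k := z]))]) \<and>
       \<Delta> (xs[i := scale c x] ! k) (fs[s := \<lambda>z. (fs ! s) (\<mu> (xs[i := scale c x, k := z]))]) =
       c * \<Delta> (xs[i := x] ! k) (fs[s := \<lambda>z. (fs ! s) (\<mu> (xs[i := x, k := z]))])"
      if sk: "s < n" "k < n" for s k
    proof (cases "k = i")
      case True
      then show ?thesis using * by (simp add: cobracket_add cobracket_scale)
    next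
      case False
      let ?h = "\<lambda>u z. (fs ! s) (\<mu> (xs[i := u, k := z]))"
      have h: "?h (x + y) = ?h x + ?h y" "?h (scale c x) = fscale c (?h x)"
        using False * sk by (simp_all add: fun_eq_iff fscale_def list_update_swap[of i k]
            bracket_add bracket_scale linear_form_add[OF lin] linear_form_scale[OF lin])
      have "?h u \<in> dual_space scale" for u
        using pull[of s "xs[i := u]" k] * sk by simp
      then show ?thesis
        using False * sk fs unfolding h
        by (simp add: multilinear_form_add[OF M] multilinear_form_scale[OF M])
    qed
    then show "(\<Sum>k<n. cocycle_term (xs[i := x + y]) fs k) =
         (\<Sum>k<n. cocycle_term (xs[i := x]) fs k) + (\<Sum>k<n. cocycle_term (xs[i := y]) fs k)"
      and "(\<Sum>k<n. cocycle_term (xs[i := scale c x]) fs k) = c * (\<Sum>k<n. cocycle_term (xs[i := x]) fs k)"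
      by (simp_all add: cocycle_term_def sum.distrib sum_distrib_left)
  }
  fix xs \<sigma> assume *: "length xs = n \<and> set xs \<subseteq> (UNIV :: 'v set) \<and> \<sigma> permutes {..<n}"
  let ?c = "of_int (sign \<sigma>) :: 'f"
  have "cocycle_term (permute_list \<sigma> xs) fs k = ?c * cocycle_term xs fs (\<sigma> k)" if k: "k < n" for k
  proof -
    have \<sigma>k: "\<sigma> k < n" using permutes_in_image[of \<sigma> "{..<n}" k] * k by auto
    have "(\<lambda>y. (fs ! s) (\<mu> ((permute_list \<sigma> xs)[k := y]))) =
        fscale ?c (\<lambda>y. (fs ! s) (\<mu> (xs[\<sigma> k := y])))" if "s < n" for s
    proof
      fix y
      have "(fs ! s) (\<mu> (permute_list \<sigma> (xs[\<sigma> k := y]))) = ?c * (fs ! s) (\<mu> (xs[\<sigma> k := y]))"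
        using * by (intro alternating_form_permute[OF form_bracket[OF lin[OF that]]]) auto
      then show "(fs ! s) (\<mu> ((permute_list \<sigma> xs)[k := y])) =
        fscale ?c (\<lambda>y. (fs ! s) (\<mu> (xs[\<sigma> k := y]))) y"
        using * k by (simp add: permute_list_update fscale_def)
    qed
    then show ?thesis
      using * k \<sigma>k pull by (simp add: cocycle_term_def permute_list_nth sum_distrib_left
          multilinear_form_scale[OF M fs])
  qed
  then have "(\<Sum>k<n. cocycle_term (permute_list \<sigma> xs) fs k) = ?c * (\<Sum>k<n. cocycle_term xs fs (\<sigma> k))"
    by (simp add: sum_distrib_left)
  also have "(\<Sum>k<n. cocycle_term xs fs (\<sigma> k)) = (\<Sum>k<n. cocycle_term xs fs k)"
    using * permutes_imp_bij by (intro sum.reindex_bij_betw) blast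
  finally show "(\<Sum>k<n. cocycle_term (permute_list \<sigma> xs) fs k) = ?c * (\<Sum>k<n. cocycle_term xs fs k)" .
qed

end

text \<open>
  The equations that the compatibility condition imposes on the matrix of the dual bracket.  Off the
  diagonal they say skew-symmetry.  On the diagonal, the numbers \<open>t\<^sub>m = (-1)^m k\<^sub>m\<^sub>m\<close> satisfy
  \<open>2 t\<^sub>p = \<Sum>\<^sub>m t\<^sub>m\<close> for each \<open>p\<close>, so they are equal, and their sum \<open>S\<close> satisfies \<open>2 S = (n + 1) S\<close>;
  they vanish because \<open>n + 1 \<noteq> 2\<close>.
\<close>

lemma skew_from_trace_relations:
  fixes k :: "nat \<Rightarrow> nat \<Rightarrow> 'f::field_char_0"
  assumes n: "n \<ge> 2"
  shows "(\<forall>p\<le>n. \<forall>q\<le>n. k q p = - (\<Sum>m\<in>{..n} - {p}. (if q = m then k p m else 0) -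
      (if q = p then (-1) ^ (p + m) * k m m else 0))) \<longleftrightarrow>
    (\<forall>p\<le>n. \<forall>q\<le>n. k p q = - k q p)" (is "?L \<longleftrightarrow> ?R")
proof -
  have off: "(\<Sum>m\<in>{..n} - {p}. (if q = m then k p m else 0) -
      (if q = p then (-1) ^ (p + m) * k m m else 0)) = k p q" if "p \<le> n" "q \<le> n" "p \<noteq> q" for p q
    using that by (simp add: sum.delta')
  have diag: "(\<Sum>m\<in>{..n} - {p}. (if p = m then k p m else 0) -
      (if p = p then (-1) ^ (p + m) * k m m else 0)) = - ((-1) ^ p * (\<Sum>m\<in>{..n} - {p}. (-1) ^ m * k m m))"
    if "p \<le> n" for p
  proof -
    have "(\<Sum>m\<in>{..n} - {p}. (if p = m then k p m else 0) -
      (if p = p then (-1) ^ (p + m) * k m m else 0)) = (\<Sum>m\<in>{..n} - {p}. - ((-1) ^ p * ((-1) ^ m * k m m)))"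
      by (intro sum.cong refl) (auto simp: power_add)
    then show ?thesis by (simp add: sum_distrib_left sum_negf)
  qed
  show ?thesis
  proof
    assume L: ?L
    define t where "t m = (-1) ^ m * k m m" for m
    define S where "S = (\<Sum>m\<le>n. t m)"
    have "2 * t p = S" if p: "p \<le> n" for p
    proof -
      have "k p p = (-1) ^ p * (\<Sum>m\<in>{..n} - {p}. t m)"
        using L p diag[OF p] by (simp add: t_def)
      also have "(\<Sum>m\<in>{..n} - {p}. t m) = S - t p"
        using p by (simp add: S_def sum_diff1)
      finally show ?thesis unfolding t_def[of p]
        by (cases "even p") (simp_all add: t_def)
    qed
    then have t: "t p = S / 2" if "p \<le> n" for p using that by (simp add: eq_divide_eq mult.commute)
    have "(\<Sum>m\<le>n. t m) = (\<Sum>m\<le>n. S / 2)" using t by (intro sum.cong refl) simp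
    then have "S = of_nat (n + 1) * (S / 2)" by (simp add: S_def)
    then have "2 * S = of_nat (n + 1) * S" by (simp only: times_divide_eq_right eq_divide_eq) simp
    then have "(of_nat (n + 1) - 2) * S = 0" by (simp only: left_diff_distrib) simp
    moreover have "of_nat (n + 1) - (2::'f) = of_nat (n - 1)"
      using n by (simp add: of_nat_diff)
    ultimately have "of_nat (n - 1) * S = 0" by metis
    then have "S = 0" using n by simp
    then have zero: "k p p = 0" if "p \<le> n" for p using t[OF that] \<open>S = 0\<close> unfolding t_def by simp
    show ?R
    proof (intro allI impI)
      fix p q assume pq: "p \<le> n" "q \<le> n"
      show "k p q = - k q p"
      proof (cases "p = q")
        case False
        have "k p q = - (\<Sum>m\<in>{..n} - {q}. (if p = m then k q m else 0) -
            (if p = q then (-1) ^ (q + m) * k m m else 0))"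
          using L pq by blast
        then show ?thesis unfolding off[OF pq(2,1) False[symmetric]] .
      qed (use zero pq in simp)
    qed
  next
    assume R: ?R
    have zero: "k p p = 0" if "p \<le> n" for p
    proof -
      have "k p p = - k p p" using R that by blast
      then have "2 * k p p = 0" by simp
      then show ?thesis by simp
    qed
    show ?L
    proof (intro allI impI)
      fix p q assume pq: "p \<le> n" "q \<le> n"
      show "k q p = - (\<Sum>m\<in>{..n} - {p}. (if q = m then k p m else 0) -
        (if q = p then (-1) ^ (p + m) * k m m else 0))"
      proof (cases "p = q")
        case True
        have "(\<Sum>m\<in>{..n} - {p}. (-1) ^ m * k m m) = 0" using zero by (intro sum.neutral) simp
        then show ?thesis using diag[OF pq(1)] zero[OF pq(1)] True by simp
      next
        case False
        have "k q p = - k p q" using R pq by blast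
        then show ?thesis unfolding off[OF pq False] .
      qed
    qed
  qed
qed

lemma sign_diff_eq_0_iff: "(-1) ^ q * (u - v) = 0 \<longleftrightarrow> u = (v :: 'f::field)"
  by simp

locale simple_cobracket = bracket_cobracket scale n e co \<mu> \<Delta>
  for scale :: "'f::field_char_0 \<Rightarrow> 'v::ab_group_add \<Rightarrow> 'v" and n e co \<mu> \<Delta> +
  assumes simple: "i \<le> n \<Longrightarrow> \<mu> (omit i bs) = e i"
    and n_ge_2: "2 \<le> n"
begin

lemma K_simple: "i \<le> n \<Longrightarrow> j \<le> n \<Longrightarrow> K i j = (if i = j then (-1) ^ i else 0)"
  by (simp add: K_def simple co_e)

text \<open>
  The matrix of the simple algebra is diagonal, in particular symmetric.
\<close>

lemma n_lie_algebra_simple: "n_lie_algebra scale n UNIV \<mu>"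
  unfolding n_lie_algebra_iff_filippov_quadric by (simp add: filippov_quadric_def K_simple)

lemma simple_update:
  assumes "p \<le> n" "k < n" "l \<le> n" "q \<le> n" "m = skip p k"
  shows "co q (\<mu> ((omit p bs)[k := e l])) = (if l = m \<and> q = p then 1 else 0) -
    (if l = p \<and> q = m then (-1) ^ (p + m) else 0)"
proof -
  have m: "m \<le> n" "m \<noteq> p" using skip_less[OF assms(1,2)] skip_neq[of p k] assms(5) by auto
  have "co q (\<mu> ((omit p bs)[k := e l])) =
    (if l = m then co q (\<mu> (omit p bs)) else if l = p then - ((-1) ^ (p + m) * co q (\<mu> (omit m bs))) else 0)"
    by (rule alternating_form_omit_update[OF co_bracket[OF assms(4)] refl assms(1,2,3,5)])
  then show ?thesis using m assms by (simp add: simple co_e)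
qed

text \<open>
  As a function of the entry in position \<open>k\<close> of \<open>omit p bs\<close>, the bracket \<open>\<mu>\<close> is an infinitesimal
  rotation (up to signs) in the plane of \<open>e\<^sub>p\<close> and \<open>e\<^sub>m\<close>.  Its trace is zero, and it has two nonzero
  matrix entries; so at most two entries of \<open>dual.K\<close> survive in the trace formula on the dual space.
\<close>

lemma cocycle_term_basis:
  assumes p: "p \<le> n" and q: "q \<le> n" and k: "k < n" and m: "m = skip p k"
  shows "cocycle_term (omit p bs) (omit q dual.bs) k =
    - ((-1) ^ q * ((if q = m then dual.K p m else 0) - (if q = p then (-1) ^ (p + m) * dual.K m m else 0)))"
proof -
  have m': "m \<le> n" "m \<noteq> p" using skip_less[OF p k] skip_neq[of p k] m by auto
  let ?xs = "omit p bs"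
  let ?B = "\<lambda>f y. f (\<mu> (?xs[k := y]))"
  let ?T = "\<lambda>i. (-1) ^ i * \<Delta> (e m) (omit i dual.bs)"
  have T: "?T i = dual.K i m" for i by (simp add: dual.K_def dual_map_def)
  have "cocycle_term ?xs (omit q dual.bs) k =
      (\<Sum>s<n. \<Delta> (e m) ((omit q dual.bs)[s := ?B (omit q dual.bs ! s)]))"
    unfolding cocycle_term_def nth_omit_bs[OF refl p k] m ..
  also have "\<dots> = (-1) ^ q * (\<Sum>l\<le>n. ?B (co l) (e l) * ?T q - ?B (co l) (e q) * ?T l)"
    by (rule dual.alternating_form_trace[OF cobracket_alternating refl q
          pullback_endo[OF length_omit_bs[OF refl p] k]])
  also have "\<dots> = (-1) ^ q * (\<Sum>l\<le>n. (if l = p then if q = m then - dual.K p m else 0 else 0) +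
      (if l = m then if q = p then (-1) ^ (p + m) * dual.K m m else 0 else 0))"
  proof (intro arg_cong2[of _ _ _ _ "(*)"] sum.cong refl)
    fix l assume "l \<in> {..n}"
    then have l: "l \<le> n" by simp
    have "?B (co l) (e l) = 0"
      using simple_update[OF p k l l m] m' by auto
    moreover have "?B (co l) (e q) =
        (if q = m \<and> l = p then 1 else 0) - (if q = p \<and> l = m then (-1) ^ (p + m) else 0)"
      by (rule simple_update[OF p k q l m])
    ultimately show "?B (co l) (e l) * ?T q - ?B (co l) (e q) * ?T l =
        (if l = p then if q = m then - dual.K p m else 0 else 0) +
        (if l = m then if q = p then (-1) ^ (p + m) * dual.K m m else 0 else 0)"
      unfolding T using m' by auto
  qed
  also have "\<dots> = - ((-1) ^ q * ((if q = m then dual.K p m else 0) -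
      (if q = p then (-1) ^ (p + m) * dual.K m m else 0)))"
    using p m' by (simp add: sum.distrib algebra_simps)
  finally show ?thesis .
qed

text \<open>
  Invariantly, \<open>\<Lambda>\<^sup>n L\<close> is isomorphic to \<open>L\<close> as a module over the inner derivations of the simple
  algebra, so \<open>\<Delta>\<close> amounts to an endomorphism of \<open>L\<close>, and compatibility says that it is a derivation,
  that is, skew-symmetric with respect to the invariant bilinear form.
\<close>

proposition cocycle_iff_skew: "cocycle \<longleftrightarrow> (\<forall>p\<le>n. \<forall>q\<le>n. dual.K p q = - dual.K q p)"
proof -
  let ?E = "\<lambda>xs fs. \<Delta> (\<mu> xs) fs - (\<Sum>k<n. cocycle_term xs fs k)"
  have lhs: "\<Delta> (\<mu> (omit p bs)) (omit q dual.bs) = (-1) ^ q * dual.K q p" if "p \<le> n" for p q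
    using that by (simp add: simple dual.K_def dual_map_def flip: mult.assoc power_mult_distrib)
  let ?f = "\<lambda>p q m. (if q = m then dual.K p m else 0) - (if q = p then (-1) ^ (p + m) * dual.K m m else 0)"
  have rhs: "(\<Sum>k<n. cocycle_term (omit p bs) (omit q dual.bs) k) =
      (-1) ^ q * - (\<Sum>m\<in>{..n} - {p}. ?f p q m)" if p: "p \<le> n" and q: "q \<le> n" for p q
  proof -
    have "(\<Sum>k<n. cocycle_term (omit p bs) (omit q dual.bs) k) = (\<Sum>k<n. - ((-1) ^ q * ?f p q (skip p k)))"
      using cocycle_term_basis[OF p q _ refl] by (intro sum.cong refl) auto
    also have "\<dots> = (\<Sum>m\<in>{..<Suc n} - {p}. - ((-1) ^ q * ?f p q m))"
      by (rule sum.reindex_bij_betw[OF bij_betw_skip[OF p]])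
    finally show ?thesis by (simp only: sum_negf sum_distrib_left lessThan_Suc_atMost mult_minus_right)
  qed
  have basis: "?E (omit p bs) (omit q dual.bs) = 0 \<longleftrightarrow>
      dual.K q p = - (\<Sum>m\<in>{..n} - {p}. ?f p q m)" if "p \<le> n" "q \<le> n" for p q
  proof -
    have *: "?E (omit p bs) (omit q dual.bs) =
        (-1) ^ q * (dual.K q p - - (\<Sum>m\<in>{..n} - {p}. ?f p q m))"
      unfolding lhs[OF that(1)] rhs[OF that] by (simp only: right_diff_distrib)
    show ?thesis unfolding * by (rule sign_diff_eq_0_iff)
  qed
  have alt_xs: "alternating_form_on scale n UNIV (\<lambda>xs. ?E xs fs)"
    if fs: "length fs = n" "set fs \<subseteq> dual_space scale" for fs
  proof (rule alternating_form_diff)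
    have "linear_form_on scale UNIV (\<lambda>x. \<Delta> x fs)"
      by (simp add: linear_form_on_def cobracket_add cobracket_scale)
    then show "alternating_form_on scale n UNIV (\<lambda>xs. \<Delta> (\<mu> xs) fs)" by (rule form_bracket)
  qed (rule cocycle_term_alternating_vectors[OF fs])
  have alt_fs: "alternating_form_on fscale n (dual_space scale) (?E xs)" if "length xs = n" for xs
    by (rule alternating_form_diff[OF cobracket_alternating cocycle_term_alternating_functionals[OF that]])
  have "cocycle \<longleftrightarrow> (\<forall>xs fs. length xs = n \<and> length fs = n \<and> set fs \<subseteq> dual_space scale \<longrightarrow> ?E xs fs = 0)"
    unfolding cocycle_iff_terms by simp
  also have "\<dots> \<longleftrightarrow> (\<forall>p\<le>n. \<forall>q\<le>n. ?E (omit p bs) (omit q dual.bs) = 0)"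
  proof (intro iffI allI impI)
    fix p q assume "\<forall>xs fs. length xs = n \<and> length fs = n \<and> set fs \<subseteq> dual_space scale \<longrightarrow> ?E xs fs = 0"
      and "p \<le> n" "q \<le> n"
    then show "?E (omit p bs) (omit q dual.bs) = 0"
      using length_omit_bs[OF refl] dual.length_omit_bs[OF refl] dual.set_omit_bs by blast
  next
    fix xs :: "'v list" and fs :: "('v \<Rightarrow> 'f) list"
    assume zero: "\<forall>p\<le>n. \<forall>q\<le>n. ?E (omit p bs) (omit q dual.bs) = 0"
      and *: "length xs = n \<and> length fs = n \<and> set fs \<subseteq> dual_space scale"
    then have fs: "length fs = n" "set fs \<subseteq> dual_space scale" and xs: "length xs = n" by auto
    have "?E (omit p bs) fs = 0" if p: "p \<le> n" for p
      using zero p by (intro dual.alternating_form_omit_zeroI[OF alt_fs[OF length_omit_bs[OF refl p]] refl _ fs]) simp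
    then show "?E xs fs = 0"
      by (intro alternating_form_omit_zeroI[OF alt_xs[OF fs] refl _ xs]) simp_all
  qed
  also have "\<dots> \<longleftrightarrow> (\<forall>p\<le>n. \<forall>q\<le>n. dual.K q p = - (\<Sum>m\<in>{..n} - {p}. ?f p q m))"
    using basis by blast
  also have "\<dots> \<longleftrightarrow> (\<forall>p\<le>n. \<forall>q\<le>n. dual.K p q = - dual.K q p)"
    by (rule skew_from_trace_relations[OF n_ge_2])
  finally show ?thesis .
qed

corollary n_lie_bialgebra_iff_skew:
  "n_lie_bialgebra scale n \<mu> \<Delta> \<longleftrightarrow>
    n_lie_algebra fscale n (dual_space scale) (dual_map \<Delta>) \<and>
    skew_bracket fscale n (dual_space scale) (dual_map \<Delta>)"
  unfolding n_lie_bialgebra_def n_lie_coalgebra_iff dual.skew_bracket_iff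
  using n_lie_algebra_simple cocycle_iff_skew unfolding cocycle_def by blast

end

section \<open>Change of basis and transport of structure\<close>

context coordinates
begin

text \<open>
  The dimension is the cardinality of a basis, so it is \<open>0\<close> for infinite bases as well; the
  coordinates bound the size of independent sets and exclude this.
\<close>

lemma subset_zero_if_dim_0:
  assumes S: "S \<subseteq> V" and dim: "dim S = 0"
  shows "S \<subseteq> {0}"
proof -
  obtain B where B: "B \<subseteq> S" "independent B" "S \<subseteq> span B" "card B = dim S"
    by (rule basis_exists)
  have "V \<subseteq> span (e ` {..<d})"
  proof
    fix x assume "x \<in> V"
    then have "x = (\<Sum>j<d. scale (co j x) (e j))" by (rule expand)
    also have "\<dots> \<in> span (e ` {..<d})" by (intro span_sum span_scale span_base) auto
    finally show "x \<in> span (e ` {..<d})" .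
  qed
  then have "finite B"
    using B S independent_span_bound[of "e ` {..<d}" B] by auto
  then have "B = {}" using B(4) dim by simp
  then show ?thesis using B(3) by simp
qed

text \<open>
  The exchange step of Steinitz, with the new coordinate functionals made explicit.
\<close>

lemma coordinates_replace:
  assumes p: "p < d" and x: "x \<in> V" and nz: "co p x \<noteq> 0"
  shows "coordinates scale V d (e(p := x))
    (\<lambda>j y. if j = p then co p y / co p x else co j y - co j x * (co p y / co p x))"
proof (intro coordinates.intro coordinates_axioms.intro vector_space_axioms subspace_V)
  let ?e = "e(p := x)"
  let ?co = "\<lambda>j y. if j = p then co p y / co p x else co j y - co j x * (co p y / co p x)"
  show e: "?e i \<in> V" if "i < d" for i using that x e_in by simp
  show "linear_form_on scale V (?co j)" if "j < d" for j
    using co_linear[OF that] co_linear[OF p] nz unfolding linear_form_on_def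
    by (auto simp: field_simps)
  show "?co j (?e i) = (if j = i then 1 else 0)" if "i < d" "j < d" for i j
    using that p nz by (auto simp: co_e)
  show "y = (\<Sum>j<d. scale (?co j y) (?e j))" if y: "y \<in> V" for y
  proof (rule coordinates_eqI[OF y])
    show "(\<Sum>j<d. scale (?co j y) (?e j)) \<in> V"
      using e by (intro subspace_sum[OF subspace_V] subspace_scale[OF subspace_V]) auto
    fix i assume i: "i < d"
    have "co i (\<Sum>j<d. scale (?co j y) (?e j)) = (\<Sum>j<d. ?co j y * co i (?e j))"
      using e by (intro linear_form_sum co_linear i) auto
    also have "\<dots> = ?co p y * co i x + (\<Sum>j\<in>{..<d} - {p}. ?co j y * co i (?e j))"
      using p by (subst sum.remove[of _ p]) auto
    also have "(\<Sum>j\<in>{..<d} - {p}. ?co j y * co i (?e j)) =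
        (\<Sum>j\<in>{..<d} - {p}. if j = i then co j y - co j x * (co p y / co p x) else 0)"
      using i by (intro sum.cong refl) (auto simp: co_e)
    also have "\<dots> = (if i = p then 0 else co i y - co i x * (co p y / co p x))"
      using i by simp
    finally show "co i y = co i (\<Sum>j<d. scale (?co j y) (?e j))"
      using nz by (auto split: if_splits)
  qed
qed

lemma coordinates_reindex:
  assumes \<pi>: "\<pi> permutes {..<d}"
  shows "coordinates scale V d (\<lambda>i. e (\<pi> i)) (\<lambda>i. co (\<pi> i))"
proof (intro coordinates.intro coordinates_axioms.intro vector_space_axioms subspace_V)
  have lt: "\<pi> i < d" if "i < d" for i using permutes_in_image[OF \<pi>, of i] that by auto
  show "e (\<pi> i) \<in> V" if "i < d" for i using e_in lt that by blast
  show "linear_form_on scale V (co (\<pi> j))" if "j < d" for j using co_linear lt that by blast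
  show "co (\<pi> j) (e (\<pi> i)) = (if j = i then 1 else 0)" if "i < d" "j < d" for i j
    using that lt permutes_inj[OF \<pi>] by (auto simp: co_e dest: injD)
  show "x = (\<Sum>j<d. scale (co (\<pi> j) x) (e (\<pi> j)))" if "x \<in> V" for x
    using expand[OF that] sum.reindex_bij_betw[OF permutes_imp_bij[OF \<pi>], of "\<lambda>j. scale (co j x) (e j)"]
    by simp
qed

end

lemma linear_map_sum:
  assumes W: "module.subspace scale V" "vector_space scale" and finite: "finite J"
    and add: "\<And>x y. x \<in> V \<Longrightarrow> y \<in> V \<Longrightarrow> \<phi> (x + y) = \<phi> x + \<phi> y"
    and scale: "\<And>c x. x \<in> V \<Longrightarrow> \<phi> (scale c x) = scale' c (\<phi> x)"
    and f: "\<And>j. j \<in> J \<Longrightarrow> f j \<in> V"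
  shows "\<phi> (\<Sum>j\<in>J. scale (c j) (f j)) = (\<Sum>j\<in>J. scale' (c j) (\<phi> (f j :: 'v::ab_group_add)) :: 'w::ab_group_add)"
proof -
  interpret vector_space scale by fact
  have zero: "\<phi> 0 = 0" using add[of 0 0] subspace_0[OF W(1)] by simp
  show ?thesis using finite f
  proof (induction J)
    case (insert j J)
    then show ?case
      by (simp add: add scale subspace_scale[OF W(1)] subspace_sum[OF W(1)])
  qed (simp add: zero)
qed

lemma n_lie_algebra_transport:
  assumes L: "n_lie_algebra scale n V \<beta>" and W: "vector_space scale'" "module.subspace scale' W"
    and \<phi>_in: "\<And>x. x \<in> V \<Longrightarrow> \<phi> x \<in> W"
    and \<phi>_add: "\<And>x y. x \<in> V \<Longrightarrow> y \<in> V \<Longrightarrow> \<phi> (x + y) = \<phi> x + \<phi> y"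
    and \<phi>_scale: "\<And>c x. x \<in> V \<Longrightarrow> \<phi> (scale c x) = scale' c (\<phi> x)"
    and \<psi>_in: "\<And>x. x \<in> W \<Longrightarrow> \<psi> x \<in> V"
    and \<psi>_add: "\<And>x y. x \<in> W \<Longrightarrow> y \<in> W \<Longrightarrow> \<psi> (x + y) = \<psi> x + \<psi> y"
    and \<psi>_scale: "\<And>c x. x \<in> W \<Longrightarrow> \<psi> (scale' c x) = scale c (\<psi> x)"
    and \<psi>_\<phi>: "\<And>x. x \<in> V \<Longrightarrow> \<psi> (\<phi> x) = x"
    and n: "0 < n"
  shows "n_lie_algebra scale' n W (\<lambda>xs. \<phi> (\<beta> (map \<psi> xs)))"
proof -
  have vs: "vector_space scale" "module.subspace scale V" and M: "multilinear_on scale n V \<beta>"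
    and A: "alternating_on scale n V \<beta>"
    and J: "\<And>xs ys. length xs = n - 1 \<Longrightarrow> set xs \<subseteq> V \<Longrightarrow> length ys = n \<Longrightarrow> set ys \<subseteq> V \<Longrightarrow>
        \<beta> (xs @ [\<beta> ys]) =
        (\<Sum>s<n. scale ((-1) ^ (n - Suc s)) (\<beta> (omit s ys @ [\<beta> (xs @ [ys ! s])])))"
    using L unfolding n_lie_algebra_def by auto
  have map_in: "set (map \<psi> xs) \<subseteq> V" if "set xs \<subseteq> W" for xs using that \<psi>_in by auto
  have \<beta>_in: "\<beta> xs \<in> V" if "length xs = n" "set xs \<subseteq> V" for xs
    using M that unfolding multilinear_on_def by blast
  show ?thesis unfolding n_lie_algebra_def
  proof (intro conjI W)
    show "multilinear_on scale' n W (\<lambda>xs. \<phi> (\<beta> (map \<psi> xs)))"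
      unfolding multilinear_on_def
    proof (intro allI impI conjI ballI)
      fix xs assume xs: "length xs = n \<and> set xs \<subseteq> W"
      then have m: "length (map \<psi> xs) = n" "set (map \<psi> xs) \<subseteq> V" using map_in by auto
      then show "\<phi> (\<beta> (map \<psi> xs)) \<in> W" by (intro \<phi>_in \<beta>_in)
      fix i x y c assume i: "i < n" and x: "x \<in> W" and y: "y \<in> W"
      have up: "\<beta> ((map \<psi> xs)[i := \<psi> z]) \<in> V" if "z \<in> W" for z
        using m that by (intro \<beta>_in set_list_update_subset \<psi>_in) auto
      have "\<beta> ((map \<psi> xs)[i := \<psi> x + \<psi> y]) = \<beta> ((map \<psi> xs)[i := \<psi> x]) + \<beta> ((map \<psi> xs)[i := \<psi> y])"
        and "\<beta> ((map \<psi> xs)[i := scale c (\<psi> x)]) = scale c (\<beta> ((map \<psi> xs)[i := \<psi> x]))"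
        using M m i \<psi>_in[OF x] \<psi>_in[OF y] unfolding multilinear_on_def by blast+
      then show "\<phi> (\<beta> (map \<psi> (xs[i := x + y]))) = \<phi> (\<beta> (map \<psi> (xs[i := x]))) + \<phi> (\<beta> (map \<psi> (xs[i := y])))"
        and "\<phi> (\<beta> (map \<psi> (xs[i := scale' c x]))) = scale' c (\<phi> (\<beta> (map \<psi> (xs[i := x]))))"
        by (simp_all add: map_update \<psi>_add \<psi>_scale x y \<phi>_add \<phi>_scale up)
    qed
    show "alternating_on scale' n W (\<lambda>xs. \<phi> (\<beta> (map \<psi> xs)))"
      unfolding alternating_on_def
    proof (intro allI impI)
      fix xs \<sigma> assume xs: "length xs = n \<and> set xs \<subseteq> W \<and> \<sigma> permutes {..<n}"
      then have m: "length (map \<psi> xs) = n" "set (map \<psi> xs) \<subseteq> V" using map_in by auto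
      then have "\<beta> (map \<psi> xs) = scale (of_int (sign \<sigma>)) (\<beta> (permute_list \<sigma> (map \<psi> xs)))"
        using A xs unfolding alternating_on_def by blast
      moreover have "\<beta> (permute_list \<sigma> (map \<psi> xs)) \<in> V"
        using m xs by (intro \<beta>_in) (auto simp: set_permute_list)
      ultimately show "\<phi> (\<beta> (map \<psi> xs)) = scale' (of_int (sign \<sigma>)) (\<phi> (\<beta> (map \<psi> (permute_list \<sigma> xs))))"
        using xs by (simp add: \<phi>_scale flip: permute_list_map)
    qed
    show "\<forall>xs ys. length xs = n - 1 \<and> set xs \<subseteq> W \<and> length ys = n \<and> set ys \<subseteq> W \<longrightarrow>
        \<phi> (\<beta> (map \<psi> (xs @ [\<phi> (\<beta> (map \<psi> ys))]))) =
        (\<Sum>s<n. scale' ((-1) ^ (n - Suc s))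
          (\<phi> (\<beta> (map \<psi> (omit s ys @ [\<phi> (\<beta> (map \<psi> (xs @ [ys ! s])))])))))"
    proof (intro allI impI)
      fix xs ys assume *: "length xs = n - 1 \<and> set xs \<subseteq> W \<and> length ys = n \<and> set ys \<subseteq> W"
      let ?xs = "map \<psi> xs" and ?ys = "map \<psi> ys"
      have m: "length ?xs = n - 1" "set ?xs \<subseteq> V" "length ?ys = n" "set ?ys \<subseteq> V"
        using * map_in by auto
      have b1: "\<beta> (?xs @ [?ys ! s]) \<in> V" if "s < n" for s
      proof -
        have "?ys ! s \<in> V" using m(3,4) that by (metis nth_mem subsetD)
        then show ?thesis using m n by (intro \<beta>_in) auto
      qed
      have b2: "\<beta> (omit s ?ys @ [\<beta> (?xs @ [?ys ! s])]) \<in> V" if "s < n" for s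
        using m n that b1[OF that] set_omit_subset[of s ?ys]
        by (intro \<beta>_in) (auto simp: length_omit)
      have "\<phi> (\<beta> (map \<psi> (xs @ [\<phi> (\<beta> ?ys)]))) = \<phi> (\<beta> (?xs @ [\<beta> ?ys]))"
        using \<beta>_in[OF m(3,4)] by (simp add: \<psi>_\<phi>)
      also have "\<dots> = \<phi> (\<Sum>s<n. scale ((-1) ^ (n - Suc s)) (\<beta> (omit s ?ys @ [\<beta> (?xs @ [?ys ! s])])))"
        unfolding J[OF m] ..
      also have "\<dots> = (\<Sum>s<n. scale' ((-1) ^ (n - Suc s)) (\<phi> (\<beta> (omit s ?ys @ [\<beta> (?xs @ [?ys ! s])]))))"
        using b2 by (intro linear_map_sum[OF vs(2,1)] \<phi>_add \<phi>_scale) auto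
      also have "\<dots> = (\<Sum>s<n. scale' ((-1) ^ (n - Suc s))
          (\<phi> (\<beta> (map \<psi> (omit s ys @ [\<phi> (\<beta> (map \<psi> (xs @ [ys ! s])))])))))"
      proof (intro sum.cong refl)
        fix s assume "s \<in> {..<n}"
        then have s: "s < n" by simp
        have "map \<psi> (omit s ys @ [\<phi> (\<beta> (map \<psi> (xs @ [ys ! s])))]) = omit s ?ys @ [\<beta> (?xs @ [?ys ! s])]"
          using b1[OF s] s * by (simp add: map_omit \<psi>_\<phi>)
        then show "scale' ((-1) ^ (n - Suc s)) (\<phi> (\<beta> (omit s ?ys @ [\<beta> (?xs @ [?ys ! s])]))) =
          scale' ((-1) ^ (n - Suc s))
          (\<phi> (\<beta> (map \<psi> (omit s ys @ [\<phi> (\<beta> (map \<psi> (xs @ [ys ! s])))]))))" by simp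
      qed
      finally show "\<phi> (\<beta> (map \<psi> (xs @ [\<phi> (\<beta> ?ys)]))) = \<dots>" .
    qed
  qed
qed

lemma subspace_coord_space: "module.subspace fscale (coord_space m)"
  unfolding module.subspace_def[OF module_fscale] by (auto simp: coord_space_def fscale_def)

lemma nth_unit_vectors: "i < m \<Longrightarrow> unit_vectors m ! i = (\<lambda>j. if j = i then 1 else 0)"
  by (simp add: unit_vectors_def)

context bracket_coordinates
begin

section \<open>Type \<open>(c\<^sub>3)\<close>\<close>

definition c3_basis :: bool where
  "c3_basis \<longleftrightarrow> \<beta> (omit 1 bs) = e 0 \<and> \<beta> (omit 0 bs) = e 1 \<and> (\<forall>i. 2 \<le> i \<and> i \<le> n \<longrightarrow> \<beta> (omit i bs) = 0)"

text \<open>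
  The model bracket on the coordinate space arises by carrying \<open>\<beta>\<close> over along the coordinates.
\<close>

lemma type_c3_if_c3_basis:
  assumes L: "n_lie_algebra scale n V \<beta>" and c3: c3_basis
  shows "type_c3 scale n V \<beta>"
proof -
  define \<phi> where "\<phi> x = (\<lambda>i. if i \<le> n then co i x else 0)" for x
  define \<psi> where "\<psi> g = (\<Sum>j<Suc n. scale (g j) (e j))" for g
  let ?W = "coord_space (n + 1) :: (nat \<Rightarrow> 'f) set"
  have \<phi>_in: "\<phi> x \<in> ?W" for x by (simp add: \<phi>_def coord_space_def)
  have \<psi>_in: "\<psi> g \<in> V" for g unfolding \<psi>_def by (rule linear_combination_in)
  have \<phi>_add: "\<phi> (x + y) = \<phi> x + \<phi> y" if "x \<in> V" "y \<in> V" for x y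
    using that by (auto simp: \<phi>_def fun_eq_iff linear_form_add[OF co_linear])
  have \<phi>_scale: "\<phi> (scale c x) = fscale c (\<phi> x)" if "x \<in> V" for c x
    using that by (auto simp: \<phi>_def fun_eq_iff fscale_apply linear_form_scale[OF co_linear])
  have \<psi>_add: "\<psi> (g + h) = \<psi> g + \<psi> h" for g h
    by (simp add: \<psi>_def scale_left_distrib sum.distrib)
  have \<psi>_scale: "\<psi> (fscale c g) = scale c (\<psi> g)" for c g
    by (simp add: \<psi>_def scale_sum_right scale_right_distrib fscale_apply)
  have \<psi>_\<phi>: "\<psi> (\<phi> x) = x" if "x \<in> V" for x
  proof -
    have "\<psi> (\<phi> x) = (\<Sum>j<Suc n. scale (co j x) (e j))"
      unfolding \<psi>_def \<phi>_def by (intro sum.cong refl) simp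
    then show ?thesis using expand[OF that] by simp
  qed
  have \<phi>_\<psi>: "\<phi> (\<psi> g) = g" if "g \<in> ?W" for g
  proof
    fix i show "\<phi> (\<psi> g) i = g i"
      using that co_sum[of i g] by (simp add: \<phi>_def \<psi>_def coord_space_def)
  qed
  define \<nu> where "\<nu> = (\<lambda>xs. \<phi> (\<beta> (map \<psi> xs)))"
  have L': "n_lie_algebra fscale n ?W \<nu>"
    unfolding \<nu>_def
    by (rule n_lie_algebra_transport[OF L vector_space_fscale subspace_coord_space])
      (simp_all only: \<phi>_in \<phi>_add \<phi>_scale \<psi>_in \<psi>_add \<psi>_scale \<psi>_\<phi> n_pos)
  have bij: "bij_betw \<phi> V ?W"
    by (rule bij_betw_byWitness[where f' = \<psi>]) (use \<phi>_in \<psi>_in \<psi>_\<phi> \<phi>_\<psi> in auto)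
  have iso: "n_lie_iso scale fscale n V \<beta> ?W \<nu> \<phi>"
    unfolding n_lie_iso_def
  proof (intro conjI bij allI ballI impI)
    fix xs assume "length xs = n \<and> set xs \<subseteq> V"
    then have "map \<psi> (map \<phi> xs) = xs" by (auto simp: \<psi>_\<phi> intro!: map_idI)
    then show "\<phi> (\<beta> xs) = \<nu> (map \<phi> xs)" by (simp add: \<nu>_def)
  qed (use \<phi>_add \<phi>_scale in auto)
  have unit: "\<phi> (e i) = unit_vectors (n + 1) ! i" if "i \<le> n" for i
    using that by (auto simp: fun_eq_iff \<phi>_def nth_unit_vectors co_e)
  have units: "unit_vectors (n + 1) = map \<phi> bs"
  proof (rule nth_equalityI)
    show "length (unit_vectors (n + 1)) = length (map \<phi> bs)" by (simp add: unit_vectors_def)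
    fix i assume "i < length (unit_vectors (n + 1) :: (nat \<Rightarrow> 'f) list)"
    then have "i \<le> n" by (simp add: unit_vectors_def)
    then show "unit_vectors (n + 1) ! i = map \<phi> bs ! i"
      using unit[of i] by (simp del: upt_Suc)
  qed
  have \<nu>_omit: "\<nu> (omit i (unit_vectors (n + 1))) = \<phi> (\<beta> (omit i bs))" if "i \<le> n" for i
  proof -
    have "map \<psi> (map \<phi> (omit i bs)) = omit i bs"
      using set_omit_bs[of i] \<psi>_\<phi> by (auto intro!: map_idI)
    then show ?thesis
      unfolding \<nu>_def units map_omit[of \<phi> i bs, symmetric] by (rule arg_cong)
  qed
  have "0 \<le> n" "1 \<le> n" using n_pos by simp_all
  note unit01 = this[THEN unit] and omit01 = this[THEN \<nu>_omit]
  have "\<phi> 0 = 0" by (simp add: \<phi>_def fun_eq_iff linear_form_zero[OF co_linear])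
  then have "\<nu> (omit i (unit_vectors (n + 1))) = 0" if "2 \<le> i \<and> i \<le> n" for i
    using \<nu>_omit[of i] c3 that unfolding c3_basis_def by metis
  moreover have "\<nu> (omit 1 (unit_vectors (n + 1))) = unit_vectors (n + 1) ! 0"
    "\<nu> (omit 0 (unit_vectors (n + 1))) = unit_vectors (n + 1) ! 1"
    using c3 unfolding c3_basis_def omit01 unit01[symmetric] by simp_all
  ultimately have "c3_bracket n \<nu>" unfolding c3_bracket_def Let_def using L' by blast
  then show ?thesis unfolding type_c3_def using L iso by blast
qed

lemma rank_c3_basis:
  assumes c3: c3_basis
  shows "dim (derived_algebra scale n V \<beta>) = 2"
proof -
  let ?S = "{\<beta> xs |xs. length xs = n \<and> set xs \<subseteq> V}"
  have "co j (\<beta> xs) = 0" if j: "2 \<le> j" "j \<le> n" and xs: "length xs = n" "set xs \<subseteq> V" for j xs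
  proof (rule alternating_form_omit_zeroI[OF co_bracket[OF j(2)] refl _ xs])
    fix i assume i: "i \<le> n"
    consider "i = 0" | "i = 1" | "2 \<le> i" by linarith
    then show "co j (\<beta> (omit i bs)) = 0"
      using c3 i j n_pos unfolding c3_basis_def
      by cases (auto simp: co_e linear_form_zero[OF co_linear])
  qed
  then have "\<beta> xs = scale (co 0 (\<beta> xs)) (e 0) + scale (co 1 (\<beta> xs)) (e 1)"
    if "length xs = n" "set xs \<subseteq> V" for xs
    using that n_pos bracket_in[OF that] e_in_V[of 0] e_in_V[of 1]
    by (intro coordinates_eqI') (auto simp: subspace_add[OF subspace_V] subspace_scale[OF subspace_V]
        linear_form_add[OF co_linear] linear_form_scale[OF co_linear] co_e)
  then have "?S \<subseteq> span {e 0, e 1}"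
    by (auto intro!: span_add span_scale intro: span_base)
       (metis insertI1 insertI2 span_add span_base span_scale singletonI)
  moreover have "{e 0, e 1} \<subseteq> ?S"
  proof -
    have "\<beta> (omit i bs) \<in> ?S" if "i \<le> n" for i
      using length_omit_bs[OF refl that] set_omit_bs by blast
    from this[of 0] this[of 1] show ?thesis using c3 n_pos unfolding c3_basis_def by simp
  qed
  ultimately have "derived_algebra scale n V \<beta> = span {e 0, e 1}"
    unfolding derived_algebra_def by (metis (no_types, lifting) span_minimal span_mono span_span subset_antisym subspace_span)
  moreover have "e 1 \<noteq> 0" "e 0 \<notin> span {e 1}"
  proof -
    show "e 1 \<noteq> 0" using co_e[of 1 1] n_pos linear_form_zero[OF co_linear[of 1]] by auto
    show "e 0 \<notin> span {e 1}"
    proof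
      assume "e 0 \<in> span {e 1}"
      then obtain k where "e 0 = scale k (e 1)" by (auto simp: span_singleton)
      then have "co 0 (e 0) = k * co 0 (e 1)"
        using linear_form_scale[OF co_linear[of 0] e_in_V[of 1]] n_pos by simp
      then show False using n_pos by (simp add: co_e)
    qed
  qed
  then have "independent {e 0, e 1}" and ne: "e 0 \<noteq> e 1"
    using independent_insertI[of "e 0" "{e 1}"] dependent_single[of "e 1"] span_base[of "e 0" "{e 1}"]
    by auto
  ultimately have "dim (derived_algebra scale n V \<beta>) = card {e 0, e 1}"
    using dim_span_eq_card_independent by simp
  also have "card {e 0, e 1} = 2" using ne by (rule card_2_iff[THEN iffD2, OF exI, OF exI, OF conjI, OF refl])
  finally show ?thesis .
qed

text \<open>
  Suppose that \<open>e\<^sub>0\<close> and \<open>e\<^sub>1\<close> are eigenvectors of a derivation with eigenvalue \<open>c\<close>, and the other basis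
  vectors are in its kernel.  A bracket that contains both \<open>e\<^sub>0\<close> and \<open>e\<^sub>1\<close> would by the Leibniz rule
  be an eigenvector with eigenvalue \<open>2 c\<close>, but the only eigenvalues are \<open>c\<close> and \<open>0\<close>.
\<close>

lemma derivation_scalar_on_plane:
  assumes A: "linear_endo_on scale V A" and D: "derivation A" and c: "c \<noteq> 0"
    and A01: "A (e 0) = scale c (e 0)" "A (e 1) = scale c (e 1)"
    and A0: "\<And>k. 2 \<le> k \<Longrightarrow> k \<le> n \<Longrightarrow> A (e k) = 0" and i: "2 \<le> i" "i \<le> n"
  shows "\<beta> (omit i bs) = 0"
proof (rule coordinates_eqI')
  show "\<beta> (omit i bs) \<in> V" by (intro bracket_in length_omit_bs[OF refl i(2)] set_omit_bs)
  show "0 \<in> V" by (rule subspace_0[OF subspace_V])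
  fix j assume j: "j \<le> n"
  have coA: "co l (A (e k)) = (if k < 2 \<and> l = k then c else 0)" if "k \<le> n" "l \<le> n" for k l
  proof -
    consider "k = 0" | "k = 1" | "2 \<le> k" by linarith
    then show ?thesis
      using that A01 A0[of k] n_pos
      by cases (auto simp: linear_form_scale[OF co_linear] e_in_V co_e linear_form_zero[OF co_linear])
  qed
  have "(\<Sum>l\<le>n. K i l * co j (A (e l))) = (\<Sum>l\<le>n. if l = j then if j < 2 then c * K i j else 0 else 0)"
    using j by (intro sum.cong refl) (auto simp: coA)
  then have 1: "(\<Sum>l\<le>n. K i l * co j (A (e l))) = (if j < 2 then c * K i j else 0)"
    using j by simp
  have "(\<Sum>k\<le>n. co k (A (e k)) * K i j - co i (A (e k)) * K k j) =
      (\<Sum>k\<le>n. (if k = 0 then c * K i j else 0) + (if k = 1 then c * K i j else 0))"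
    using i by (intro sum.cong refl) (auto simp: coA)
  also have "\<dots> = 2 * (c * K i j)" using n_pos i by (simp add: sum.distrib)
  finally have 2: "(\<Sum>k\<le>n. co k (A (e k)) * K i j - co i (A (e k)) * K k j) = 2 * (c * K i j)" .
  have "(\<Sum>l\<le>n. K i l * co j (A (e l))) =
      (\<Sum>k\<le>n. co k (A (e k)) * K i j - co i (A (e k)) * K k j)"
    using D i(2) j unfolding derivation_iff[OF A] by blast
  then have "(if j < 2 then c * K i j else 0) = 2 * (c * K i j)" unfolding 1 2 .
  then have "K i j = 0" using c by (cases "j < 2") simp_all
  then show "co j (\<beta> (omit i bs)) = co j 0"
    using j by (simp add: K_def linear_form_zero[OF co_linear])
qed

text \<open>
  Let \<open>K p q\<close> be nonzero.  The rows \<open>p\<close> and \<open>q\<close> of the matrix and the basis vectors other than \<open>e\<^sub>p\<close> and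
  \<open>e\<^sub>q\<close> form a basis.  The adjoint map of these \<open>n - 1\<close> basis vectors sends \<open>e\<^sub>q\<close> to \<open>\<plusminus> row p\<close> and \<open>e\<^sub>p\<close> to
  \<open>\<minusplus> row q\<close>; since \<open>K\<close> is skew-symmetric, it multiplies both rows by the same scalar \<open>\<plusminus> K p q\<close>.
  After rescaling one of the basis vectors, the rows behave like \<open>f\<^sub>1\<close> and \<open>f\<^sub>2\<close> of type \<open>(c\<^sub>3)\<close>, and
  the remaining brackets vanish because the adjoint map is a derivation.
\<close>

proposition c3_if_skew:
  assumes n2: "2 \<le> n" and L: "n_lie_algebra scale n V \<beta>"
    and skew: "\<forall>i\<le>n. \<forall>j\<le>n. K i j = - K j i"
    and pq: "p \<le> n" "q \<le> n" "K p q \<noteq> 0"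
  shows "type_c3 scale n V \<beta> \<and> dim (derived_algebra scale n V \<beta>) = 2"
proof -
  have zero: "K i i = 0" if "i \<le> n" for i
  proof -
    have "K i i = - K i i" using skew that by blast
    then have "2 * K i i = 0" by simp
    then show ?thesis by simp
  qed
  have ne: "p \<noteq> q" using zero pq by auto
  have Kqp: "K q p = - K p q" using skew pq by blast
  \<comment> \<open>The enumeration \<open>\<pi>\<close> of the basis puts \<open>q\<close> and \<open>p\<close> first; row \<open>p\<close> will replace \<open>e\<^sub>q\<close>, because its
    coordinate there is \<open>K p q\<close>, and row \<open>q\<close> will replace \<open>e\<^sub>p\<close>.\<close>
  define \<pi> where "\<pi> = transpose q 0 \<circ> transpose (transpose q 0 p) 1"
  have \<pi>: "\<pi> permutes {..<Suc n}"
    unfolding \<pi>_def using pq n_pos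
    by (intro permutes_compose permutes_swap_id) (auto simp: transpose_def)
  have \<pi>01: "\<pi> 0 = q" "\<pi> 1 = p"
    using ne by (auto simp: \<pi>_def transpose_def)
  have \<pi>_inj: "\<pi> i = \<pi> j \<longleftrightarrow> i = j" for i j
    using permutes_inj[OF \<pi>] by (auto dest: injD)
  have \<pi>_le: "\<pi> i \<le> n" if "i \<le> n" for i
    using permutes_in_image[OF \<pi>, of i] that by auto
  define r where "r = \<pi> 2"
  have r: "r \<le> n" "r \<noteq> p" "r \<noteq> q"
    using \<pi>_le[OF n2] \<pi>_inj[of 2 0] \<pi>_inj[of 2 1] \<pi>01 by (auto simp: r_def)
  define js where "js = map \<pi> [2..<Suc n]"
  have js_dist: "distinct js"
    by (auto simp: js_def distinct_map inj_on_def \<pi>_inj)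
  have js_set: "set js = {..n} - {p, q}"
  proof -
    have "set js = \<pi> ` ({..<Suc n} - {0, 1})" unfolding js_def by auto
    also have "\<dots> = \<pi> ` {..<Suc n} - \<pi> ` {0, 1}"
      using permutes_inj[OF \<pi>] by (rule image_set_diff)
    also have "\<dots> = {..n} - {p, q}" using permutes_image[OF \<pi>] \<pi>01 by auto
    finally show ?thesis .
  qed
  have js_len: "length js = n - 1" by (simp add: js_def)
  obtain s where s: "s * s = 1" and val: "\<And>j l. j \<le> n \<Longrightarrow> l \<le> n \<Longrightarrow>
      co j (\<beta> (map e js @ [e l])) = (if l = q then s * K p j else if l = p then - (s * K q j) else 0)"
    using ad_basis_distinct[OF pq(1,2) ne js_dist js_set] by metis
  let ?Z = "map e js"
  have Z: "length ?Z = n - 1" "set ?Z \<subseteq> V"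
    using js_len map_e_in[of js] js_set by auto
  let ?A = "\<lambda>y. \<beta> (?Z @ [y])"
  have A: "linear_endo_on scale V ?A" by (rule ad_linear[OF Z])
  define row where "row i = scale ((-1) ^ i) (\<beta> (omit i bs))" for i
  have row_in: "row i \<in> V" if "i \<le> n" for i
    unfolding row_def using that
    by (intro subspace_scale[OF subspace_V] bracket_in length_omit_bs set_omit_bs refl)
  have co_row: "co j (row i) = K i j" if "i \<le> n" "j \<le> n" for i j
    unfolding row_def K_def using that
    by (intro linear_form_scale[OF co_linear] bracket_in length_omit_bs set_omit_bs refl) auto
  define c where "c = s * K p q"
  have c: "c \<noteq> 0" using s pq by (auto simp: c_def)
  have coA: "co j (?A y) = s * co q y * K p j - s * co p y * K q j" if j: "j \<le> n" and y: "y \<in> V" for j y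
  proof -
    have "linear_form_on scale V (\<lambda>y. co j (?A y))"
      using A co_linear[of j] j by (auto simp: linear_form_on_def linear_endo_on_def)
    then have "co j (?A y) = (\<Sum>l<Suc n. co l y * co j (?A (e l)))" using y by (rule linear_form_expand)
    also have "\<dots> = (\<Sum>l\<le>n. (if l = q then co q y * (s * K p j) else 0) +
        (if l = p then - (co p y * (s * K q j)) else 0))"
      unfolding lessThan_Suc_atMost using ne j by (intro sum.cong refl) (auto simp: val)
    finally show ?thesis using pq by (simp add: sum.distrib algebra_simps)
  qed
  have A_row: "?A (row p) = scale c (row p)" "?A (row q) = scale c (row q)"
    using pq Kqp zero row_in linear_endo_in[OF A]
    by (auto intro!: coordinates_eqI' simp: subspace_scale[OF subspace_V] coA co_row c_def
        linear_form_scale[OF co_linear])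
  have A_e: "?A (e l) = 0" if "l \<le> n" "l \<noteq> p" "l \<noteq> q" for l
    using that linear_endo_in[OF A] e_in_V subspace_0[OF subspace_V] pq
    by (intro coordinates_eqI') (auto simp: val linear_form_zero[OF co_linear])
  define \<epsilon> where "\<epsilon> = (-1 :: 'f) ^ (n - 1)"
  have \<epsilon>: "\<epsilon> * \<epsilon> = 1" by (simp add: \<epsilon>_def flip: power_mult_distrib)
  then have \<epsilon>0: "\<epsilon> \<noteq> 0" by auto
  \<comment> \<open>The third basis vector is rescaled so that the two rows become fixed vectors of the bracket; the
    sign \<open>\<epsilon>\<close> accounts for moving the free argument from the last position to the first.\<close>
  define u where "u = scale (\<epsilon> / c) (e r)"
  have er: "e r \<in> V" by (rule e_in_V[OF r(1)])
  have u: "u \<in> V" unfolding u_def by (rule subspace_scale[OF subspace_V er])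
  define e1 where "e1 = e(q := row p)"
  define co1 where "co1 = (\<lambda>j y. if j = q then co q y / co q (row p)
    else co j y - co j (row p) * (co q y / co q (row p)))"
  have C1: "coordinates scale V (Suc n) e1 co1"
    unfolding e1_def co1_def using pq by (intro coordinates_replace row_in) (auto simp: co_row)
  have co1_p: "co1 p (row q) = K q p"
    using pq ne zero by (simp add: co1_def co_row)
  define e2 where "e2 = e1(p := row q)"
  define co2 where "co2 = (\<lambda>j y. if j = p then co1 p y / co1 p (row q)
    else co1 j y - co1 j (row q) * (co1 p y / co1 p (row q)))"
  have C2: "coordinates scale V (Suc n) e2 co2"
    unfolding e2_def co2_def using pq Kqp
    by (intro coordinates.coordinates_replace[OF C1] row_in) (auto simp: co1_p)
  have "co2 r u = \<epsilon> / c * co2 r (e2 r)"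
    unfolding u_def using r er
    by (simp add: linear_form_scale[OF coordinates.co_linear[OF C2]] e2_def e1_def)
  also have "co2 r (e2 r) = 1" using r by (simp add: coordinates.co_e[OF C2])
  finally have co2_r: "co2 r u \<noteq> 0" using \<epsilon>0 c by simp
  define e3 where "e3 = e2(r := u)"
  define co3 where "co3 = (\<lambda>j y. if j = r then co2 r y / co2 r u
    else co2 j y - co2 j u * (co2 r y / co2 r u))"
  have C3: "coordinates scale V (Suc n) e3 co3"
    unfolding e3_def co3_def using r co2_r
    by (intro coordinates.coordinates_replace[OF C2] u) auto
  define g where "g i = e3 (\<pi> i)" for i
  have C4: "coordinates scale V (Suc n) g (\<lambda>i. co3 (\<pi> i))"
    unfolding g_def by (rule coordinates.coordinates_reindex[OF C3 \<pi>])
  interpret g: bracket_coordinates scale V n g "\<lambda>i. co3 (\<pi> i)" \<beta>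
    by (intro bracket_coordinates.intro C4 bracket_coordinates_axioms.intro multilinear alternating n_pos)
  have g0: "g 0 = row p" and g1: "g 1 = row q" and g2: "g 2 = u"
    using \<pi>01 r ne by (auto simp: g_def e3_def e2_def e1_def r_def)
  have g_ge: "g k = e (\<pi> k)" if "3 \<le> k" for k
    using that \<pi>_inj[of k 0] \<pi>_inj[of k 1] \<pi>_inj[of k 2] \<pi>01
    by (auto simp: g_def e3_def e2_def e1_def r_def)
  define Y where "Y = map g [2..<Suc n]"
  have up: "[2..<Suc n] = 2 # [3..<Suc n]" using n2 by (subst upt_conv_Cons) auto
  have Y_Z: "Y = ?Z[0 := u]"
    unfolding Y_def js_def up using g2 g_ge by simp
  have Z0: "?Z[0 := e r] = ?Z" unfolding js_def up r_def by simp
  have Y: "length Y = n - 1" "set Y \<subseteq> V"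
    using Z set_list_update_subset[OF Z(2) u] unfolding Y_Z by simp_all
  have ad_Y: "\<beta> (Y @ [y]) = scale (\<epsilon> / c) (?A y)" if "y \<in> V" for y
  proof -
    have "\<beta> ((?Z @ [y])[0 := scale (\<epsilon> / c) (e r)]) = scale (\<epsilon> / c) (\<beta> ((?Z @ [y])[0 := e r]))"
      using Z that n_pos er by (intro bracket_scale) auto
    moreover have "(?Z @ [y])[0 := x] = ?Z[0 := x] @ [y]" for x
      using Z n2 by (auto simp: list_update_append)
    ultimately show ?thesis unfolding Y_Z u_def using Z0 by simp
  qed
  have D: "linear_endo_on scale V (\<lambda>y. \<beta> (Y @ [y]))" by (rule ad_linear[OF Y])
  have D01: "\<beta> (Y @ [g 0]) = scale \<epsilon> (g 0)" "\<beta> (Y @ [g 1]) = scale \<epsilon> (g 1)"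
    unfolding g0 g1 using pq c by (simp_all add: ad_Y row_in A_row)
  have D_ge: "\<beta> (Y @ [g k]) = 0" if k: "2 \<le> k" "k \<le> n" for k
  proof (cases "k = 2")
    case True
    then show ?thesis
      unfolding True g2 ad_Y[OF u] unfolding u_def using r er by (simp add: linear_endo_scale[OF A] A_e)
  next
    case False
    then have "\<pi> k \<le> n" "\<pi> k \<noteq> p" "\<pi> k \<noteq> q"
      using k \<pi>_le \<pi>_inj[of k 0] \<pi>_inj[of k 1] \<pi>01 by auto
    then show ?thesis using False k by (simp add: g_ge ad_Y e_in_V A_e)
  qed
  have "derivation (\<lambda>y. \<beta> (Y @ [y]))"
    using L Y unfolding n_lie_algebra_iff_derivation by simp
  then have "g.derivation (\<lambda>y. \<beta> (Y @ [y]))" unfolding derivation_def g.derivation_def .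
  then have ge: "\<beta> (omit i g.bs) = 0" if "2 \<le> i" "i \<le> n" for i
    using g.derivation_scalar_on_plane[OF D _ \<epsilon>0 D01 D_ge that] by blast
  have first: "\<beta> (y # Y) = scale \<epsilon> (\<beta> (Y @ [y]))" if "y \<in> V" for y
    using bracket_omit_last[of "y # Y" y 0] Y that n_pos by (simp add: omit_def \<epsilon>_def)
  have g_V: "g 0 \<in> V" "g 1 \<in> V" using n_pos by (auto intro: g.e_in_V)
  have "omit 1 g.bs = g 0 # Y" "omit 0 g.bs = g 1 # Y"
  proof -
    have "omit 1 [0..<Suc n] = 0 # [2..<Suc n]" "omit 0 [0..<Suc n] = 1 # [2..<Suc n]"
      using n_pos by (simp_all add: omit_def upt_conv_Cons numeral_2_eq_2)
    then show "omit 1 g.bs = g 0 # Y" "omit 0 g.bs = g 1 # Y"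
      by (simp_all add: Y_def flip: map_omit)
  qed
  then have "g.c3_basis"
    unfolding g.c3_basis_def using ge g_V D01 by (simp add: first \<epsilon>)
  then show ?thesis using g.type_c3_if_c3_basis[OF L] g.rank_c3_basis by blast
qed

end

text \<open>
  The basis \<open>f\<^sub>1, \<dots>, f\<^sub>n\<^sub>+\<^sub>1\<close> of type \<open>(c\<^sub>3)\<close> gives a matrix whose only nonzero entries are \<open>1\<close> and \<open>-1\<close>
  in the positions \<open>(0, 1)\<close> and \<open>(1, 0)\<close>.
\<close>

lemma skew_bracket_if_type_c3:
  fixes scale :: "'f::field_char_0 \<Rightarrow> 'v::ab_group_add \<Rightarrow> 'v"
  assumes c3: "type_c3 scale n V \<beta>" and n: "0 < n"
  shows "skew_bracket scale n V \<beta>"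
proof -
  let ?W = "coord_space (n + 1) :: (nat \<Rightarrow> 'f) set" and ?u = "unit_vectors (n + 1) :: (nat \<Rightarrow> 'f) list"
  obtain \<nu> \<phi> where L: "n_lie_algebra scale n V \<beta>" and \<nu>: "c3_bracket n \<nu>"
    and iso: "n_lie_iso scale fscale n V \<beta> ?W \<nu> \<phi>"
    using c3 unfolding type_c3_def by blast
  have vs: "vector_space scale" and sub: "module.subspace scale V"
    and M: "multilinear_on scale n V \<beta>" and A: "alternating_on scale n V \<beta>"
    using L unfolding n_lie_algebra_def by auto
  have bij: "bij_betw \<phi> V ?W"
    and add: "\<And>x y. x \<in> V \<Longrightarrow> y \<in> V \<Longrightarrow> \<phi> (x + y) = \<phi> x + \<phi> y"
    and scale: "\<And>c x. x \<in> V \<Longrightarrow> \<phi> (scale c x) = fscale c (\<phi> x)"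
    and hom: "\<And>xs. length xs = n \<Longrightarrow> set xs \<subseteq> V \<Longrightarrow> \<phi> (\<beta> xs) = \<nu> (map \<phi> xs)"
    using iso unfolding n_lie_iso_def by auto
  define f where "f i = inv_into V \<phi> (?u ! i)" for i
  have u_in: "?u ! i \<in> ?W" if "i < Suc n" for i
    using that by (auto simp: nth_unit_vectors coord_space_def)
  have f: "f i \<in> V" "\<phi> (f i) = ?u ! i" if "i < Suc n" for i
    using u_in[OF that] bij unfolding f_def bij_betw_def
    by (auto intro: inv_into_into f_inv_into_f)
  have C: "coordinates scale V (Suc n) f (\<lambda>i x. \<phi> x i)"
  proof (intro coordinates.intro coordinates_axioms.intro vs sub f(1))
    show "linear_form_on scale V (\<lambda>x. \<phi> x j)" for j
      by (simp add: linear_form_on_def add scale fscale_apply)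
    show "\<phi> (f i) j = (if j = i then 1 else 0)" if "i < Suc n" "j < Suc n" for i j
      using that by (simp add: f nth_unit_vectors)
    show "x = (\<Sum>j<Suc n. scale (\<phi> x j) (f j))" if x: "x \<in> V" for x
    proof (rule inj_onD[of \<phi> V])
      show "inj_on \<phi> V" using bij by (simp add: bij_betw_def)
      interpret vector_space scale by (rule vs)
      show "(\<Sum>j<Suc n. scale (\<phi> x j) (f j)) \<in> V"
        using f(1) by (intro subspace_sum[OF sub] subspace_scale[OF sub]) auto
      have "\<phi> (\<Sum>j<Suc n. scale (\<phi> x j) (f j)) = (\<Sum>j<Suc n. fscale (\<phi> x j) (\<phi> (f j)))"
        by (rule linear_map_sum[OF sub vs _ add scale f(1)]) auto
      also have "\<dots> = \<phi> x"
      proof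
        fix i
        have "(\<Sum>j<Suc n. fscale (\<phi> x j) (\<phi> (f j))) i = (\<Sum>j<Suc n. if j = i then \<phi> x i else 0)"
          unfolding sum_fun_apply by (intro sum.cong refl) (auto simp: fscale_apply f nth_unit_vectors)
        also have "\<dots> = (if i < Suc n then \<phi> x i else 0)" by (simp del: sum.lessThan_Suc)
        also have "\<dots> = \<phi> x i"
          using bij_betwE[OF bij] x by (auto simp: coord_space_def)
        finally show "(\<Sum>j<Suc n. fscale (\<phi> x j) (\<phi> (f j))) i = \<phi> x i" .
      qed
      finally show "\<phi> x = \<phi> (\<Sum>j<Suc n. scale (\<phi> x j) (f j))" by simp
    qed fact
  qed
  interpret bracket_coordinates scale V n f "\<lambda>i x. \<phi> x i" \<beta>
    by (intro bracket_coordinates.intro C bracket_coordinates_axioms.intro M A n)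
  have units: "map \<phi> bs = ?u"
  proof (rule nth_equalityI)
    show "length (map \<phi> bs) = length ?u" by (simp add: unit_vectors_def)
    fix i assume "i < length (map \<phi> bs)"
    then have i: "i < Suc n" by simp
    then show "map \<phi> bs ! i = ?u ! i" using f(2)[OF i] by simp
  qed
  have K: "K i j = (-1) ^ i * \<nu> (omit i ?u) j" if "i \<le> n" for i j
    unfolding K_def hom[OF length_omit_bs[OF refl that] set_omit_bs] units[symmetric]
    by (simp only: map_omit)
  have vals: "\<nu> (omit 1 ?u) = ?u ! 0" "\<nu> (omit 0 ?u) = ?u ! 1"
    "\<And>i. 2 \<le> i \<Longrightarrow> i \<le> n \<Longrightarrow> \<nu> (omit i ?u) = 0"
    using \<nu> unfolding c3_bracket_def Let_def by auto
  have K_val: "K i j = (if i = 0 \<and> j = 1 then 1 else if i = 1 \<and> j = 0 then - 1 else 0)"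
    if "i \<le> n" for i j
  proof -
    consider "i = 0" | "i = 1" | "2 \<le> i" by linarith
    then show ?thesis
    proof cases
      case 1
      then show ?thesis using K[OF that, of j] n vals(2) by (simp add: nth_unit_vectors)
    next
      case 2
      then show ?thesis using K[OF that, of j] n vals(1) by (simp add: nth_unit_vectors)
    next
      case 3
      then show ?thesis using K[OF that, of j] vals(3)[OF 3 that] by simp
    qed
  qed
  show ?thesis unfolding skew_bracket_iff by (simp add: K_val)
qed

section \<open>The classification\<close>

lemma coordinates_of_basis:
  fixes scale :: "'f::field_char_0 \<Rightarrow> 'v::ab_group_add \<Rightarrow> 'v"
  assumes vs: "vector_space scale" and basis: "is_basis scale UNIV es"
  shows "coordinates scale UNIV (length es) ((!) es)
    (\<lambda>i x. module.representation scale (set es) x (es ! i))"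
proof -
  interpret vector_space scale by (rule vs)
  have dist: "distinct es" and ind: "independent (set es)" and span: "span (set es) = UNIV"
    using basis unfolding is_basis_def by auto
  have in_span: "x \<in> span (set es)" for x using span by simp
  show ?thesis
  proof (intro coordinates.intro coordinates_axioms.intro vs subspace_UNIV UNIV_I)
    show "linear_form_on scale UNIV (\<lambda>x. representation (set es) x (es ! j))" for j
      by (simp add: linear_form_on_def representation_add[OF ind in_span in_span]
          representation_scale[OF ind in_span])
    show "representation (set es) (es ! i) (es ! j) = (if j = i then 1 else 0)"
      if "i < length es" "j < length es" for i j
      using that dist representation_basis[OF ind, of "es ! i"] by (auto simp: nth_eq_iff_index_eq)
    show "x = (\<Sum>j<length es. scale (representation (set es) x (es ! j)) (es ! j))" for x
    proof -
      have "(\<Sum>b\<in>set es. scale (representation (set es) x b) b) = x"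
        by (rule sum_representation_eq[OF ind in_span]) auto
      moreover have "bij_betw ((!) es) {..<length es} (set es)"
        using dist by (intro bij_betw_nth) auto
      ultimately show ?thesis
        using sum.reindex_bij_betw[of "(!) es" "{..<length es}" "set es"
            "\<lambda>b. scale (representation (set es) x b) b"] by simp
    qed
  qed
qed

theorem theorem5p3:
  fixes scale :: "complex \<Rightarrow> 'v::ab_group_add \<Rightarrow> 'v"
    and n :: nat and es :: "'v list" and \<mu> :: "'v list \<Rightarrow> 'v"
    and \<Delta> :: "'v \<Rightarrow> ('v \<Rightarrow> complex) list \<Rightarrow> complex"
  assumes "n \<ge> 3"
    and "vector_space scale"
    and "is_basis scale UNIV es" and "length es = n + 1"
    and "multilinear_on scale n UNIV \<mu>" and "alternating_on scale n UNIV \<mu>"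
    and "\<forall>i<n + 1. \<mu> (omit i es) = es ! i"
    and "Vector_Spaces.linear scale fscale \<Delta>" and "range \<Delta> \<subseteq> wedge_power scale n"
  shows "n_lie_bialgebra scale n \<mu> \<Delta> \<longleftrightarrow>
    coalgebra_rank scale n \<Delta> = 0 \<or>
    (coalgebra_rank scale n \<Delta> = 2 \<and> type_c3 fscale n (dual_space scale) (dual_map \<Delta>))"
proof -
  let ?co = "\<lambda>i x. module.representation scale (set es) x (es ! i)"
  have C: "coordinates scale UNIV (Suc n) ((!) es) ?co"
    using coordinates_of_basis[OF assms(2,3)] assms(4) by simp
  have es: "map ((!) es) [0..<Suc n] = es"
    using assms(4) by (metis Suc_eq_plus1 map_nth)
  interpret simple_cobracket scale n "(!) es" ?co \<mu> \<Delta>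
    by (intro simple_cobracket.intro bracket_cobracket.intro bracket_coordinates.intro C
        bracket_coordinates_axioms.intro bracket_cobracket_axioms.intro
        simple_cobracket_axioms.intro, unfold es) (use assms in auto)
  let ?D = "dual_space scale" and ?\<beta> = "dual_map \<Delta>"
  let ?S = "{?\<beta> fs |fs. length fs = n \<and> set fs \<subseteq> ?D}"
  have rank: "coalgebra_rank scale n \<Delta> = dual.dim ?S"
    unfolding coalgebra_rank_def derived_algebra_def by simp
  have S_D: "?S \<subseteq> ?D" using dual.bracket_in by auto
  have rank_0: "coalgebra_rank scale n \<Delta> = 0 \<longleftrightarrow> (\<forall>p\<le>n. \<forall>q\<le>n. dual.K p q = 0)"
  proof
    assume "coalgebra_rank scale n \<Delta> = 0"
    then have S: "?S \<subseteq> {0}" using dual.subset_zero_if_dim_0[OF S_D] rank by simp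
    show "\<forall>p\<le>n. \<forall>q\<le>n. dual.K p q = 0"
    proof (intro allI impI)
      fix p q assume p: "p \<le> n"
      have "?\<beta> (omit p dual.bs) \<in> ?S"
        using dual.length_omit_bs[OF refl p] dual.set_omit_bs by blast
      then have "?\<beta> (omit p dual.bs) = 0" using S by blast
      then show "dual.K p q = 0" by (simp add: dual.K_def)
    qed
  next
    assume K: "\<forall>p\<le>n. \<forall>q\<le>n. dual.K p q = 0"
    have "?\<beta> fs = 0" if fs: "length fs = n" "set fs \<subseteq> ?D" for fs
    proof (rule dual.coordinates_eqI'[OF dual.bracket_in[OF fs] dual.subspace_0[OF dual.subspace_V]])
      fix j assume j: "j \<le> n"
      have "?\<beta> (omit i dual.bs) (es ! j) = 0" if "i \<le> n" for i
        using K j that by (simp add: dual.K_def)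
      then show "?\<beta> fs (es ! j) = 0 (es ! j)"
        using dual.alternating_form_omit_zeroI[OF dual.co_bracket[OF j] refl _ fs] by simp
    qed
    then have "?S \<subseteq> dual.span {}" by auto
    then have "dual.dim ?S \<le> card ({} :: ('v \<Rightarrow> complex) set)" by (rule dual.dim_le_card) simp
    then show "coalgebra_rank scale n \<Delta> = 0" using rank by simp
  qed
  show ?thesis
    unfolding n_lie_bialgebra_iff_skew
  proof (intro iffI; (elim conjE disjE)?)
    assume L: "n_lie_algebra fscale n ?D ?\<beta>" and "skew_bracket fscale n ?D ?\<beta>"
    then have skew: "\<forall>p\<le>n. \<forall>q\<le>n. dual.K p q = - dual.K q p"
      unfolding dual.skew_bracket_iff by blast
    show "coalgebra_rank scale n \<Delta> = 0 \<or>
      (coalgebra_rank scale n \<Delta> = 2 \<and> type_c3 fscale n ?D ?\<beta>)"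
    proof (cases "\<forall>p\<le>n. \<forall>q\<le>n. dual.K p q = 0")
      case False
      then obtain p q where "p \<le> n" "q \<le> n" "dual.K p q \<noteq> 0" by blast
      from dual.c3_if_skew[OF n_ge_2 L skew this] show ?thesis
        unfolding coalgebra_rank_def by blast
    qed (use rank_0 in blast)
  next
    assume "coalgebra_rank scale n \<Delta> = 0"
    then have K: "dual.K p q = 0" if "p \<le> n" "q \<le> n" for p q using rank_0 that by blast
    show "n_lie_algebra fscale n ?D ?\<beta> \<and> skew_bracket fscale n ?D ?\<beta>"
      unfolding dual.n_lie_algebra_iff_filippov_quadric dual.skew_bracket_iff
      by (simp add: dual.filippov_quadric_def K)
  next
    assume c3: "type_c3 fscale n ?D ?\<beta>"
    then show "n_lie_algebra fscale n ?D ?\<beta> \<and> skew_bracket fscale n ?D ?\<beta>"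
      using skew_bracket_if_type_c3[OF c3 n_pos] unfolding type_c3_def by blast
  qed
qed

end
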